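(* For any mixing one-dimensional subshift of finite type $X$, we have $\mathrm{SIAut}(X)=\mathfrak L(X)=\hat{\mathfrak L}(X)$.
   Context: A one-dimensional subshift is a nonempty closed shift-invariant set $X\subset\Sigma^{\mathbb Z}$, $\Sigma$ a finite alphabet, with the shift $\sigma(x)_i=x_{i+1}$. It is a subshift of finite type (SFT) if $X=\bigcap_{n\in\mathbb Z}\sigma^n(C)$ for some clopen $C\subset\Sigma^{\mathbb Z}$. The edge shift of a finite directed multigraph $(V,E)$ (every vertex having positive in- and out-degree) is the set of bi-infinite paths $p:\mathbb Z\to E$ in which the edge $p(n)$ ends where $p(n+1)$ begins; every SFT is topologically conjugate to an edge shift. An SFT is mixing if it is topologically conjugate to an edge shift whose adjacency matrix is primitive (some power has all entries positive); equivalently, it is topologically mixing. If $(X,\sigma)$ is a mixing SFT then so is $(X,\sigma^n)$ for every $n\ge1$ (up to topological conjugacy). $\mathrm{Aut}(X,\sigma^n)$ is the group of homeomorphisms $X\to X$ commuting with $\sigma^n$, and $\mathrm{SAut}(X)=\bigcup_{n\ge1}\mathrm{Aut}(X,\sigma^n)$. Inertness: an automorphism of a mixing SFT is inert if it acts trivially on Krieger's dimension group. Concretely, for an edge shift $Y$ with vertex set $V$: an $m$-ray is a set $R(x,m)=\{y\in Y: y_i=x_i\ \forall i\le m\}$ ($x\in Y$), which is said to end at the terminal vertex of $x_m$; an $m$-beam is a finite (possibly empty) union of $m$-rays; every $m$-beam is an $m'$-beam for all $m'\ge m$. For an $m$-beam $U$ let $v_{U,m}\in\mathbb Z^V$ have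 $I$-th entry the number of $m$-rays contained in $U$ ending at $I$. Two beams $U,U'$ are equivalent if $v_{U,m}=v_{U',m}$ for some $m$ for which both are $m$-beams. The classes of beams form the positive cone generating the dimension group, and an automorphism $f$ of $Y$ acts by $[U]\mapsto[f(U)]$; so $f$ is inert iff $f(U)$ is equivalent to $U$ for every beam $U$. Inertness of an automorphism of an arbitrary mixing SFT is defined by conjugating to an edge shift (the choice does not matter); for $f\in\mathrm{Aut}(X,\sigma^n)$ this is applied to the mixing SFT $(X,\sigma^n)$. $\mathrm{SIAut}(X)$ is the subgroup of $\mathrm{SAut}(X)$ generated by all inert automorphisms of $(X,\sigma^n)$, over all $n\ge1$. Gates: for $D\subset\mathbb Z$, $x|D$ is the restriction and $X|D=\{x|D:x\in X\}$. A gate on $X$ is a homeomorphism $\chi:X\to X$ for which there is a finite $N\subset\mathbb Z$ with $\chi(x)_i=x_i$ for all $x\in X$, $i\notin N$. A finite $N$ is a strong neighborhood of $\chi$ if moreover there is $\hat\chi:X|N\to X|N$ with $\chi(x)|N=\hat\chi(x|N)$ for all $x$; every gate has one, and $\hat\chi$ is then a permutation of $X|N$. The gate $\chi$ is even if it has a strong neighborhood $N$ such that for every $y\in X|(\mathbb Z\setminus N)$ the map $\hat\chi$ restricts to an even permutation of $\{x|N: x\in X,\ x|(\mathbb Z\setminus N)=y\}$. For $k\in\mathbb Z$ put $\chi^k=\sigma^{-k}\circ\chi\circ\sigma^k$ (not an iterate). For $S\subset\mathbb Z$ say $\chi^S$ commutes if $\chi^s,\chi^t$ commute for all $s,t\in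 S$; then $\chi^S$ is the pointwise limit, over finite $F\subset S$ ordered by inclusion, of the compositions $\prod_{s\in F}\chi^s$ (it always exists). A gate lattice is a map $\chi^{n\mathbb Z+k}$ with $\chi$ a gate, $n\ge1$, $k\in\mathbb Z$, and $\chi^{n\mathbb Z+k}$ commuting; it is even if $\chi$ is even. $\mathfrak L(X)$ is the group generated by gate lattices, $\hat{\mathfrak L}(X)$ the group generated by even gate lattices. *)

theory Defs
  imports
    "HOL-Analysis.Function_Topology"
    "HOL-Analysis.Abstract_Limits"
    "HOL-Algebra.Bij"
    "HOL-Algebra.Generated_Groups"
    "HOL-Combinatorics.Permutations"
    "HOL-Combinatorics.Orbits"
    "Graph_Theory.Digraph"
begin

section \<open>Subshifts\<close>

text \<open>A configuration is a function \<open>int \<Rightarrow> 'a\<close>. On a set of configurations over an alphabet \<open>A\<close>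
  the topology below is the one induced from the product of discrete copies of \<open>A\<close>; it does not
  depend on \<open>A\<close>, so the alphabet is only mentioned where its finiteness matters.\<close>

definition config_topology :: "(int \<Rightarrow> 'a) set \<Rightarrow> (int \<Rightarrow> 'a) topology" where
  "config_topology X = subtopology (product_topology (\<lambda>_. discrete_topology UNIV) UNIV) X"

text \<open>\<open>shift k\<close> is the \<open>k\<close>-th power of the shift map, for any integer \<open>k\<close>.\<close>

definition shift :: "int \<Rightarrow> (int \<Rightarrow> 'a) \<Rightarrow> int \<Rightarrow> 'a" where
  "shift k x = (\<lambda>i. x (i + k))"

definition full_shift :: "'a set \<Rightarrow> (int \<Rightarrow> 'a) set" where
  "full_shift A = {x. \<forall>i. x i \<in> A}"

definition subshift :: "'a set \<Rightarrow> (int \<Rightarrow> 'a) set \<Rightarrow> bool" where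
  "subshift A X \<longleftrightarrow> finite A \<and> X \<noteq> {} \<and> closedin (config_topology (full_shift A)) X \<and> shift 1 ` X = X"

definition SFT :: "'a set \<Rightarrow> (int \<Rightarrow> 'a) set \<Rightarrow> bool" where
  "SFT A X \<longleftrightarrow> subshift A X \<and>
     (\<exists>C. openin (config_topology (full_shift A)) C \<and> closedin (config_topology (full_shift A)) C \<and>
          X = (\<Inter>n. shift n ` C))"

definition conjugacy ::
  "(int \<Rightarrow> 'a) set \<Rightarrow> ((int \<Rightarrow> 'a) \<Rightarrow> int \<Rightarrow> 'a) \<Rightarrow> (int \<Rightarrow> 'b) set \<Rightarrow> ((int \<Rightarrow> 'b) \<Rightarrow> int \<Rightarrow> 'b)
     \<Rightarrow> ((int \<Rightarrow> 'a) \<Rightarrow> int \<Rightarrow> 'b) \<Rightarrow> bool" where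
  "conjugacy X S Y T h \<longleftrightarrow>
     homeomorphic_map (config_topology X) (config_topology Y) h \<and> (\<forall>x\<in>X. h (S x) = T (h x))"


section \<open>Edge shifts\<close>

definition essential_graph :: "('v, 'e) pre_digraph \<Rightarrow> bool" where
  "essential_graph G \<longleftrightarrow> fin_digraph G \<and> (\<forall>v\<in>verts G. in_degree G v > 0 \<and> out_degree G v > 0)"

definition edge_shift :: "('v, 'e) pre_digraph \<Rightarrow> (int \<Rightarrow> 'e) set" where
  "edge_shift G = {p. \<forall>n. p n \<in> arcs G \<and> head G (p n) = tail G (p (n + 1))}"

definition adjacency :: "('v, 'e) pre_digraph \<Rightarrow> 'v \<Rightarrow> 'v \<Rightarrow> nat" where
  "adjacency G u v = card {e \<in> arcs G. tail G e = u \<and> head G e = v}"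

text \<open>Powers of a matrix with rows and columns indexed by a finite set \<open>V\<close>.\<close>

fun mat_power :: "'v set \<Rightarrow> ('v \<Rightarrow> 'v \<Rightarrow> nat) \<Rightarrow> nat \<Rightarrow> 'v \<Rightarrow> 'v \<Rightarrow> nat" where
  "mat_power V M 0 u v = (if u = v then 1 else 0)"
| "mat_power V M (Suc k) u v = (\<Sum>w\<in>V. mat_power V M k u w * M w v)"

definition primitive :: "'v set \<Rightarrow> ('v \<Rightarrow> 'v \<Rightarrow> nat) \<Rightarrow> bool" where
  "primitive V M \<longleftrightarrow> (\<exists>k\<ge>1. \<forall>u\<in>V. \<forall>v\<in>V. mat_power V M k u v > 0)"

text \<open>Up to isomorphism every finite graph has its vertices and edges in \<open>nat\<close>, so quantifying over
  graphs of type \<open>(nat, nat) pre_digraph\<close> is no restriction.\<close>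

definition mixing_SFT :: "'a set \<Rightarrow> (int \<Rightarrow> 'a) set \<Rightarrow> bool" where
  "mixing_SFT A X \<longleftrightarrow> SFT A X \<and>
     (\<exists>(G :: (nat, nat) pre_digraph) h. essential_graph G \<and> primitive (verts G) (adjacency G) \<and>
        conjugacy X (shift 1) (edge_shift G) (shift 1) h)"


section \<open>Automorphisms and inertness\<close>

text \<open>Self-maps of \<open>X\<close> are taken extensional, so that they are elements of \<^const>\<open>BijGroup\<close> and
  equality of maps is equality on \<open>X\<close>.\<close>

definition homeos :: "(int \<Rightarrow> 'a) set \<Rightarrow> ((int \<Rightarrow> 'a) \<Rightarrow> int \<Rightarrow> 'a) set" where
  "homeos X = {f \<in> extensional X. homeomorphic_map (config_topology X) (config_topology X) f}"

definition Aut :: "(int \<Rightarrow> 'a) set \<Rightarrow> nat \<Rightarrow> ((int \<Rightarrow> 'a) \<Rightarrow> int \<Rightarrow> 'a) set" where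
  "Aut X n = {f \<in> homeos X. \<forall>x\<in>X. f (shift (int n) x) = shift (int n) (f x)}"

definition SAut :: "(int \<Rightarrow> 'a) set \<Rightarrow> ((int \<Rightarrow> 'a) \<Rightarrow> int \<Rightarrow> 'a) monoid" where
  "SAut X = (BijGroup X)\<lparr>carrier := (\<Union>n\<in>{1..}. Aut X n)\<rparr>"

definition ray :: "(int \<Rightarrow> 'e) set \<Rightarrow> (int \<Rightarrow> 'e) \<Rightarrow> int \<Rightarrow> (int \<Rightarrow> 'e) set" where
  "ray Y x m = {y \<in> Y. \<forall>i\<le>m. y i = x i}"

definition beam :: "(int \<Rightarrow> 'e) set \<Rightarrow> int \<Rightarrow> (int \<Rightarrow> 'e) set \<Rightarrow> bool" where
  "beam Y m U \<longleftrightarrow> (\<exists>F. finite F \<and> F \<subseteq> Y \<and> U = (\<Union>x\<in>F. ray Y x m))"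

text \<open>The set of rays counted here is finite whenever \<open>U\<close> is an \<open>m\<close>-beam, since distinct
  \<open>m\<close>-rays are disjoint.\<close>

definition beam_vector :: "('v, 'e) pre_digraph \<Rightarrow> (int \<Rightarrow> 'e) set \<Rightarrow> int \<Rightarrow> 'v \<Rightarrow> int" where
  "beam_vector G U m v =
     int (card {ray (edge_shift G) x m | x. x \<in> edge_shift G \<and> ray (edge_shift G) x m \<subseteq> U \<and>
                                           head G (x m) = v})"

definition beam_equiv ::
  "('v, 'e) pre_digraph \<Rightarrow> (int \<Rightarrow> 'e) set \<Rightarrow> (int \<Rightarrow> 'e) set \<Rightarrow> bool" where
  "beam_equiv G U U' \<longleftrightarrow>
     (\<exists>m. beam (edge_shift G) m U \<and> beam (edge_shift G) m U' \<and>
          (\<forall>v\<in>verts G. beam_vector G U m v = beam_vector G U' m v))"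

definition inert_edge :: "('v, 'e) pre_digraph \<Rightarrow> ((int \<Rightarrow> 'e) \<Rightarrow> int \<Rightarrow> 'e) \<Rightarrow> bool" where
  "inert_edge G f \<longleftrightarrow> (\<forall>U. (\<exists>m. beam (edge_shift G) m U) \<longrightarrow> beam_equiv G (f ` U) U)"

text \<open>Inertness does not depend on the edge shift presenting \<open>(X, shift n)\<close>, nor on the conjugacy.\<close>

definition inert :: "(int \<Rightarrow> 'a) set \<Rightarrow> nat \<Rightarrow> ((int \<Rightarrow> 'a) \<Rightarrow> int \<Rightarrow> 'a) \<Rightarrow> bool" where
  "inert X n f \<longleftrightarrow> f \<in> Aut X n \<and>
     (\<exists>(G :: (nat, nat) pre_digraph) h. essential_graph G \<and>
        conjugacy X (shift (int n)) (edge_shift G) (shift 1) h \<and>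
        inert_edge G (h \<circ> f \<circ> inv_into X h))"

definition SIAut :: "(int \<Rightarrow> 'a) set \<Rightarrow> ((int \<Rightarrow> 'a) \<Rightarrow> int \<Rightarrow> 'a) set" where
  "SIAut X = generate (SAut X) {f. \<exists>n\<ge>1. inert X n f}"


section \<open>Gates and gate lattices\<close>

definition patterns :: "(int \<Rightarrow> 'a) set \<Rightarrow> int set \<Rightarrow> (int \<Rightarrow> 'a) set" where
  "patterns X D = (\<lambda>x. restrict x D) ` X"

definition gate :: "(int \<Rightarrow> 'a) set \<Rightarrow> ((int \<Rightarrow> 'a) \<Rightarrow> int \<Rightarrow> 'a) \<Rightarrow> bool" where
  "gate X \<chi> \<longleftrightarrow> \<chi> \<in> homeos X \<and> (\<exists>N. finite N \<and> (\<forall>x\<in>X. \<forall>i. i \<notin> N \<longrightarrow> \<chi> x i = x i))"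

text \<open>\<open>\<phi>\<close> is the induced map on patterns; its values on \<open>patterns X N\<close> are determined by \<open>\<chi>\<close>
  and \<open>N\<close>.\<close>

definition strong_neighborhood ::
  "(int \<Rightarrow> 'a) set \<Rightarrow> ((int \<Rightarrow> 'a) \<Rightarrow> int \<Rightarrow> 'a) \<Rightarrow> int set \<Rightarrow> ((int \<Rightarrow> 'a) \<Rightarrow> int \<Rightarrow> 'a) \<Rightarrow> bool" where
  "strong_neighborhood X \<chi> N \<phi> \<longleftrightarrow> finite N \<and> (\<forall>x\<in>X. \<forall>i. i \<notin> N \<longrightarrow> \<chi> x i = x i) \<and>
     \<phi> \<in> patterns X N \<rightarrow> patterns X N \<and> (\<forall>x\<in>X. restrict (\<chi> x) N = \<phi> (restrict x N))"

definition fillings :: "(int \<Rightarrow> 'a) set \<Rightarrow> int set \<Rightarrow> (int \<Rightarrow> 'a) \<Rightarrow> (int \<Rightarrow> 'a) set" where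
  "fillings X N y = {restrict x N | x. x \<in> X \<and> restrict x (- N) = y}"

definition even_gate :: "(int \<Rightarrow> 'a) set \<Rightarrow> ((int \<Rightarrow> 'a) \<Rightarrow> int \<Rightarrow> 'a) \<Rightarrow> bool" where
  "even_gate X \<chi> \<longleftrightarrow> gate X \<chi> \<and>
     (\<exists>N \<phi>. strong_neighborhood X \<chi> N \<phi> \<and>
        (\<forall>y\<in>patterns X (- N). perm_restrict \<phi> (fillings X N y) permutes fillings X N y \<and>
                               evenperm (perm_restrict \<phi> (fillings X N y))))"

definition gate_translate ::
  "(int \<Rightarrow> 'a) set \<Rightarrow> ((int \<Rightarrow> 'a) \<Rightarrow> int \<Rightarrow> 'a) \<Rightarrow> int \<Rightarrow> (int \<Rightarrow> 'a) \<Rightarrow> int \<Rightarrow> 'a" where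
  "gate_translate X \<chi> k = restrict (shift (- k) \<circ> \<chi> \<circ> shift k) X"

definition translates_commute ::
  "(int \<Rightarrow> 'a) set \<Rightarrow> ((int \<Rightarrow> 'a) \<Rightarrow> int \<Rightarrow> 'a) \<Rightarrow> int set \<Rightarrow> bool" where
  "translates_commute X \<chi> S \<longleftrightarrow>
     (\<forall>s\<in>S. \<forall>t\<in>S. compose X (gate_translate X \<chi> s) (gate_translate X \<chi> t) =
                   compose X (gate_translate X \<chi> t) (gate_translate X \<chi> s))"

text \<open>The composition over a finite set, evaluated at a point. The factors are composed in
  increasing order of index; this is only used when they commute, so the order is immaterial.\<close>

definition finite_gate_product ::
  "(int \<Rightarrow> 'a) set \<Rightarrow> ((int \<Rightarrow> 'a) \<Rightarrow> int \<Rightarrow> 'a) \<Rightarrow> int set \<Rightarrow> (int \<Rightarrow> 'a) \<Rightarrow> int \<Rightarrow> 'a" where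
  "finite_gate_product X \<chi> F x = foldr (gate_translate X \<chi>) (sorted_list_of_set F) x"

text \<open>\<open>gate_product X \<chi> S g\<close> states that \<open>g\<close> is the infinite composition of the translates of \<open>\<chi>\<close>
  over \<open>S\<close>; there is at most one such \<open>g\<close>, as the topology is Hausdorff and \<open>g\<close> extensional.\<close>

definition gate_product ::
  "(int \<Rightarrow> 'a) set \<Rightarrow> ((int \<Rightarrow> 'a) \<Rightarrow> int \<Rightarrow> 'a) \<Rightarrow> int set \<Rightarrow> ((int \<Rightarrow> 'a) \<Rightarrow> int \<Rightarrow> 'a) \<Rightarrow> bool" where
  "gate_product X \<chi> S g \<longleftrightarrow> translates_commute X \<chi> S \<and> g \<in> extensional X \<and>
     (\<forall>x\<in>X. limitin (config_topology X) (\<lambda>F. finite_gate_product X \<chi> F x) (g x)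
              (finite_subsets_at_top S))"

definition progression :: "nat \<Rightarrow> int \<Rightarrow> int set" where
  "progression n k = {int n * z + k | z. True}"

definition gate_lattices :: "(int \<Rightarrow> 'a) set \<Rightarrow> ((int \<Rightarrow> 'a) \<Rightarrow> int \<Rightarrow> 'a) set" where
  "gate_lattices X = {g. \<exists>\<chi> n k. gate X \<chi> \<and> n \<ge> 1 \<and> gate_product X \<chi> (progression n k) g}"

definition even_gate_lattices :: "(int \<Rightarrow> 'a) set \<Rightarrow> ((int \<Rightarrow> 'a) \<Rightarrow> int \<Rightarrow> 'a) set" where
  "even_gate_lattices X = {g. \<exists>\<chi> n k. even_gate X \<chi> \<and> n \<ge> 1 \<and> gate_product X \<chi> (progression n k) g}"

definition gate_lattice_group :: "(int \<Rightarrow> 'a) set \<Rightarrow> ((int \<Rightarrow> 'a) \<Rightarrow> int \<Rightarrow> 'a) set" where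
  "gate_lattice_group X = generate (BijGroup X) (gate_lattices X)"

definition even_gate_lattice_group :: "(int \<Rightarrow> 'a) set \<Rightarrow> ((int \<Rightarrow> 'a) \<Rightarrow> int \<Rightarrow> 'a) set" where
  "even_gate_lattice_group X = generate (BijGroup X) (even_gate_lattices X)"

end

theory Submission
  imports Defs "HOL-Analysis.Abstract_Topological_Spaces"
begin

text \<open>
  The inclusion of \<^const>\<open>even_gate_lattice_group\<close> in \<^const>\<open>gate_lattice_group\<close> is immediate, and
  two of the others rest on one elementary observation: the lattice of a gate over
  \<open>n\<int> + k\<close> is the product of its lattices over the residue classes modulo any multiple of \<open>n\<close>
  (\<open>lattice_progression_split\<close>).

  Gate lattices are inert up to this splitting. Present \<open>X\<close> as an edge shift. Once the period \<open>N\<close>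
  exceeds the length of an interval on which the gate lives, cut the bi-infinite paths into blocks
  of length \<open>N\<close>, each containing the interval of one translate of the gate. Blocks are the edges of
  a graph presenting \<open>(X, \<sigma>\<^sup>N)\<close>, and the gate lattice permutes these edges coordinatewise, keeping
  both end vertices. Such a map sends rays to rays with the same end and preserves every beam vector
  (\<open>gate_lattice_in_SIAut\<close>).

  Gate lattices are products of even ones by a pigeonhole argument. The parity of a gate on the
  fillings of a long interval is a function of the surrounding context, and by the SFT property only
  boundedly many cells of the context matter. So among sufficiently many translates of a gate,
  all inside one long interval, two have the same parity function, and their product is an even gate
  (\<open>even_translate_pair\<close>). If these translates are by \<open>s < t\<close> and \<open>d = t - s\<close>, the lattice of the
  gate over \<open>d\<int> + s\<close> is a lattice of the product gate with period \<open>2d\<close> (\<open>lattice_pair\<close>).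

  An inert \<open>f\<close> is a product of two gate lattices because it can be cut. Inertness says that, for a
  ray \<open>U\<close>, the rays making up \<open>f U\<close> and those making up \<open>U\<close> can be matched with equal end vertices.
  Composing \<open>f\<close> with this exchange of left halves maps \<open>U\<close> to itself and agrees with \<open>f\<close> far to the
  right. Doing so for one left half per vertex gives a homeomorphism \<open>c\<close> that is the identity on
  the left and equals \<open>f\<close> on the right (\<open>inert_cut\<close>). If \<open>a\<^sub>j\<close> is \<open>c\<close> moved to position \<open>j p\<close>, where
  \<open>p\<close> is a large multiple of the period of \<open>f\<close>, then \<open>a\<^sub>j a\<^sub>j\<^sub>+\<^sub>1\<inverse>\<close> is a gate that applies \<open>f\<close> between
  two positions, and \<open>f\<close> is the telescoping ordered product of these gates over all \<open>j\<close>. Only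
  neighbouring factors fail to commute. So the factors with even \<open>j\<close> can be collected on one side at
  the price of conjugating those with odd \<open>j\<close> by a neighbour, and each collection is a gate lattice
  (\<open>cut_decomposition\<close>).
\<close>

section \<open>Configuration spaces in terms of finite windows\<close>

definition agree :: "int set \<Rightarrow> (int \<Rightarrow> 'a) \<Rightarrow> (int \<Rightarrow> 'a) \<Rightarrow> bool" where
  "agree D x y \<longleftrightarrow> (\<forall>i\<in>D. x i = y i)"

lemma agreeI: "(\<And>i. i \<in> D \<Longrightarrow> x i = y i) \<Longrightarrow> agree D x y"
  by (simp add: agree_def)

lemma agreeD: "agree D x y \<Longrightarrow> i \<in> D \<Longrightarrow> x i = y i"
  by (simp add: agree_def)

lemma agree_mono: "agree D x y \<Longrightarrow> E \<subseteq> D \<Longrightarrow> agree E x y"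
  by (auto simp: agree_def)

lemma agree_sym: "agree D x y \<Longrightarrow> agree D y x"
  by (simp add: agree_def)

lemma agree_trans: "agree D x y \<Longrightarrow> agree D y z \<Longrightarrow> agree D x z"
  by (simp add: agree_def)

lemma agree_refl [simp]: "agree D x x"
  by (simp add: agree_def)

lemma agree_window_mono: "agree {-r'..r'} x y \<Longrightarrow> r \<le> r' \<Longrightarrow> agree {-r..r} x (y :: int \<Rightarrow> 'a)"
  by (erule agree_mono) auto

lemma topspace_config [simp]: "topspace (config_topology X) = X"
  by (simp add: config_topology_def)

lemma finite_subset_window:
  fixes D :: "int set"
  assumes "finite D" shows "\<exists>r\<ge>0. D \<subseteq> {-r..r}"
proof (intro exI conjI)
  show "0 \<le> Max (insert 0 (abs ` D))" using assms by simp
  show "D \<subseteq> {- Max (insert 0 (abs ` D))..Max (insert 0 (abs ` D))}"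
  proof
    fix d assume "d \<in> D"
    then have "\<bar>d\<bar> \<le> Max (insert 0 (abs ` D))" using assms by (intro Max_ge) auto
    then show "d \<in> {- Max (insert 0 (abs ` D))..Max (insert 0 (abs ` D))}" by auto
  qed
qed

lemma openin_config:
  "openin (config_topology X) U \<longleftrightarrow>
     U \<subseteq> X \<and> (\<forall>x\<in>U. \<exists>r. \<forall>y\<in>X. agree {-r..r} x y \<longrightarrow> y \<in> U)"
proof (intro iffI conjI ballI)
  assume U: "openin (config_topology X) U"
  then obtain T where T: "openin (product_topology (\<lambda>_. discrete_topology UNIV) UNIV) T" "U = T \<inter> X"
    unfolding config_topology_def openin_subtopology by auto
  then show "U \<subseteq> X" by auto
  fix x assume "x \<in> U"
  then obtain B where B: "finite {i::int. B i \<noteq> (UNIV::'a set)}" "x \<in> PiE UNIV B" "PiE UNIV B \<subseteq> T"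
    using T unfolding openin_product_topology_alt by fastforce
  obtain r where r: "{i::int. B i \<noteq> (UNIV::'a set)} \<subseteq> {-r..r}"
    using finite_subset_window[OF B(1)] by auto
  have "y \<in> U" if "y \<in> X" "agree {-r..r} x y" for y
  proof -
    have "y i \<in> B i" for i
    proof (cases "B i = UNIV")
      case False
      then have "i \<in> {-r..r}" using r by auto
      then have "x i = y i" using that(2) by (rule agreeD[rotated])
      then show ?thesis using B(2) by (metis PiE_mem UNIV_I)
    qed simp
    then show ?thesis using B(3) T(2) that(1) by auto
  qed
  then show "\<exists>r. \<forall>y\<in>X. agree {-r..r} x y \<longrightarrow> y \<in> U" by blast
next
  assume U: "U \<subseteq> X \<and> (\<forall>x\<in>U. \<exists>r. \<forall>y\<in>X. agree {-r..r} x y \<longrightarrow> y \<in> U)"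
  then have "\<forall>x\<in>U. \<exists>r. \<forall>y\<in>X. agree {-r..r} x y \<longrightarrow> y \<in> U" by blast
  from bchoice[OF this]
  obtain r where r: "\<And>x y. x \<in> U \<Longrightarrow> y \<in> X \<Longrightarrow> agree {-r x..r x} x y \<Longrightarrow> y \<in> U"
    by blast
  define B where "B x = PiE UNIV (\<lambda>i. if i \<in> {-r x..r x} then {x i} else (UNIV::'a set))" for x
  have "openin (product_topology (\<lambda>_. discrete_topology UNIV) UNIV) (B x)" for x
    unfolding B_def
  proof (rule product_topology_basis)
    show "finite {i. (if i \<in> {-r x..r x} then {x i} else (UNIV::'a set)) \<noteq> topspace (discrete_topology UNIV)}"
      by (rule finite_subset[of _ "{-r x..r x}"]) auto
  qed simp
  then have "openin (product_topology (\<lambda>_. discrete_topology UNIV) UNIV) (\<Union>x\<in>U. B x)"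
    by blast
  moreover have "U = (\<Union>x\<in>U. B x) \<inter> X"
  proof (intro equalityI subsetI)
    fix y assume "y \<in> U" 
    moreover have "y \<in> B y" by (auto simp: B_def)
    ultimately show "y \<in> (\<Union>x\<in>U. B x) \<inter> X" using U by blast
  next
    fix y assume "y \<in> (\<Union>x\<in>U. B x) \<inter> X"
    then obtain x where x: "x \<in> U" "y \<in> B x" "y \<in> X" by auto
    have "agree {-r x..r x} x y"
    proof (rule agreeI)
      fix i assume i: "i \<in> {-r x..r x}"
      have "y i \<in> (if i \<in> {-r x..r x} then {x i} else UNIV)"
        using PiE_mem[OF x(2)[unfolded B_def] UNIV_I] .
      then show "x i = y i" using i by simp
    qed
    then show "y \<in> U" by (rule r[OF x(1,3)])
  qed
  ultimately show "openin (config_topology X) U"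
    unfolding config_topology_def openin_subtopology by blast
qed

lemma common_window:
  fixes P :: "int \<Rightarrow> int \<Rightarrow> bool"
  assumes "finite D" "\<And>i. i \<in> D \<Longrightarrow> \<exists>r. P i r" "\<And>i r r'. P i r \<Longrightarrow> r \<le> r' \<Longrightarrow> P i r'"
  shows "\<exists>r\<ge>0. \<forall>i\<in>D. P i r"
  using assms(1,2)
proof (induction D)
  case (insert d D)
  have "\<exists>r\<ge>0. \<forall>i\<in>D. P i r" by (rule insert.IH) (use insert.prems in simp)
  then obtain r1 where "\<forall>i\<in>D. P i r1" "r1 \<ge> 0" by blast
  moreover obtain r2 where "P d r2" using insert.prems by auto
  ultimately have "\<forall>i\<in>insert d D. P i (max r1 r2)"
    using assms(3)[of _ r1 "max r1 r2"] assms(3)[of _ r2 "max r1 r2"] by simp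
  then show ?case using \<open>r1 \<ge> 0\<close> by (intro exI[of _ "max r1 r2"]) simp
qed auto

lemma continuous_map_config:
  "continuous_map (config_topology X) (config_topology Y) g \<longleftrightarrow>
     g \<in> X \<rightarrow> Y \<and> (\<forall>i. \<forall>x\<in>X. \<exists>r. \<forall>y\<in>X. agree {-r..r} x y \<longrightarrow> g x i = g y i)"
proof (intro iffI conjI allI ballI)
  assume g: "continuous_map (config_topology X) (config_topology Y) g"
  then show gXY: "g \<in> X \<rightarrow> Y" by (auto simp: continuous_map_def)
  fix i x assume "x \<in> X"
  have "agree {-\<bar>i\<bar>..\<bar>i\<bar>} y z \<Longrightarrow> y i = z i" for y z :: "int \<Rightarrow> 'b" by (erule agreeD) auto
  then have "openin (config_topology Y) {y \<in> Y. g x i = y i}"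
    unfolding openin_config by (fastforce intro!: exI[of _ "\<bar>i\<bar>"])
  then have "openin (config_topology X) {z \<in> X. g z \<in> {y \<in> Y. g x i = y i}}"
    using g by (auto simp: continuous_map_def)
  moreover have "x \<in> {z \<in> X. g z \<in> {y \<in> Y. g x i = y i}}" using \<open>x \<in> X\<close> gXY by auto
  ultimately obtain r where "\<forall>y\<in>X. agree {-r..r} x y \<longrightarrow> y \<in> {z \<in> X. g z \<in> {y \<in> Y. g x i = y i}}"
    unfolding openin_config by blast
  then show "\<exists>r. \<forall>y\<in>X. agree {-r..r} x y \<longrightarrow> g x i = g y i" by blast
next
  assume g: "g \<in> X \<rightarrow> Y \<and> (\<forall>i. \<forall>x\<in>X. \<exists>r. \<forall>y\<in>X. agree {-r..r} x y \<longrightarrow> g x i = g y i)"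
  show "continuous_map (config_topology X) (config_topology Y) g"
    unfolding continuous_map_def
  proof (intro conjI allI impI)
    fix U assume U: "openin (config_topology Y) U"
    have "\<exists>r. \<forall>y\<in>X. agree {-r..r} x y \<longrightarrow> g y \<in> U" if x: "x \<in> X" "g x \<in> U" for x
    proof -
      obtain r where r: "\<And>y. y \<in> Y \<Longrightarrow> agree {-r..r} (g x) y \<Longrightarrow> y \<in> U"
        using U x unfolding openin_config by blast
      have "\<exists>s\<ge>0. \<forall>i\<in>{-r..r}. \<forall>y\<in>X. agree {-s..s} x y \<longrightarrow> g x i = g y i"
      proof (rule common_window)
        show "\<exists>r. \<forall>y\<in>X. agree {-r..r} x y \<longrightarrow> g x i = g y i" for i using g x by blast
      qed (simp, meson agree_window_mono)
      then obtain s where s: "\<forall>i\<in>{-r..r}. \<forall>y\<in>X. agree {-s..s} x y \<longrightarrow> g x i = g y i"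
        by blast
      have "g y \<in> U" if y: "y \<in> X" "agree {-s..s} x y" for y
      proof (rule r)
        show "g y \<in> Y" using g y by auto
        show "agree {-r..r} (g x) (g y)" using s y by (intro agreeI) blast
      qed
      then show ?thesis by blast
    qed
    then show "openin (config_topology X) {x \<in> topspace (config_topology X). g x \<in> U}"
      unfolding openin_config by simp
  qed (use g in auto)
qed

definition window_continuous :: "(int \<Rightarrow> 'a) set \<Rightarrow> ((int \<Rightarrow> 'a) \<Rightarrow> int \<Rightarrow> 'b) \<Rightarrow> bool" where
  "window_continuous X g \<longleftrightarrow>
     (\<forall>i. \<exists>r. \<forall>x\<in>X. \<forall>y\<in>X. agree {-r..r} x y \<longrightarrow> g x i = g y i)"

lemma window_continuous_finite:
  assumes "window_continuous X g" "finite D"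
  obtains r where "r \<ge> 0"
    "\<And>x y. x \<in> X \<Longrightarrow> y \<in> X \<Longrightarrow> agree {-r..r} x y \<Longrightarrow> agree D (g x) (g y)"
proof -
  have "\<exists>r\<ge>0. \<forall>i\<in>D. \<forall>x\<in>X. \<forall>y\<in>X. agree {-r..r} x y \<longrightarrow> g x i = g y i"
  proof (rule common_window[OF assms(2)])
    show "\<exists>r. \<forall>x\<in>X. \<forall>y\<in>X. agree {-r..r} x y \<longrightarrow> g x i = g y i" for i
      using assms(1) unfolding window_continuous_def by blast
  qed (meson agree_window_mono)
  then show ?thesis using that unfolding agree_def[of D] by blast
qed

lemma window_continuousE:
  assumes "window_continuous X g"
  obtains r where "r \<ge> 0" "\<And>x y. x \<in> X \<Longrightarrow> y \<in> X \<Longrightarrow> agree {-r..r} x y \<Longrightarrow> g x i = g y i"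
  using window_continuous_finite[OF assms, of "{i}"] by (auto simp: agree_def[of "{i}"])

text \<open>Compactness makes the windows of a continuous map independent of the point.\<close>

lemma compact_window_continuous:
  assumes X: "compact_space (config_topology X)"
    and g: "continuous_map (config_topology X) (config_topology Y) g"
  shows "window_continuous X g"
  unfolding window_continuous_def
proof
  fix i
  have "\<forall>x\<in>X. \<exists>r. \<forall>y\<in>X. agree {-r..r} x y \<longrightarrow> g x i = g y i"
    using g unfolding continuous_map_config by blast
  from bchoice[OF this]
  obtain r where r: "\<And>x y. x \<in> X \<Longrightarrow> y \<in> X \<Longrightarrow> agree {-r x..r x} x y \<Longrightarrow> g x i = g y i"
    by blast
  define B where "B x = {y \<in> X. agree {-r x..r x} x y}" for x
  have "openin (config_topology X) (B x)" for x
    unfolding openin_config B_def by (auto intro!: exI[of _ "r x"] intro: agree_trans)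
  moreover have "\<Union>(B ` X) = X" unfolding B_def by auto
  ultimately have "\<exists>\<F>. finite \<F> \<and> \<F> \<subseteq> B ` X \<and> X \<subseteq> \<Union>\<F>"
    using X unfolding compact_space_alt topspace_config by (metis (no_types, lifting) imageE order_refl)
  then obtain F where F: "finite F" "F \<subseteq> X" "X \<subseteq> \<Union>(B ` F)"
    by (metis finite_subset_image)
  obtain R where R: "R \<ge> 0" "r ` F \<subseteq> {-R..R}" using finite_subset_window[of "r ` F"] F(1) by auto
  have "g x i = g y i" if xy: "x \<in> X" "y \<in> X" "agree {-R..R} x y" for x y
  proof -
    obtain z where z: "z \<in> F" "x \<in> B z" using F(3) xy(1) by blast
    then have "r z \<le> R" using R by auto
    then have zx: "agree {-r z..r z} z x" "agree {-r z..r z} z y"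
      using z xy agree_window_mono[OF xy(3)] unfolding B_def by (auto intro: agree_trans)
    have "z \<in> X" using z F(2) by auto
    then show ?thesis using r[of z x] r[of z y] zx xy by simp
  qed
  then show "\<exists>r. \<forall>x\<in>X. \<forall>y\<in>X. agree {-r..r} x y \<longrightarrow> g x i = g y i" by blast
qed

lemma window_continuous_comp:
  assumes g: "window_continuous X g" and h: "window_continuous Y h" "h \<in> Y \<rightarrow> X"
  shows "window_continuous Y (g \<circ> h)"
  unfolding window_continuous_def
proof
  fix i
  obtain r where r: "\<And>x y. x \<in> X \<Longrightarrow> y \<in> X \<Longrightarrow> agree {-r..r} x y \<Longrightarrow> g x i = g y i"
    using window_continuousE[OF g] by metis
  obtain s where s: "\<And>x y. x \<in> Y \<Longrightarrow> y \<in> Y \<Longrightarrow> agree {-s..s} x y \<Longrightarrow> agree {-r..r} (h x) (h y)"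
    using window_continuous_finite[OF h(1) finite_atLeastAtMost_int] by metis
  have "(g \<circ> h) x i = (g \<circ> h) y i" if "x \<in> Y" "y \<in> Y" "agree {-s..s} x y" for x y
    unfolding comp_def using s[OF that] h(2) that by (intro r) auto
  then show "\<exists>r. \<forall>x\<in>Y. \<forall>y\<in>Y. agree {-r..r} x y \<longrightarrow> (g \<circ> h) x i = (g \<circ> h) y i" by blast
qed

lemma window_continuous_subset:
  assumes "window_continuous Y k" "Z \<subseteq> Y" shows "window_continuous Z k"
  unfolding window_continuous_def
proof
  fix i
  obtain r where "\<And>x y. x \<in> Y \<Longrightarrow> y \<in> Y \<Longrightarrow> agree {-r..r} x y \<Longrightarrow> k x i = k y i"
    using window_continuousE[OF assms(1)] by metis
  then show "\<exists>r. \<forall>x\<in>Z. \<forall>y\<in>Z. agree {-r..r} x y \<longrightarrow> k x i = k y i"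
    using assms(2) by (intro exI[of _ r] ballI impI) blast
qed

lemma window_continuous_cong:
  assumes "window_continuous X g" "\<And>x. x \<in> X \<Longrightarrow> f x = g x" shows "window_continuous X f"
  unfolding window_continuous_def
proof
  fix i
  obtain r where r: "\<And>x y. x \<in> X \<Longrightarrow> y \<in> X \<Longrightarrow> agree {-r..r} x y \<Longrightarrow> g x i = g y i"
    using window_continuousE[OF assms(1)] by metis
  have "f x i = f y i" if "x \<in> X" "y \<in> X" "agree {-r..r} x y" for x y
    using r[OF that] assms(2)[OF that(1)] assms(2)[OF that(2)] by simp
  then show "\<exists>r. \<forall>x\<in>X. \<forall>y\<in>X. agree {-r..r} x y \<longrightarrow> f x i = f y i"
    by (intro exI[of _ r] ballI impI)
qed

lemma window_continuous_imp_continuous_map: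
  "window_continuous X g \<Longrightarrow> g \<in> X \<rightarrow> Y \<Longrightarrow> continuous_map (config_topology X) (config_topology Y) g"
  unfolding continuous_map_config window_continuous_def by meson

lemma Hausdorff_config: "Hausdorff_space (config_topology X)"
  unfolding config_topology_def
  by (intro Hausdorff_space_subtopology) (simp add: Hausdorff_space_product_topology)

lemma compact_config_closed:
  assumes "compact_space (config_topology X)" "\<And>r. \<exists>y\<in>X. agree {-r..r} x y"
  shows "x \<in> X"
proof (rule ccontr)
  assume x: "x \<notin> X"
  have "compactin (config_topology UNIV) X"
    using assms(1) unfolding compactin_subspace config_topology_def by (simp add: subtopology_subtopology)
  from compactin_imp_closedin[OF Hausdorff_config this]
  have "openin (config_topology UNIV) (UNIV - X)"
    unfolding closedin_def by simp
  then show False using x assms(2) unfolding openin_config by blast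
qed

lemma compact_full_shift: "finite A \<Longrightarrow> compact_space (config_topology (full_shift A))"
proof -
  assume "finite A"
  have "full_shift A = PiE UNIV (\<lambda>_. A)" by (auto simp: full_shift_def)
  moreover have "compactin (product_topology (\<lambda>_. discrete_topology UNIV) UNIV) (PiE UNIV (\<lambda>_::int. A))"
    using \<open>finite A\<close> by (simp add: compactin_PiE compactin_discrete_topology)
  ultimately show ?thesis unfolding config_topology_def by (simp add: compactin_subspace)
qed

lemma subshift_compact: assumes "subshift A X" shows "compact_space (config_topology X)"
proof -
  have X: "finite A" "closedin (config_topology (full_shift A)) X" using assms by (auto simp: subshift_def)
  then have "X \<subseteq> full_shift A" using closedin_subset by fastforce
  moreover have "compactin (config_topology (full_shift A)) X"
    using closedin_compact_space[OF compact_full_shift X(2)] X(1) by blast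
  ultimately show ?thesis
    unfolding compactin_subspace config_topology_def
    by (simp add: subtopology_subtopology Int_absorb1)
qed

lemma shift_shift [simp]: "shift a (shift b x) = shift (a + b) x"
  by (simp add: shift_def add.assoc)

lemma shift_0 [simp]: "shift 0 x = x" by (simp add: shift_def)

lemma shift_apply: "shift k x i = x (i + k)" by (simp add: shift_def)

lemma subshift_shift: assumes "subshift A X" "x \<in> X" shows "shift k x \<in> X"
proof -
  have S: "shift 1 ` X = X" using assms(1) by (simp add: subshift_def)
  have 1: "shift 1 x \<in> X" if "x \<in> X" for x
    using imageI[OF that, of "shift 1"] S by simp
  have 2: "shift (-1) x \<in> X" if "x \<in> X" for x
  proof -
    have "x \<in> shift 1 ` X" using S that by simp
    then obtain y where "y \<in> X" "x = shift 1 y" by (rule imageE)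
    then show ?thesis by simp
  qed
  show ?thesis
  proof (induction k rule: int_induct[where k=0])
    case base then show ?case using assms by simp
  next
    case (step1 i) then show ?case using 1[of "shift i x"] by (simp add: add.commute)
  next
    case (step2 i) then show ?case using 2[of "shift i x"] by simp
  qed
qed

text \<open>An equivariant map is determined by its values on one period, so one window size serves
  all cells.\<close>

lemma equivariant_window:
  fixes m n :: int
  assumes X: "\<And>x k. x \<in> X \<Longrightarrow> shift k x \<in> X" and h: "window_continuous X h"
    and eq: "\<And>x z. x \<in> X \<Longrightarrow> h (shift (n * z) x) = shift (m * z) (h x)" and m: "m \<ge> 1"
  obtains r where "r \<ge> 0" "\<And>x y i. x \<in> X \<Longrightarrow> y \<in> X \<Longrightarrow>
      agree {n * (i div m) - r..n * (i div m) + r} x y \<Longrightarrow> h x i = h y i"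
proof -
  obtain r where r: "r \<ge> 0"
    "\<And>x y. x \<in> X \<Longrightarrow> y \<in> X \<Longrightarrow> agree {-r..r} x y \<Longrightarrow> agree {0..<m} (h x) (h y)"
    using window_continuous_finite[OF h finite_atLeastLessThan_int] by metis
  show ?thesis
  proof (rule that[OF r(1)])
    fix x y i assume x: "x \<in> X" "y \<in> X"
      and a: "agree {n * (i div m) - r..n * (i div m) + r} x y"
    let ?z = "i div m"
    have "agree {-r..r} (shift (n * ?z) x) (shift (n * ?z) y)"
      by (rule agreeI) (auto simp: shift_apply intro!: agreeD[OF a])
    then have "agree {0..<m} (h (shift (n * ?z) x)) (h (shift (n * ?z) y))"
      using r(2) X x by blast
    then have "shift (m * ?z) (h x) (i mod m) = shift (m * ?z) (h y) (i mod m)"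
      using m eq x by (auto simp: agree_def)
    then show "h x i = h y i" by (simp add: shift_apply)
  qed
qed

definition gluing :: "(int \<Rightarrow> 'a) set \<Rightarrow> int \<Rightarrow> bool" where
  "gluing X w \<longleftrightarrow> w \<ge> 0 \<and>
     (\<forall>x\<in>X. \<forall>y\<in>X. \<forall>a. agree {a..a+w} x y \<longrightarrow> (\<lambda>i. if i < a then x i else y i) \<in> X)"

text \<open>Continuity of the membership test of the clopen set turns the defining intersection of an
  SFT into a condition on windows of bounded width, so two points that agree on a long enough
  interval may be glued there.\<close>

lemma SFT_glue:
  assumes "SFT A X"
  obtains w where "gluing X w"
proof -
  let ?T = "config_topology (full_shift A)"
  obtain C where C: "openin ?T C" "closedin ?T C" "X = (\<Inter>n. shift n ` C)"
    and fin: "finite A" using assms by (auto simp: SFT_def subshift_def)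
  define ind where "ind x = (\<lambda>_::int. x \<in> C)" for x
  have "continuous_map ?T (config_topology UNIV) ind"
    unfolding continuous_map_config
  proof (intro conjI allI ballI)
    fix i x assume x: "x \<in> full_shift A"
    have "openin ?T (full_shift A - C)" using C(2) by (simp add: closedin_def)
    then show "\<exists>r. \<forall>y\<in>full_shift A. agree {-r..r} x y \<longrightarrow> ind x i = ind y i"
      using x C(1) unfolding openin_config ind_def by (cases "x \<in> C") (fast, (metis DiffD2 DiffI))
  qed auto
  then have "window_continuous (full_shift A) ind"
    using compact_window_continuous compact_full_shift fin by blast
  then obtain r where r: "r \<ge> 0" "\<And>x y. x \<in> full_shift A \<Longrightarrow> y \<in> full_shift A \<Longrightarrow>
      agree {-r..r} x y \<Longrightarrow> ind x 0 = ind y 0"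
    by (metis window_continuousE)
  have memX: "x \<in> X \<longleftrightarrow> (\<forall>n. shift n x \<in> C)" for x
  proof
    assume x: "x \<in> X"
    show "\<forall>n. shift n x \<in> C"
    proof
      fix n have "x \<in> shift (-n) ` C" using x C(3) by blast
      then show "shift n x \<in> C" by auto
    qed
  next
    assume n: "\<forall>n. shift n x \<in> C"
    have "x \<in> shift n ` C" for n using n by (intro image_eqI[of _ _ "shift (-n) x"]) auto
    then show "x \<in> X" using C(3) by blast
  qed
  have CF: "C \<subseteq> full_shift A" using openin_subset[OF C(1)] by simp
  then have XF: "X \<subseteq> full_shift A" using memX[THEN iffD1, rule_format, of _ 0] by auto
  show ?thesis
  proof (rule that[of "2 * r"], unfold gluing_def, intro conjI ballI allI impI)
    fix x y a assume x: "x \<in> X" and y: "y \<in> X" and ag: "agree {a..a+2*r} x y"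
    let ?z = "\<lambda>i. if i < a then x i else y i"
    have zF: "?z \<in> full_shift A" using x y XF by (auto simp: full_shift_def)
    then have sF: "shift n ?z \<in> full_shift A" for n by (auto simp: full_shift_def shift_def)
    have "shift n ?z \<in> C" for n
    proof (cases "n - r \<ge> a")
      case True
      then have "agree {-r..r} (shift n y) (shift n ?z)" by (auto simp: shift_def agree_def)
      then have "ind (shift n y) 0 = ind (shift n ?z) 0"
        using r(2) sF memX y CF by blast
      then show ?thesis using memX y by (simp add: ind_def)
    next
      case False
      then have "agree {-r..r} (shift n x) (shift n ?z)" using ag by (auto simp: shift_def agree_def)
      then have "ind (shift n x) 0 = ind (shift n ?z) 0"
        using r(2) sF memX x CF by blast
      then show ?thesis using memX x by (simp add: ind_def)
    qed
    then show "?z \<in> X" using memX by blast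
  qed (use r in auto)
qed

section \<open>Self-homeomorphisms as permutations of all configurations\<close>

abbreviation inv_map :: "('b \<Rightarrow> 'c) \<Rightarrow> 'c \<Rightarrow> 'b" where
  "inv_map \<equiv> inv_into UNIV"

text \<open>Extending by the identity outside \<open>X\<close> turns composition of self-maps of \<open>X\<close> into plain
  function composition and inversion into \<^term>\<open>inv_map\<close>. Continuity of the inverse follows
  from compactness (\<open>autos_inv\<close>).\<close>

definition autos :: "(int \<Rightarrow> 'a) set \<Rightarrow> ((int \<Rightarrow> 'a) \<Rightarrow> int \<Rightarrow> 'a) set" where
  "autos X = {g. g permutes X \<and> window_continuous X g}"

definition translate :: "((int \<Rightarrow> 'a) \<Rightarrow> int \<Rightarrow> 'a) \<Rightarrow> int \<Rightarrow> (int \<Rightarrow> 'a) \<Rightarrow> int \<Rightarrow> 'a" where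
  "translate g k = shift (- k) \<circ> g \<circ> shift k"

definition supported_on :: "(int \<Rightarrow> 'a) set \<Rightarrow> int set \<Rightarrow> ((int \<Rightarrow> 'a) \<Rightarrow> int \<Rightarrow> 'a) \<Rightarrow> bool" where
  "supported_on X D g \<longleftrightarrow> (\<forall>x\<in>X. \<forall>i. i \<notin> D \<longrightarrow> g x i = x i)"

definition radius :: "(int \<Rightarrow> 'a) set \<Rightarrow> int \<Rightarrow> ((int \<Rightarrow> 'a) \<Rightarrow> int \<Rightarrow> 'a) \<Rightarrow> bool" where
  "radius X r g \<longleftrightarrow> (\<forall>x\<in>X. \<forall>y\<in>X. \<forall>i. agree {i-r..i+r} x y \<longrightarrow> g x i = g y i)"

lemma translate_apply: "translate g k x i = g (shift k x) (i - k)"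
  by (simp add: translate_def shift_def)

lemma translate_0 [simp]: "translate g 0 = g"
  by (simp add: translate_def fun_eq_iff)

lemma translate_translate [simp]: "translate (translate g a) b = translate g (a + b)"
  by (simp add: translate_def fun_eq_iff add.commute)

lemma translate_comp: "translate (g \<circ> h) k = translate g k \<circ> translate h k"
  by (simp add: translate_def fun_eq_iff)

lemma supported_onD: "supported_on X D g \<Longrightarrow> x \<in> X \<Longrightarrow> i \<notin> D \<Longrightarrow> g x i = x i"
  by (simp add: supported_on_def)

lemma supported_on_mono: "supported_on X D g \<Longrightarrow> D \<subseteq> E \<Longrightarrow> supported_on X E g"
  by (auto simp: supported_on_def)

lemma radiusD: "radius X r g \<Longrightarrow> x \<in> X \<Longrightarrow> y \<in> X \<Longrightarrow> agree {i-r..i+r} x y \<Longrightarrow> g x i = g y i"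
  unfolding radius_def by blast

lemma radius_mono: "radius X r g \<Longrightarrow> r \<le> s \<Longrightarrow> radius X s g"
  unfolding radius_def
proof (intro ballI allI impI)
  fix x y i assume r: "\<forall>x\<in>X. \<forall>y\<in>X. \<forall>i. agree {i-r..i+r} x y \<longrightarrow> g x i = g y i" "r \<le> s"
    and x: "x \<in> X" "y \<in> X" "agree {i-s..i+s} x y"
  have "agree {i-r..i+r} x y" by (rule agree_mono[OF x(3)]) (use r(2) in auto)
  then show "g x i = g y i" using r(1) x by blast
qed

lemma radius_agree:
  assumes "radius X r g" "x \<in> X" "y \<in> X" "agree {a-r..b+r} x y"
  shows "agree {a..b} (g x) (g y)"
proof (rule agreeI)
  fix i assume "i \<in> {a..b}"
  then have "agree {i-r..i+r} x y" by (intro agree_mono[OF assms(4)]) auto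
  then show "g x i = g y i" using radiusD assms(1-3) by blast
qed

lemma radius_comp:
  assumes "radius X r g" "radius X s h" "h permutes X"
  shows "radius X (r + s) (g \<circ> h)"
  unfolding radius_def
proof (intro ballI allI impI)
  fix x y i assume x: "x \<in> X" "y \<in> X" and "agree {i - (r+s)..i + (r+s)} x y"
  then have "agree {(i - r) - s..(i + r) + s} x y" by (simp add: algebra_simps)
  then have "agree {i-r..i+r} (h x) (h y)" by (rule radius_agree[OF assms(2) x])
  moreover have "h x \<in> X" "h y \<in> X" using x assms(3) by (simp_all add: permutes_in_image)
  ultimately show "(g \<circ> h) x i = (g \<circ> h) y i" unfolding comp_def by (intro radiusD[OF assms(1)])
qed

lemma radius_window_continuous: "radius X r g \<Longrightarrow> window_continuous X g"
  unfolding window_continuous_def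
proof
  fix i assume r: "radius X r g"
  have "g x i = g y i" if "x \<in> X" "y \<in> X" "agree {-(\<bar>i\<bar>+r)..\<bar>i\<bar>+r} x y" for x y
    by (rule radiusD[OF r that(1,2)], rule agree_mono[OF that(3)]) auto
  then show "\<exists>r. \<forall>x\<in>X. \<forall>y\<in>X. agree {-r..r} x y \<longrightarrow> g x i = g y i"
    by (intro exI[of _ "\<bar>i\<bar> + r"] ballI impI)
qed

lemma supported_on_comp:
  assumes "supported_on X D g" "supported_on X D h" "h permutes X"
  shows "supported_on X D (g \<circ> h)"
  using assms unfolding supported_on_def by (simp add: permutes_in_image)

lemma supported_on_inv:
  assumes "supported_on X D g" "g permutes X"
  shows "supported_on X D (inv_map g)"
  unfolding supported_on_def
proof (intro ballI allI impI)
  fix x i assume x: "x \<in> X" "i \<notin> D"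
  then have "inv_map g x \<in> X" using permutes_in_image[OF permutes_inv[OF assms(2)]] by simp
  then have "g (inv_map g x) i = inv_map g x i" using assms(1) x by (simp add: supported_on_def)
  then show "inv_map g x i = x i" using permutes_inverses(1)[OF assms(2)] by simp
qed

lemma permutes_eqI:
  assumes "f permutes X" "g permutes X" "\<And>x i. x \<in> X \<Longrightarrow> f x i = g x i"
  shows "f = g"
proof
  fix x show "f x = g x"
    using assms by (cases "x \<in> X") (auto simp: permutes_not_in)
qed

text \<open>Each map rewrites cells of its own support using a neighbourhood that the other map
  leaves alone.\<close>

lemma separated_commute:
  assumes g: "g permutes X" "supported_on X A g" "radius X r g"
    and h: "h permutes X" "supported_on X B h" "radius X r h"
    and "r \<ge> 0" and sep: "\<And>a b. a \<in> A \<Longrightarrow> b \<in> B \<Longrightarrow> \<bar>a - b\<bar> > r"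
  shows "g \<circ> h = h \<circ> g"
proof (rule permutes_eqI[OF permutes_compose[OF h(1) g(1)] permutes_compose[OF g(1) h(1)]])
  fix x i assume x: "x \<in> X"
  have gx: "g x \<in> X" "h x \<in> X" using x g(1) h(1) by (simp_all add: permutes_in_image)
  consider "i \<in> A" | "i \<in> B" | "i \<notin> A" "i \<notin> B" by blast
  then show "(g \<circ> h) x i = (h \<circ> g) x i"
  proof cases
    case 1
    have "agree {i-r..i+r} (h x) x"
    proof (rule agreeI)
      fix j assume "j \<in> {i-r..i+r}"
      then have "j \<notin> B" using sep[OF 1, of j] by auto
      then show "h x j = x j" using h(2) x supported_onD by blast
    qed
    then have "g (h x) i = g x i" using radiusD[OF g(3)] gx x by blast
    moreover have "i \<notin> B" using sep[OF 1, of i] \<open>r \<ge> 0\<close> by auto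
    ultimately show ?thesis using supported_onD[OF h(2) gx(1)] by simp
  next
    case 2
    have "agree {i-r..i+r} (g x) x"
    proof (rule agreeI)
      fix j assume "j \<in> {i-r..i+r}"
      then have "j \<notin> A" using sep[OF _ 2, of j] by auto
      then show "g x j = x j" using g(2) x supported_onD by blast
    qed
    then have "h (g x) i = h x i" using radiusD[OF h(3)] gx x by blast
    moreover have "i \<notin> A" using sep[OF _ 2, of i] \<open>r \<ge> 0\<close> by auto
    ultimately show ?thesis using supported_onD[OF g(2) gx(2)] by simp
  next
    case 3
    then show ?thesis using supported_onD[OF g(2)] supported_onD[OF h(2)] x gx by simp
  qed
qed

locale compact_shift_space =
  fixes X :: "(int \<Rightarrow> 'a) set"
  assumes compact: "compact_space (config_topology X)"
    and shift_mem: "x \<in> X \<Longrightarrow> shift k x \<in> X"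
begin

lemma shift_mem_iff [simp]: "shift k x \<in> X \<longleftrightarrow> x \<in> X"
  using shift_mem[of "shift k x" "-k"] shift_mem[of x k] by auto

lemma equivariant_int:
  assumes eq: "\<And>x. x \<in> X \<Longrightarrow> h (shift a x) = shift b (h x)" and x: "x \<in> X"
  shows "h (shift (a * z) x) = shift (b * z) (h x)"
proof (induction z rule: int_induct[where k = 0])
  case (step1 i)
  have "h (shift a (shift (a * i) x)) = shift b (h (shift (a * i) x))"
    using eq[of "shift (a * i) x"] x by simp
  then show ?case using step1 by (simp add: algebra_simps)
next
  case (step2 i)
  have "h (shift a (shift (a * (i - 1)) x)) = shift b (h (shift (a * (i - 1)) x))"
    using eq[of "shift (a * (i - 1)) x"] x by simp
  then have "shift b (h (shift (a * (i - 1)) x)) = shift (b * i) (h x)"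
    using step2 by (simp add: algebra_simps)
  then have "shift (-b) (shift b (h (shift (a * (i - 1)) x))) = shift (-b) (shift (b * i) (h x))"
    by simp
  then show ?case by (simp add: algebra_simps)
qed simp

lemma autos_permutes: "g \<in> autos X \<Longrightarrow> g permutes X"
  by (simp add: autos_def)

lemma autos_mem [simp]: "g \<in> autos X \<Longrightarrow> g x \<in> X \<longleftrightarrow> x \<in> X"
  by (simp add: autos_def permutes_in_image)

lemma autos_continuous: "g \<in> autos X \<Longrightarrow> window_continuous X g"
  by (simp add: autos_def)

lemma autos_inv_apply [simp]:
  "g \<in> autos X \<Longrightarrow> g (inv_map g x) = x" "g \<in> autos X \<Longrightarrow> inv_map g (g x) = x"
  by (simp_all add: permutes_inverses[OF autos_permutes])

lemma autos_id: "id \<in> autos X"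
proof -
  have "radius X 0 id"
    unfolding radius_def by (auto dest: agreeD)
  then show ?thesis using radius_window_continuous by (auto simp: autos_def permutes_id)
qed

lemma autos_comp:
  assumes "g \<in> autos X" "h \<in> autos X" shows "g \<circ> h \<in> autos X"
  using window_continuous_comp[OF autos_continuous[OF assms(1)] autos_continuous[OF assms(2)]] assms
  by (simp add: autos_def permutes_compose permutes_in_image)

lemma homeomorphic_map_inverse:
  assumes "homeomorphic_map (config_topology X) (config_topology Y) h"
  obtains k where "window_continuous X h" "window_continuous Y k" "h \<in> X \<rightarrow> Y" "k \<in> Y \<rightarrow> X"
    "\<And>x. x \<in> X \<Longrightarrow> k (h x) = x" "\<And>y. y \<in> Y \<Longrightarrow> h (k y) = y"
proof -
  obtain k where k: "homeomorphic_maps (config_topology X) (config_topology Y) h k"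
    using assms by (auto simp: homeomorphic_map_maps)
  then have c: "continuous_map (config_topology X) (config_topology Y) h"
     "continuous_map (config_topology Y) (config_topology X) k"
    by (auto simp: homeomorphic_maps_def)
  have "compact_space (config_topology Y)"
    using compact homeomorphic_compact_space assms homeomorphic_map_imp_homeomorphic_space by blast
  then have "window_continuous X h" "window_continuous Y k"
    using compact_window_continuous[OF compact c(1)] compact_window_continuous[OF _ c(2)] by auto
  moreover have "h \<in> X \<rightarrow> Y" "k \<in> Y \<rightarrow> X" using c by (auto simp: continuous_map_config)
  ultimately show ?thesis
    using k that unfolding homeomorphic_maps_def topspace_config by blast
qed

lemma window_continuous_bij_homeomorphic:
  assumes "window_continuous X h" "bij_betw h X Y"
  shows "homeomorphic_map (config_topology X) (config_topology Y) h"
proof (rule continuous_imp_homeomorphic_map)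
  have "h \<in> X \<rightarrow> Y" using assms(2) by (auto simp: bij_betw_def)
  then show "continuous_map (config_topology X) (config_topology Y) h"
    by (rule window_continuous_imp_continuous_map[OF assms(1)])
qed (use assms compact Hausdorff_config in \<open>auto simp: bij_betw_def\<close>)

lemma autos_inv:
  assumes "g \<in> autos X" shows "inv_map g \<in> autos X"
proof -
  have p: "g permutes X" using assms by (rule autos_permutes)
  have "homeomorphic_map (config_topology X) (config_topology X) g"
    by (rule window_continuous_bij_homeomorphic)
      (use assms in \<open>auto simp: autos_def intro: permutes_imp_bij\<close>)
  then obtain k where k: "window_continuous X k" "\<And>y. y \<in> X \<Longrightarrow> g (k y) = y"
    by (rule homeomorphic_map_inverse) blast
  have "inv_map g y = k y" if "y \<in> X" for y
    using k(2)[OF that] permutes_inverses(2)[OF p, of "k y"] by simp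
  then have "window_continuous X (inv_map g)"
    using k(1) unfolding window_continuous_def by metis
  then show ?thesis using p by (simp add: autos_def permutes_inv)
qed

lemma autos_translate:
  assumes "g \<in> autos X" shows "translate g k \<in> autos X"
proof -
  have "translate g k permutes X"
  proof (rule bij_imp_permutes)
    show "bij_betw (translate g k) X X"
      by (rule bij_betw_byWitness[where f' = "translate (inv_map g) k"])
        (use assms autos_inv[OF assms] in \<open>auto simp: translate_def\<close>)
    fix x assume "x \<notin> X"
    then show "translate g k x = x"
      using permutes_not_in[OF autos_permutes[OF assms], of "shift k x"] by (simp add: translate_def)
  qed
  moreover have "window_continuous X (translate g k)"
    unfolding window_continuous_def
  proof
    fix i
    obtain r where r: "\<And>x y. x \<in> X \<Longrightarrow> y \<in> X \<Longrightarrow> agree {-r..r} x y \<Longrightarrow> g x (i - k) = g y (i - k)"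
      using window_continuousE[OF autos_continuous[OF assms]] by metis
    have "translate g k x i = translate g k y i"
      if "x \<in> X" "y \<in> X" "agree {-(r+\<bar>k\<bar>)..r+\<bar>k\<bar>} x y" for x y
      unfolding translate_apply
    proof (rule r)
      show "agree {-r..r} (shift k x) (shift k y)"
        by (rule agreeI) (auto simp: shift_apply intro!: agreeD[OF that(3)])
    qed (use that in auto)
    then show "\<exists>r. \<forall>x\<in>X. \<forall>y\<in>X. agree {-r..r} x y \<longrightarrow> translate g k x i = translate g k y i" by blast
  qed
  ultimately show ?thesis by (simp add: autos_def)
qed

lemma translate_inv:
  assumes "g \<in> autos X" shows "translate (inv_map g) k = inv_map (translate g k)"
proof -
  have "translate g k \<circ> translate (inv_map g) k = id"
    using assms by (auto simp: translate_def fun_eq_iff)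
  then show ?thesis
    using permutes_surj[OF autos_permutes[OF autos_translate[OF assms]]]
      permutes_inj[OF autos_permutes[OF autos_translate[OF assms]]]
    by (metis inv_o_cancel comp_assoc comp_id id_comp)
qed

lemma supported_on_translate:
  assumes "supported_on X D g" shows "supported_on X {i. i - k \<in> D} (translate g k)"
  unfolding supported_on_def
  using supported_onD[OF assms] by (simp add: translate_apply shift_apply)

lemma radius_translate:
  assumes "radius X r g" shows "radius X r (translate g k)"
  unfolding radius_def
proof (intro ballI allI impI)
  fix x y i assume "x \<in> X" "y \<in> X" "agree {i-r..i+r} x y"
  then show "translate g k x i = translate g k y i"
    unfolding translate_apply
    by (intro radiusD[OF assms]) (auto simp: agree_def shift_apply)
qed

lemma restrict_autos_homeos: assumes "g \<in> autos X" shows "restrict g X \<in> homeos X"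
proof -
  have "homeomorphic_map (config_topology X) (config_topology X) (restrict g X)"
  proof (rule window_continuous_bij_homeomorphic)
    show "window_continuous X (restrict g X)"
      using autos_continuous[OF assms] unfolding window_continuous_def restrict_def by metis
    show "bij_betw (restrict g X) X X"
      using permutes_imp_bij[OF autos_permutes[OF assms]] bij_betw_cong[of X "restrict g X" g X] by simp
  qed
  then show ?thesis by (simp add: homeos_def)
qed

lemma homeos_autos:
  assumes "f \<in> homeos X" obtains g where "g \<in> autos X" "f = restrict g X"
proof -
  have h: "homeomorphic_map (config_topology X) (config_topology X) f" "f \<in> extensional X"
    using assms by (auto simp: homeos_def)
  obtain k where k: "window_continuous X f" "f \<in> X \<rightarrow> X" "k \<in> X \<rightarrow> X"
    "\<And>x. x \<in> X \<Longrightarrow> k (f x) = x" "\<And>y. y \<in> X \<Longrightarrow> f (k y) = y"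
    using homeomorphic_map_inverse[OF h(1)] by metis
  define g where "g x = (if x \<in> X then f x else x)" for x
  have "g permutes X"
  proof (rule bij_imp_permutes)
    have "bij_betw f X X" by (rule bij_betw_byWitness[where f' = k]) (use k in auto)
    then show "bij_betw g X X" using bij_betw_cong[of X g f X] by (simp add: g_def)
  qed (simp add: g_def)
  moreover have "window_continuous X g"
    using k(1) unfolding window_continuous_def g_def by metis
  moreover have "f = restrict g X" using h(2) by (auto simp: g_def fun_eq_iff extensional_def)
  ultimately show ?thesis using that by (simp add: autos_def)
qed

lemma restrict_eq_autos:
  assumes "g \<in> autos X" "h \<in> autos X" "restrict g X = restrict h X" shows "g = h"
  using assms by (intro permutes_eqI[OF autos_permutes autos_permutes]) (auto simp: fun_eq_iff restrict_def, metis)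

lemma compose_restrict:
  "g \<in> autos X \<Longrightarrow> h \<in> autos X \<Longrightarrow> compose X (restrict g X) (restrict h X) = restrict (g \<circ> h) X"
  by (auto simp: compose_def fun_eq_iff)

lemma gate_translate_restrict:
  "g \<in> autos X \<Longrightarrow> gate_translate X (restrict g X) k = restrict (translate g k) X"
  by (auto simp: gate_translate_def translate_def fun_eq_iff)

lemma restrict_autos_Bij: "g \<in> autos X \<Longrightarrow> restrict g X \<in> Bij X"
  using restrict_autos_homeos[of g] permutes_imp_bij[of g X]
  by (auto simp: Bij_def autos_def bij_betw_cong[of X "restrict g X" g X])

lemma BijGroup_mult_restrict:
  "g \<in> autos X \<Longrightarrow> h \<in> autos X \<Longrightarrow> restrict g X \<otimes>\<^bsub>BijGroup X\<^esub> restrict h X = restrict (g \<circ> h) X"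
  by (simp add: BijGroup_def restrict_autos_Bij compose_restrict)

lemma BijGroup_inv_restrict:
  assumes "g \<in> autos X" shows "inv\<^bsub>BijGroup X\<^esub> restrict g X = restrict (inv_map g) X"
proof -
  interpret group "BijGroup X" by (rule group_BijGroup)
  have "restrict (inv_map g) X \<otimes>\<^bsub>BijGroup X\<^esub> restrict g X = \<one>\<^bsub>BijGroup X\<^esub>"
    using assms autos_inv[OF assms]
    by (subst BijGroup_mult_restrict) (auto simp: BijGroup_def fun_eq_iff)
  moreover have "restrict g X \<in> carrier (BijGroup X)" "restrict (inv_map g) X \<in> carrier (BijGroup X)"
    using restrict_autos_Bij assms autos_inv by (auto simp: BijGroup_def)
  ultimately show ?thesis by (intro inv_equality)
qed

lemma generate_restrict_comp:
  assumes "f \<in> autos X" "h \<in> autos X"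
    and "restrict f X \<in> generate (BijGroup X) K" "restrict h X \<in> generate (BijGroup X) K"
  shows "restrict (f \<circ> h) X \<in> generate (BijGroup X) K"
  using generate.eng[OF assms(3,4)] BijGroup_mult_restrict[OF assms(1,2)] by simp

lemma generate_restrict_id: "restrict id X \<in> generate (BijGroup X) K"
  using generate.one[of "BijGroup X" K] by (simp add: BijGroup_def restrict_def id_def)

lemma Aut_eq: "Aut X n = {restrict g X | g. g \<in> autos X \<and>
    (\<forall>x\<in>X. g (shift (int n) x) = shift (int n) (g x))}"
proof (intro equalityI subsetI)
  fix f assume f: "f \<in> Aut X n"
  then obtain g where "g \<in> autos X" "f = restrict g X" using homeos_autos unfolding Aut_def by blast
  moreover from this have "\<forall>x\<in>X. g (shift (int n) x) = shift (int n) (g x)"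
    using f by (simp add: Aut_def)
  ultimately show "f \<in> {restrict g X | g. g \<in> autos X \<and>
      (\<forall>x\<in>X. g (shift (int n) x) = shift (int n) (g x))}"
    by blast
next
  fix f assume "f \<in> {restrict g X | g. g \<in> autos X \<and>
      (\<forall>x\<in>X. g (shift (int n) x) = shift (int n) (g x))}"
  then show "f \<in> Aut X n" using restrict_autos_homeos by (auto simp: Aut_def)
qed

lemma inv_commutes_shift:
  assumes g: "g \<in> autos X" and c: "\<And>x. x \<in> X \<Longrightarrow> g (shift k x) = shift k (g x)" and x: "x \<in> X"
  shows "inv_map g (shift k x) = shift k (inv_map g x)"
proof -
  have "g (shift k (inv_map g x)) = shift k x" using c[of "inv_map g x"] x g autos_inv[OF g] by simp
  then show ?thesis using autos_inv_apply(2)[OF g] by metis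
qed

lemma subgroup_SAut: "subgroup (\<Union>n\<in>{1..}. Aut X n) (BijGroup X)"
proof
  show "(\<Union>n\<in>{1..}. Aut X n) \<subseteq> carrier (BijGroup X)"
    using restrict_autos_Bij by (auto simp: Aut_eq BijGroup_def)
  have "\<one>\<^bsub>BijGroup X\<^esub> = restrict id X" by (auto simp: BijGroup_def)
  then have "\<one>\<^bsub>BijGroup X\<^esub> \<in> Aut X 1" unfolding Aut_eq using autos_id by auto
  then show "\<one>\<^bsub>BijGroup X\<^esub> \<in> (\<Union>n\<in>{1..}. Aut X n)" by (rule UN_I[rotated]) simp
next
  fix f h assume "f \<in> (\<Union>n\<in>{1..}. Aut X n)" "h \<in> (\<Union>n\<in>{1..}. Aut X n)"
  then obtain n m where n: "n \<ge> 1" "m \<ge> 1" "f \<in> Aut X n" "h \<in> Aut X m" by auto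
  obtain f' where f': "f' \<in> autos X" "f = restrict f' X"
    "\<And>x. x \<in> X \<Longrightarrow> f' (shift (int n) x) = shift (int n) (f' x)"
    using n(3) unfolding Aut_eq by blast
  obtain h' where h': "h' \<in> autos X" "h = restrict h' X"
    "\<And>x. x \<in> X \<Longrightarrow> h' (shift (int m) x) = shift (int m) (h' x)"
    using n(4) unfolding Aut_eq by blast
  have "(f' \<circ> h') (shift (int (n * m)) x) = shift (int (n * m)) ((f' \<circ> h') x)" if x: "x \<in> X" for x
  proof -
    have "h' (shift (int (n * m)) x) = shift (int (n * m)) (h' x)"
      using equivariant_int[of h' "int m" "int m" x "int n", OF h'(3) x] by (simp add: mult.commute)
    moreover have "f' (shift (int (n * m)) y) = shift (int (n * m)) (f' y)" if "y \<in> X" for y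
      using equivariant_int[of f' "int n" "int n" y "int m", OF f'(3) that] by simp
    ultimately show ?thesis using x h'(1) by simp
  qed
  then have "restrict (f' \<circ> h') X \<in> Aut X (n * m)"
    unfolding Aut_eq using autos_comp[OF f'(1) h'(1)] by blast
  then have "f \<otimes>\<^bsub>BijGroup X\<^esub> h \<in> Aut X (n * m)"
    unfolding f'(2) h'(2) BijGroup_mult_restrict[OF f'(1) h'(1)] .
  then show "f \<otimes>\<^bsub>BijGroup X\<^esub> h \<in> (\<Union>n\<in>{1..}. Aut X n)"
    by (rule UN_I[rotated]) (use n in simp)
next
  fix f assume "f \<in> (\<Union>n\<in>{1..}. Aut X n)"
  then obtain n g where n: "n \<ge> 1" and g: "g \<in> autos X" "f = restrict g X"
    "\<And>x. x \<in> X \<Longrightarrow> g (shift (int n) x) = shift (int n) (g x)"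
    unfolding Aut_eq by blast
  have "restrict (inv_map g) X \<in> Aut X n"
    unfolding Aut_eq using autos_inv[OF g(1)] inv_commutes_shift[OF g(1,3)] by blast
  then show "inv\<^bsub>BijGroup X\<^esub> f \<in> (\<Union>n\<in>{1..}. Aut X n)"
    unfolding g(2) BijGroup_inv_restrict[OF g(1)] using n by (intro UN_I[of n]) auto
qed

lemma SIAut_eq: "SIAut X = generate (BijGroup X) {f. \<exists>n\<ge>1. inert X n f}"
  unfolding SIAut_def SAut_def
  by (rule group.generate_consistent[OF group_BijGroup _ subgroup_SAut]) (auto simp: inert_def)

end

section \<open>Gate lattices\<close>

context compact_shift_space
begin

definition moved :: "((int \<Rightarrow> 'a) \<Rightarrow> int \<Rightarrow> 'a) \<Rightarrow> int set" where
  "moved g = {i. \<exists>x\<in>X. g x i \<noteq> x i}"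

definition gates :: "((int \<Rightarrow> 'a) \<Rightarrow> int \<Rightarrow> 'a) set" where
  "gates = {g \<in> autos X. finite (moved g)}"

definition commuting :: "((int \<Rightarrow> 'a) \<Rightarrow> int \<Rightarrow> 'a) \<Rightarrow> int set \<Rightarrow> bool" where
  "commuting g S \<longleftrightarrow> (\<forall>s\<in>S. \<forall>t\<in>S. translate g s \<circ> translate g t = translate g t \<circ> translate g s)"

definition partial_product :: "((int \<Rightarrow> 'a) \<Rightarrow> int \<Rightarrow> 'a) \<Rightarrow> int set \<Rightarrow> (int \<Rightarrow> 'a) \<Rightarrow> int \<Rightarrow> 'a" where
  "partial_product g F = foldr (translate g) (sorted_list_of_set F)"

text \<open>The infinite product of commuting translates: the value at a cell is computed from the finitely
  many translates able to change that cell. Larger finite subproducts give the same value there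
  (\<open>lattice_eq_partial_product\<close>), so this is the pointwise limit (\<open>gate_product_iff\<close>).\<close>

definition lattice_map :: "((int \<Rightarrow> 'a) \<Rightarrow> int \<Rightarrow> 'a) \<Rightarrow> int set \<Rightarrow> (int \<Rightarrow> 'a) \<Rightarrow> int \<Rightarrow> 'a" where
  "lattice_map g S x = (if x \<in> X then \<lambda>i. partial_product g {s \<in> S. i - s \<in> moved g} x i else x)"

lemma supported_on_moved: "supported_on X (moved g) g"
  by (auto simp: supported_on_def moved_def)

lemma gates_autos: "g \<in> gates \<Longrightarrow> g \<in> autos X"
  by (simp add: gates_def)

lemma gatesI: "g \<in> autos X \<Longrightarrow> finite D \<Longrightarrow> supported_on X D g \<Longrightarrow> g \<in> gates"
  unfolding gates_def moved_def supported_on_def by (auto elim!: rev_finite_subset)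

lemma translate_outside_moved:
  "x \<in> X \<Longrightarrow> i - s \<notin> moved g \<Longrightarrow> translate g s x i = x i"
  using supported_onD[OF supported_on_translate[OF supported_on_moved]] by fastforce

lemma gates_comp:
  assumes "g \<in> gates" "h \<in> gates" shows "g \<circ> h \<in> gates"
proof (rule gatesI)
  show "g \<circ> h \<in> autos X" using assms by (intro autos_comp gates_autos)
  show "finite (moved g \<union> moved h)" using assms by (simp add: gates_def)
  show "supported_on X (moved g \<union> moved h) (g \<circ> h)"
    using assms by (intro supported_on_comp autos_permutes gates_autos) 
      (auto intro: supported_on_mono[OF supported_on_moved])
qed

lemma gates_inv: "g \<in> gates \<Longrightarrow> inv_map g \<in> gates"
  by (rule gatesI[OF autos_inv _ supported_on_inv[OF supported_on_moved autos_permutes]])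
    (auto simp: gates_def)

lemma gates_translate:
  assumes "g \<in> gates" shows "translate g k \<in> gates"
proof (rule gatesI)
  show "translate g k \<in> autos X" using assms by (intro autos_translate gates_autos)
  have "{i. i - k \<in> moved g} = (\<lambda>i. i + k) ` moved g" by (auto simp: image_iff) (metis diff_add_cancel)
  then show "finite {i. i - k \<in> moved g}" using assms by (simp add: gates_def)
qed (rule supported_on_translate[OF supported_on_moved])

lemma commuting_subset: "commuting g S \<Longrightarrow> T \<subseteq> S \<Longrightarrow> commuting g T"
  by (auto simp: commuting_def subset_iff)

lemma commuting_apply:
  "commuting g S \<Longrightarrow> s \<in> S \<Longrightarrow> t \<in> S \<Longrightarrow>
     translate g s (translate g t x) = translate g t (translate g s x)"
  unfolding commuting_def by (metis comp_apply)

lemma commuting_shift: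
  assumes "commuting g S" shows "commuting g ((+) m ` S)"
  unfolding commuting_def
proof clarify
  fix s t assume st: "s \<in> S" "t \<in> S"
  then have "translate (translate g s \<circ> translate g t) m = translate (translate g t \<circ> translate g s) m"
    using assms by (simp add: commuting_def)
  then show "translate g (m + s) \<circ> translate g (m + t) = translate g (m + t) \<circ> translate g (m + s)"
    by (simp add: translate_comp add.commute)
qed

lemma commuting_inv:
  assumes "g \<in> autos X" "commuting g S" shows "commuting (inv_map g) S"
  unfolding commuting_def
proof (intro ballI)
  fix s t assume st: "s \<in> S" "t \<in> S"
  have b: "bij (translate g k)" for k
    using permutes_bij[OF autos_permutes[OF autos_translate[OF assms(1)]]] .
  have "inv_map (translate g s \<circ> translate g t) = inv_map (translate g t \<circ> translate g s)"
    using assms(2) st by (simp add: commuting_def)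
  then show "translate (inv_map g) s \<circ> translate (inv_map g) t = translate (inv_map g) t \<circ> translate (inv_map g) s"
    using b by (simp add: o_inv_distrib translate_inv[OF assms(1)])
qed

lemma partial_product_empty [simp]: "partial_product g {} = id"
  by (simp add: partial_product_def fun_eq_iff)

lemma partial_product_autos: assumes "g \<in> autos X" shows "partial_product g F \<in> autos X"
proof -
  have "foldr (translate g) xs \<in> autos X" for xs
  proof (induction xs)
    case Nil then show ?case using autos_id by (simp add: id_def)
  next
    case (Cons s xs)
    then show ?case using autos_comp[OF autos_translate[OF assms]] by (simp add: o_def)
  qed
  then show ?thesis by (simp add: partial_product_def)
qed

lemma partial_product_insert:
  assumes "commuting g S" "insert s F \<subseteq> S" "finite F" "s \<notin> F"
  shows "partial_product g (insert s F) = translate g s \<circ> partial_product g F"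
proof -
  have "foldr (translate g) (insort s xs) x = translate g s (foldr (translate g) xs x)"
    if "set xs \<subseteq> S" for xs x
    using that
  proof (induction xs)
    case (Cons y ys)
    have "translate g y (translate g s z) = translate g s (translate g y z)" for z
      using commuting_apply[OF assms(1)] assms(2) Cons.prems by simp
    then show ?case using Cons by simp
  qed simp
  then show ?thesis using assms
    by (simp add: partial_product_def sorted_list_of_set_insert_remove fun_eq_iff)
qed

lemma partial_product_comm:
  assumes "commuting g S" "insert s F \<subseteq> S" "finite F"
  shows "translate g s \<circ> partial_product g F = partial_product g F \<circ> translate g s"
  using assms(3,2)
proof (induction F)
  case (insert t F)
  then have i: "partial_product g (insert t F) = translate g t \<circ> partial_product g F"
    by (intro partial_product_insert[OF assms(1)]) auto
  have IH: "translate g s (partial_product g F x) = partial_product g F (translate g s x)" for x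
    using insert by (metis comp_apply insert_subset)
  have "translate g s (translate g t x) = translate g t (translate g s x)" for x
    using commuting_apply[OF assms(1)] insert.prems by simp
  with IH have "(translate g s \<circ> (translate g t \<circ> partial_product g F)) x
      = (translate g t \<circ> partial_product g F \<circ> translate g s) x" for x
    by simp
  then show ?case unfolding i by blast
qed simp

lemma partial_product_insert_right:
  assumes "commuting g S" "insert s F \<subseteq> S" "finite F" "s \<notin> F"
  shows "partial_product g (insert s F) = partial_product g F \<circ> translate g s"
  using partial_product_insert[OF assms] partial_product_comm[OF assms(1-3)] by simp

lemma partial_product_Un:
  assumes "commuting g S" "finite F" "finite F'" "F \<union> F' \<subseteq> S" "F \<inter> F' = {}"
  shows "partial_product g (F \<union> F') = partial_product g F \<circ> partial_product g F'"
  using assms(2,4,5)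
proof (induction F)
  case (insert s F)
  have "partial_product g (insert s (F \<union> F')) = translate g s \<circ> partial_product g (F \<union> F')"
    using insert assms(3) by (intro partial_product_insert[OF assms(1)]) auto
  moreover have "partial_product g (insert s F) = translate g s \<circ> partial_product g F"
    using insert by (intro partial_product_insert[OF assms(1)]) auto
  ultimately show ?case using insert by (simp add: comp_assoc)
qed simp

lemma partial_product_unmoved:
  assumes g: "g \<in> autos X" and S: "commuting g S" and F: "finite F" "F \<subseteq> S"
    and x: "x \<in> X" and i: "\<And>s. s \<in> F \<Longrightarrow> i - s \<notin> moved g"
  shows "partial_product g F x i = x i"
  using F i
proof (induction F)
  case (insert s F)
  have "partial_product g (insert s F) = translate g s \<circ> partial_product g F"
    using insert by (intro partial_product_insert[OF S]) auto
  then show ?case using insert x partial_product_autos[OF g] by (simp add: translate_outside_moved)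
qed simp

lemma finite_relevant: "g \<in> gates \<Longrightarrow> finite {s \<in> S. i - s \<in> moved g}"
  by (rule finite_subset[of _ "(\<lambda>d. i - d) ` moved g"]) (auto simp: gates_def image_iff, force)

lemma lattice_eq_partial_product:
  assumes g: "g \<in> gates" "commuting g S" and x: "x \<in> X"
    and F: "finite F" "F \<subseteq> S" "\<And>s. s \<in> S \<Longrightarrow> i - s \<in> moved g \<Longrightarrow> s \<in> F"
  shows "lattice_map g S x i = partial_product g F x i"
proof -
  let ?R = "{s \<in> S. i - s \<in> moved g}"
  have R: "?R \<subseteq> F" using F(3) by auto
  have "partial_product g (F - ?R \<union> ?R) = partial_product g (F - ?R) \<circ> partial_product g ?R"
    using F R finite_relevant[OF g(1)] by (intro partial_product_Un[OF g(2)]) auto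
  then have "partial_product g F x i = partial_product g (F - ?R) (partial_product g ?R x) i"
    using R by (simp add: Un_absorb2)
  also have "\<dots> = partial_product g ?R x i"
    using F x partial_product_autos[OF gates_autos[OF g(1)]]
    by (intro partial_product_unmoved[OF gates_autos[OF g(1)] g(2)]) auto
  finally show ?thesis using x by (simp add: lattice_map_def)
qed

lemma lattice_window:
  assumes g: "g \<in> gates" "commuting g S" and D: "finite D"
  obtains F0 where "finite F0" "F0 \<subseteq> S"
    "\<And>F x. finite F \<Longrightarrow> F0 \<subseteq> F \<Longrightarrow> F \<subseteq> S \<Longrightarrow> x \<in> X \<Longrightarrow> agree D (lattice_map g S x) (partial_product g F x)"
proof
  let ?F0 = "\<Union>i\<in>D. {s \<in> S. i - s \<in> moved g}"
  show "finite ?F0" using D finite_relevant[OF g(1)] by blast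
  show "?F0 \<subseteq> S" by blast
  fix F x assume "finite F" "?F0 \<subseteq> F" "F \<subseteq> S" "x \<in> X"
  then show "agree D (lattice_map g S x) (partial_product g F x)"
    by (intro agreeI lattice_eq_partial_product[OF g]) auto
qed

text \<open>On every window the lattice agrees with a finite product, and \<open>X\<close> is closed.\<close>

lemma lattice_mem:
  assumes g: "g \<in> gates" "commuting g S" and x: "x \<in> X" shows "lattice_map g S x \<in> X"
proof (rule compact_config_closed[OF compact])
  fix r
  obtain F0 where "finite F0" "F0 \<subseteq> S" "agree {-r..r} (lattice_map g S x) (partial_product g F0 x)"
    using lattice_window[OF g finite_atLeastAtMost_int[of "-r" r]] x by (metis order_refl)
  then show "\<exists>y\<in>X. agree {-r..r} (lattice_map g S x) y"
    using partial_product_autos[OF gates_autos[OF g(1)]] x by (meson autos_mem)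
qed

text \<open>Both lattices can be truncated simultaneously: the truncation of the outer one is a
  continuous map, so it sees only a bounded part of the inner one.\<close>

lemma lattice_comp_truncate:
  assumes g: "g \<in> gates" "commuting g S" and h: "h \<in> gates" "commuting h T"
  obtains F0 H0 where "finite F0" "F0 \<subseteq> S" "finite H0" "H0 \<subseteq> T"
    "\<And>F H x. finite F \<Longrightarrow> F0 \<subseteq> F \<Longrightarrow> F \<subseteq> S \<Longrightarrow> finite H \<Longrightarrow> H0 \<subseteq> H \<Longrightarrow> H \<subseteq> T \<Longrightarrow> x \<in> X \<Longrightarrow>
       lattice_map g S (lattice_map h T x) i = partial_product g F (partial_product h H x) i"
proof -
  obtain F0 where F0: "finite F0" "F0 \<subseteq> S"
    "\<And>F x. finite F \<Longrightarrow> F0 \<subseteq> F \<Longrightarrow> F \<subseteq> S \<Longrightarrow> x \<in> X \<Longrightarrow> agree {i} (lattice_map g S x) (partial_product g F x)"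
    using lattice_window[OF g, of "{i}"] by auto
  have a: "partial_product g F0 \<in> autos X"
    by (rule partial_product_autos[OF gates_autos[OF g(1)]])
  obtain r where r: "\<And>x y. x \<in> X \<Longrightarrow> y \<in> X \<Longrightarrow> agree {-r..r} x y \<Longrightarrow>
      partial_product g F0 x i = partial_product g F0 y i"
    using window_continuousE[OF autos_continuous[OF a]] by metis
  obtain H0 where H0: "finite H0" "H0 \<subseteq> T"
    "\<And>F x. finite F \<Longrightarrow> H0 \<subseteq> F \<Longrightarrow> F \<subseteq> T \<Longrightarrow> x \<in> X \<Longrightarrow> agree {-r..r} (lattice_map h T x) (partial_product h F x)"
    using lattice_window[OF h, of "{-r..r}"] by auto
  show ?thesis
  proof (rule that[OF F0(1,2) H0(1,2)])
    fix F H x assume F: "finite F" "F0 \<subseteq> F" "F \<subseteq> S" and H: "finite H" "H0 \<subseteq> H" "H \<subseteq> T" and x: "x \<in> X"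
    have p: "partial_product h H x \<in> X"
      using x partial_product_autos[OF gates_autos[OF h(1)]] by simp
    have "lattice_map g S (lattice_map h T x) i = partial_product g F0 (lattice_map h T x) i"
      using F0(3)[of F0, OF F0(1) order_refl F0(2) lattice_mem[OF h x]] by (simp add: agree_def)
    also have "\<dots> = partial_product g F0 (partial_product h H x) i"
      using r lattice_mem[OF h x] p H0(3)[OF H x] by blast
    also have "\<dots> = lattice_map g S (partial_product h H x) i"
      using F0(3)[of F0, OF F0(1) order_refl F0(2) p] by (simp add: agree_def)
    also have "\<dots> = partial_product g F (partial_product h H x) i"
      using F0(3)[OF F p] by (simp add: agree_def)
    finally show "lattice_map g S (lattice_map h T x) i = partial_product g F (partial_product h H x) i" .
  qed
qed

lemma lattice_Un:
  assumes g: "g \<in> gates" "commuting g (S \<union> T)" and "S \<inter> T = {}"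
  shows "lattice_map g (S \<union> T) = lattice_map g S \<circ> lattice_map g T"
proof (intro ext)
  fix x i
  have gS: "commuting g S" "commuting g T" using commuting_subset[OF g(2)] by auto
  show "lattice_map g (S \<union> T) x i = (lattice_map g S \<circ> lattice_map g T) x i"
  proof (cases "x \<in> X")
    case True
    obtain F0 H0 where F: "finite F0" "F0 \<subseteq> S" "finite H0" "H0 \<subseteq> T"
      "\<And>F H x. finite F \<Longrightarrow> F0 \<subseteq> F \<Longrightarrow> F \<subseteq> S \<Longrightarrow> finite H \<Longrightarrow> H0 \<subseteq> H \<Longrightarrow> H \<subseteq> T \<Longrightarrow> x \<in> X \<Longrightarrow>
       lattice_map g S (lattice_map g T x) i = partial_product g F (partial_product g H x) i"
      using lattice_comp_truncate[OF g(1) gS(1) g(1) gS(2)] by metis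
    define F where "F = F0 \<union> {s \<in> S. i - s \<in> moved g}"
    define H where "H = H0 \<union> {s \<in> T. i - s \<in> moved g}"
    have FH: "finite F" "F0 \<subseteq> F" "F \<subseteq> S" "finite H" "H0 \<subseteq> H" "H \<subseteq> T"
      using F finite_relevant[OF g(1)] by (auto simp: F_def H_def)
    have "lattice_map g (S \<union> T) x i = partial_product g (F \<union> H) x i"
      using FH True by (intro lattice_eq_partial_product[OF g]) (auto simp: F_def H_def)
    also have "\<dots> = partial_product g F (partial_product g H x) i"
      using FH assms(3) by (subst partial_product_Un[OF g(2)]) auto
    also have "\<dots> = lattice_map g S (lattice_map g T x) i" using F(5)[OF FH True] by simp
    finally show ?thesis by simp
  qed (simp add: lattice_map_def)
qed

lemma lattice_inverse:
  assumes g: "g \<in> gates" "commuting g S" shows "lattice_map (inv_map g) S (lattice_map g S x) = x"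
proof (rule ext)
  fix i
  have g': "inv_map g \<in> gates" "commuting (inv_map g) S"
    using gates_inv commuting_inv gates_autos g by auto
  have P: "partial_product (inv_map g) F (partial_product g F x) = x" if "finite F" "F \<subseteq> S" for F x
    using that
  proof (induction F arbitrary: x)
    case (insert s F)
    have "partial_product (inv_map g) (insert s F) = partial_product (inv_map g) F \<circ> translate (inv_map g) s"
      using insert by (intro partial_product_insert_right[OF g'(2)]) auto
    moreover have "partial_product g (insert s F) = translate g s \<circ> partial_product g F"
      using insert by (intro partial_product_insert[OF g(2)]) auto
    moreover have "translate (inv_map g) s (translate g s y) = y" for y
      using gates_autos[OF g(1)] by (simp add: translate_inv autos_translate)
    ultimately show ?case using insert by simp
  qed simp
  show "lattice_map (inv_map g) S (lattice_map g S x) i = x i"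
  proof (cases "x \<in> X")
    case True
    obtain F0 H0 where F: "finite F0" "F0 \<subseteq> S" "finite H0" "H0 \<subseteq> S"
      "\<And>F H x. finite F \<Longrightarrow> F0 \<subseteq> F \<Longrightarrow> F \<subseteq> S \<Longrightarrow> finite H \<Longrightarrow> H0 \<subseteq> H \<Longrightarrow> H \<subseteq> S \<Longrightarrow> x \<in> X \<Longrightarrow>
       lattice_map (inv_map g) S (lattice_map g S x) i = partial_product (inv_map g) F (partial_product g H x) i"
      using lattice_comp_truncate[OF g' g] by metis
    have "lattice_map (inv_map g) S (lattice_map g S x) i
        = partial_product (inv_map g) (F0 \<union> H0) (partial_product g (F0 \<union> H0) x) i"
      using F(1-4) True by (intro F(5)) auto
    then show ?thesis using P[of "F0 \<union> H0"] F(1-4) by simp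
  qed (simp add: lattice_map_def)
qed

lemma lattice_autos:
  assumes g: "g \<in> gates" "commuting g S" shows "lattice_map g S \<in> autos X"
proof -
  have g': "inv_map g \<in> gates" "commuting (inv_map g) S"
    using gates_inv commuting_inv gates_autos g by auto
  have ii: "inv_map (inv_map g) = g"
    using permutes_inv_inv[OF autos_permutes[OF gates_autos[OF g(1)]]] .
  have "lattice_map g S permutes X"
  proof (rule bij_imp_permutes)
    show "bij_betw (lattice_map g S) X X"
      by (rule bij_betw_byWitness[where f' = "lattice_map (inv_map g) S"])
        (use lattice_inverse[OF g] lattice_inverse[OF g'] lattice_mem[OF g] lattice_mem[OF g']
         in \<open>auto simp: ii\<close>)
  qed (simp add: lattice_map_def)
  moreover have "window_continuous X (lattice_map g S)"
    unfolding window_continuous_def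
  proof
    fix i
    have "partial_product g {s \<in> S. i - s \<in> moved g} \<in> autos X"
      by (rule partial_product_autos[OF gates_autos[OF g(1)]])
    from autos_continuous[OF this]
    show "\<exists>r. \<forall>x\<in>X. \<forall>y\<in>X. agree {-r..r} x y \<longrightarrow> lattice_map g S x i = lattice_map g S y i"
      unfolding window_continuous_def by (simp add: lattice_map_def)
  qed
  ultimately show ?thesis by (simp add: autos_def)
qed

lemma partial_product_shift:
  assumes g: "g \<in> autos X" "commuting g S" and F: "finite F" "F \<subseteq> S"
  shows "partial_product g F (shift m x) = shift m (partial_product g ((+) m ` F) x)"
  using F
proof (induction F)
  case (insert s F)
  have "partial_product g (insert s F) = translate g s \<circ> partial_product g F"
    using insert by (intro partial_product_insert[OF g(2)]) auto
  moreover have "partial_product g (insert (m + s) ((+) m ` F))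
      = translate g (m + s) \<circ> partial_product g ((+) m ` F)"
    using insert by (intro partial_product_insert[OF commuting_shift[OF g(2), of m]]) auto
  moreover have "translate g s (shift m y) = shift m (translate g (m + s) y)" for y
    by (simp add: translate_def add.commute)
  ultimately show ?case using insert by simp
qed simp

lemma lattice_shift:
  assumes g: "g \<in> gates" "commuting g S" and S: "(+) m ` S = S"
  shows "lattice_map g S (shift m x) = shift m (lattice_map g S x)"
proof (cases "x \<in> X")
  case True
  show ?thesis
  proof (rule ext)
    fix i
    let ?F = "{s \<in> S. i - s \<in> moved g}"
    have F: "finite ?F" by (rule finite_relevant[OF g(1)])
    have "lattice_map g S (shift m x) i = partial_product g ?F (shift m x) i"
      using True by (simp add: lattice_map_def)
    also have "\<dots> = partial_product g ((+) m ` ?F) x (i + m)"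
      using F by (subst partial_product_shift[OF gates_autos[OF g(1)] g(2)]) (auto simp: shift_apply)
    also have "\<dots> = lattice_map g S x (i + m)"
    proof (rule lattice_eq_partial_product[OF g True, symmetric])
      fix s assume s: "s \<in> S" "i + m - s \<in> moved g"
      then obtain t where "t \<in> S" "s = m + t" using S by (metis imageE)
      then show "s \<in> (+) m ` ?F" using s by (auto simp: algebra_simps)
    qed (use F S in auto)
    finally show "lattice_map g S (shift m x) i = shift m (lattice_map g S x) i" by (simp add: shift_apply)
  qed
qed (simp add: lattice_map_def)

lemma shift_progression: "(+) (int n) ` progression n k = progression n k"
proof -
  have "int n + s \<in> progression n k" if s: "s \<in> progression n k" for s
  proof -
    obtain z where "s = int n * z + k" using s unfolding progression_def by blast
    then have "int n + s = int n * (z + 1) + k" by (simp add: algebra_simps)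
    then show ?thesis unfolding progression_def by blast
  qed
  moreover have "s \<in> (+) (int n) ` progression n k" if s: "s \<in> progression n k" for s
  proof -
    obtain z where "s = int n * z + k" using s unfolding progression_def by blast
    then have "s = int n + (int n * (z - 1) + k)" by (simp add: algebra_simps)
    then show ?thesis unfolding progression_def by blast
  qed
  ultimately show ?thesis by blast
qed

lemma progression_split:
  assumes "r \<ge> 1"
  shows "progression n k = (\<Union>j<r. progression (r * n) (k + int (j * n)))"
proof (intro equalityI subsetI)
  fix s assume "s \<in> progression n k"
  then obtain z where z: "s = int n * z + k" by (auto simp: progression_def)
  define j where "j = nat (z mod int r)"
  have j: "j < r" "int j = z mod int r" using assms by (auto simp: j_def nat_less_iff)
  have "s = int (r * n) * (z div int r) + (k + int (j * n))"
    using mult_div_mod_eq[of "int r" z] unfolding z of_nat_mult j(2)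
    by (metis (no_types, opaque_lifting) add.commute add.left_commute distrib_left mult.commute mult.left_commute)
  then show "s \<in> (\<Union>j<r. progression (r * n) (k + int (j * n)))"
    using j(1) unfolding progression_def by blast
next
  fix s assume "s \<in> (\<Union>j<r. progression (r * n) (k + int (j * n)))"
  then obtain j z where "s = int (r * n) * z + (k + int (j * n))" by (auto simp: progression_def)
  then have "s = int n * (int r * z + int j) + k" by (simp add: algebra_simps)
  then show "s \<in> progression n k" by (auto simp: progression_def)
qed

lemma progression_disjoint:
  assumes "n \<ge> 1" "j < r" "j' < r" "j \<noteq> j'"
  shows "progression (r * n) (k + int (j * n)) \<inter> progression (r * n) (k + int (j' * n)) = {}"
proof (rule ccontr)
  assume "\<not> ?thesis"
  then obtain z z' where "int (r * n) * z + (k + int (j * n)) = int (r * n) * z' + (k + int (j' * n))"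
    by (auto simp: progression_def)
  then have "int n * (int r * z + int j) = int n * (int r * z' + int j')" by (simp add: algebra_simps)
  then have "int r * z + int j = int r * z' + int j'" using assms(1) by simp
  then have "(int r * z + int j) mod int r = (int r * z' + int j') mod int r" by simp
  then show False using assms by simp
qed

text \<open>Since a lattice is the product of the lattices of its residue classes, membership in a set \<open>K\<close>
  closed under composition need only be checked for lattices that are as sparse as desired.\<close>

lemma lattice_progression_split:
  assumes g: "g \<in> gates" "commuting g (progression n k)" and nr: "n \<ge> 1" "r \<ge> 1"
    and K: "id \<in> K" "\<And>f h. f \<in> K \<Longrightarrow> h \<in> K \<Longrightarrow> f \<circ> h \<in> K"
    and cls: "\<And>j. j < r \<Longrightarrow> lattice_map g (progression (r * n) (k + int (j * n))) \<in> K"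
  shows "lattice_map g (progression n k) \<in> K"
proof -
  let ?Q = "\<lambda>j. progression (r * n) (k + int (j * n))"
  have "lattice_map g (\<Union>j<m. ?Q j) \<in> K" if "m \<le> r" for m
    using that
  proof (induction m)
    case 0
    have "lattice_map g {} = id" by (auto simp: lattice_map_def fun_eq_iff)
    then show ?case using K(1) by (simp add: id_def)
  next
    case (Suc m)
    have "(\<Union>j<Suc m. ?Q j) = ?Q m \<union> (\<Union>j<m. ?Q j)" by (auto simp: less_Suc_eq)
    moreover have "(\<Union>j<Suc m. ?Q j) \<subseteq> progression n k"
      unfolding progression_split[OF nr(2), of n k] using Suc.prems by (intro UN_mono) auto
    moreover have "?Q m \<inter> (\<Union>j<m. ?Q j) = {}"
    proof -
      have "?Q m \<inter> ?Q j = {}" if "j < m" for j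
        using Suc.prems that by (intro progression_disjoint[OF nr(1)]) auto
      then show ?thesis by blast
    qed
    ultimately have "lattice_map g (\<Union>j<Suc m. ?Q j) = lattice_map g (?Q m) \<circ> lattice_map g (\<Union>j<m. ?Q j)"
      using lattice_Un[OF g(1)] commuting_subset[OF g(2)] by metis
    moreover have "lattice_map g (?Q m) \<in> K" "lattice_map g (\<Union>j<m. ?Q j) \<in> K"
      using Suc cls by auto
    ultimately show ?case using K(2) by metis
  qed
  from this[of r] show ?thesis using progression_split[OF nr(2), of n k] by simp
qed

lemma gate_iff: "gate X f \<longleftrightarrow> (\<exists>g\<in>gates. f = restrict g X)"
proof
  assume "gate X f"
  then obtain N where f: "f \<in> homeos X" "finite N" "\<forall>x\<in>X. \<forall>i. i \<notin> N \<longrightarrow> f x i = x i"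
    by (auto simp: gate_def)
  obtain g where g: "g \<in> autos X" "f = restrict g X" using homeos_autos[OF f(1)] .
  have "supported_on X N g" using f(3) g(2) by (simp add: supported_on_def)
  then show "\<exists>g\<in>gates. f = restrict g X" using g gatesI f(2) by blast
next
  assume "\<exists>g\<in>gates. f = restrict g X"
  then obtain g where g: "g \<in> gates" "f = restrict g X" by blast
  have "\<forall>x\<in>X. \<forall>i. i \<notin> moved g \<longrightarrow> f x i = x i" using g(2) by (auto simp: moved_def)
  then show "gate X f"
    using g restrict_autos_homeos[OF gates_autos[OF g(1)]] unfolding gate_def gates_def by blast
qed

lemma limitin_config:
  "limitin (config_topology X) f l F \<longleftrightarrow>
     l \<in> X \<and> (\<forall>r. eventually (\<lambda>a. f a \<in> X \<and> agree {-r..r} l (f a)) F)"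
proof (intro iffI conjI allI)
  assume L: "limitin (config_topology X) f l F"
  then show l: "l \<in> X" by (simp add: limitin_def)
  fix r
  have "openin (config_topology X) {y \<in> X. agree {-r..r} l y}"
    unfolding openin_config by (auto intro!: exI[of _ r] intro: agree_trans)
  then show "eventually (\<lambda>a. f a \<in> X \<and> agree {-r..r} l (f a)) F"
    using L l unfolding limitin_def by (auto elim: allE[of _ "{y \<in> X. agree {-r..r} l y}"])
next
  assume R: "l \<in> X \<and> (\<forall>r. eventually (\<lambda>a. f a \<in> X \<and> agree {-r..r} l (f a)) F)"
  show "limitin (config_topology X) f l F"
    unfolding limitin_def
  proof (intro conjI allI impI)
    fix U assume "openin (config_topology X) U \<and> l \<in> U"
    then obtain r where r: "\<And>y. y \<in> X \<Longrightarrow> agree {-r..r} l y \<Longrightarrow> y \<in> U"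
      unfolding openin_config by blast
    have "eventually (\<lambda>a. f a \<in> X \<and> agree {-r..r} l (f a)) F" using R by blast
    then show "eventually (\<lambda>a. f a \<in> U) F" by (rule eventually_mono) (use r in blast)
  qed (use R in simp)
qed

lemma finite_gate_product_restrict:
  assumes "g \<in> autos X" "x \<in> X"
  shows "finite_gate_product X (restrict g X) F x = partial_product g F x"
proof -
  have "foldr (gate_translate X (restrict g X)) xs x = foldr (translate g) xs x \<and>
      foldr (translate g) xs x \<in> X" for xs
    by (induction xs)
      (use assms autos_translate[OF assms(1)] in \<open>simp_all add: gate_translate_restrict del: restrict_apply\<close>,
       simp add: restrict_def)
  then show ?thesis by (simp add: finite_gate_product_def partial_product_def)
qed

lemma translates_commute_restrict:
  assumes "g \<in> autos X" shows "translates_commute X (restrict g X) S \<longleftrightarrow> commuting g S"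
  unfolding translates_commute_def commuting_def gate_translate_restrict[OF assms]
  using autos_translate[OF assms] restrict_eq_autos autos_comp
  by (smt (verit, ccfv_threshold) compose_restrict)

lemma gate_product_iff:
  assumes g: "g \<in> gates"
  shows "gate_product X (restrict g X) S f \<longleftrightarrow> commuting g S \<and> f = restrict (lattice_map g S) X"
proof -
  have a: "g \<in> autos X" by (rule gates_autos[OF g])
  have lim: "limitin (config_topology X) (\<lambda>F. finite_gate_product X (restrict g X) F x)
      (lattice_map g S x) (finite_subsets_at_top S)" if c: "commuting g S" and x: "x \<in> X" for x
    unfolding limitin_config finite_gate_product_restrict[OF a x]
  proof (intro conjI allI)
    show "lattice_map g S x \<in> X" by (rule lattice_mem[OF g c x])
    fix r
    obtain F0 where "finite F0" "F0 \<subseteq> S" "\<And>F x. finite F \<Longrightarrow> F0 \<subseteq> F \<Longrightarrow> F \<subseteq> S \<Longrightarrow> x \<in> X \<Longrightarrow>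
        agree {-r..r} (lattice_map g S x) (partial_product g F x)"
      using lattice_window[OF g c, of "{-r..r}"] by auto
    then show "eventually (\<lambda>F. partial_product g F x \<in> X \<and>
        agree {-r..r} (lattice_map g S x) (partial_product g F x)) (finite_subsets_at_top S)"
      unfolding eventually_finite_subsets_at_top using partial_product_autos[OF a] x by auto
  qed
  show ?thesis
  proof
    assume G: "gate_product X (restrict g X) S f"
    then have c: "commuting g S" by (simp add: gate_product_def translates_commute_restrict[OF a])
    have "f x = lattice_map g S x" if x: "x \<in> X" for x
      using limitin_Hausdorff_unique[OF _ lim[OF c x] _ Hausdorff_config] G x
      unfolding gate_product_def by simp
    then show "commuting g S \<and> f = restrict (lattice_map g S) X"
      using c G by (auto simp: gate_product_def extensional_def fun_eq_iff restrict_def)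
  next
    assume "commuting g S \<and> f = restrict (lattice_map g S) X"
    then show "gate_product X (restrict g X) S f"
      using lim by (simp add: gate_product_def translates_commute_restrict[OF a])
  qed
qed

lemma gate_lattices_eq:
  "gate_lattices X = {restrict (lattice_map g (progression n k)) X | g n k.
     g \<in> gates \<and> n \<ge> 1 \<and> commuting g (progression n k)}"
  unfolding gate_lattices_def using gate_iff gate_product_iff by (auto; metis)

lemma even_gate_lattices_eq:
  "even_gate_lattices X = {restrict (lattice_map g (progression n k)) X | g n k.
     g \<in> gates \<and> even_gate X (restrict g X) \<and> n \<ge> 1 \<and> commuting g (progression n k)}"
proof -
  have "even_gate X f \<Longrightarrow> \<exists>g\<in>gates. f = restrict g X" for f
    unfolding even_gate_def using gate_iff by blast
  then show ?thesis
    unfolding even_gate_lattices_def using gate_product_iff by (auto; metis)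
qed

end

section \<open>Parity\<close>

context compact_shift_space
begin

definition local_on :: "int set \<Rightarrow> ((int \<Rightarrow> 'a) \<Rightarrow> int \<Rightarrow> 'a) \<Rightarrow> bool" where
  "local_on N f \<longleftrightarrow> f \<in> autos X \<and> supported_on X N f \<and>
     (\<forall>x\<in>X. \<forall>y\<in>X. agree N x y \<longrightarrow> agree N (f x) (f y))"

text \<open>For \<open>f\<close> local on \<open>N\<close> the result does not depend on the chosen extension of the pattern.\<close>

definition pattern_action :: "int set \<Rightarrow> ((int \<Rightarrow> 'a) \<Rightarrow> int \<Rightarrow> 'a) \<Rightarrow> (int \<Rightarrow> 'a) \<Rightarrow> int \<Rightarrow> 'a" where
  "pattern_action N f p = restrict (f (SOME x. x \<in> X \<and> restrict x N = p)) N"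

definition even_on :: "int set \<Rightarrow> ((int \<Rightarrow> 'a) \<Rightarrow> int \<Rightarrow> 'a) \<Rightarrow> (int \<Rightarrow> 'a) set \<Rightarrow> bool" where
  "even_on N f F \<longleftrightarrow> evenperm (perm_restrict (pattern_action N f) F)"

lemma restrict_eq_iff_agree: "restrict x N = restrict y N \<longleftrightarrow> agree N x y"
  by (auto simp: fun_eq_iff agree_def restrict_def)

lemma gate_local:
  assumes g: "g \<in> gates" obtains L0 where "L0 \<ge> 0" "\<And>L. L \<ge> L0 \<Longrightarrow> local_on {-L..L} g"
proof -
  have a: "g \<in> autos X" and f: "finite (moved g)" using g by (auto simp: gates_def)
  obtain d where d: "d \<ge> 0" "moved g \<subseteq> {-d..d}" using finite_subset_window[OF f] by auto
  obtain r where r: "r \<ge> 0" "\<And>x y. x \<in> X \<Longrightarrow> y \<in> X \<Longrightarrow> agree {-r..r} x y \<Longrightarrow> agree (moved g) (g x) (g y)"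
    using window_continuous_finite[OF autos_continuous[OF a] f] by metis
  show ?thesis
  proof (rule that[of "max d r"])
    fix L assume L: "L \<ge> max d r"
    have "supported_on X {-L..L} g"
      by (rule supported_on_mono[OF supported_on_moved]) (use d(2) L in auto)
    moreover have "agree {-L..L} (g x) (g y)" if x: "x \<in> X" "y \<in> X" and ag: "agree {-L..L} x y" for x y
    proof (rule agreeI)
      fix i assume i: "i \<in> {-L..L}"
      have "agree {-r..r} x y" by (rule agree_mono[OF ag]) (use L in auto)
      then have near: "agree (moved g) (g x) (g y)" using r(2) x by blast
      show "g x i = g y i"
      proof (cases "i \<in> moved g")
        case False
        then show ?thesis using supported_onD[OF supported_on_moved] x agreeD[OF ag i] by metis
      qed (rule agreeD[OF near])
    qed
    ultimately show "local_on {-L..L} g" using a by (simp add: local_on_def)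
  qed (use d in auto)
qed

lemma local_on_comp: "local_on N f \<Longrightarrow> local_on N f' \<Longrightarrow> local_on N (f \<circ> f')"
  unfolding local_on_def by (auto intro: autos_comp supported_on_comp autos_permutes)

lemma pattern_action_restrict:
  assumes "local_on N f" "x \<in> X" shows "pattern_action N f (restrict x N) = restrict (f x) N"
proof -
  let ?u = "SOME u. u \<in> X \<and> restrict u N = restrict x N"
  have u: "?u \<in> X \<and> restrict ?u N = restrict x N" by (rule someI[of _ x]) (use assms in auto)
  then have "agree N ?u x" by (simp only: restrict_eq_iff_agree)
  then have "agree N (f ?u) (f x)" using assms u unfolding local_on_def by blast
  then show ?thesis unfolding pattern_action_def by (simp only: restrict_eq_iff_agree)
qed

lemma pattern_action_filling:
  assumes f: "local_on N f" and x: "x \<in> X" "restrict x (- N) = y"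
  shows "f x \<in> X" "restrict (f x) (- N) = y"
proof -
  show "f x \<in> X" using f x by (simp add: local_on_def)
  have "agree (- N) (f x) x"
    by (rule agreeI) (use f x in \<open>auto simp: local_on_def supported_on_def\<close>)
  then show "restrict (f x) (- N) = y" using x(2) restrict_eq_iff_agree[of "f x" "-N" x] by simp
qed

lemma pattern_action_permutes:
  assumes f: "local_on N f" and fin: "finite (fillings X N y)"
  shows "perm_restrict (pattern_action N f) (fillings X N y) permutes fillings X N y"
proof -
  let ?F = "fillings X N y" and ?a = "pattern_action N f"
  have "inj_on ?a ?F"
  proof (rule inj_onI)
    fix p p' assume "p \<in> ?F" "p' \<in> ?F" and eq: "?a p = ?a p'"
    then obtain x x' where x: "x \<in> X" "restrict x (- N) = y" "p = restrict x N"
      and x': "x' \<in> X" "restrict x' (- N) = y" "p' = restrict x' N"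
      unfolding fillings_def by blast
    have "restrict (f x) N = restrict (f x') N"
      using eq pattern_action_restrict[OF f] x x' by simp
    then have "agree N (f x) (f x')" by (simp only: restrict_eq_iff_agree)
    moreover have "agree (-N) (f x) (f x')"
      using pattern_action_filling[OF f x(1,2)] pattern_action_filling[OF f x'(1,2)]
      by (simp only: flip: restrict_eq_iff_agree)
    ultimately have "f x = f x'" by (auto simp: agree_def fun_eq_iff)
    then have "x = x'"
      using f permutes_inj[OF autos_permutes, of f] by (auto simp: local_on_def dest: injD)
    then show "p = p'" using x x' by simp
  qed
  moreover have "?a ` ?F \<subseteq> ?F"
    using pattern_action_restrict[OF f] pattern_action_filling[OF f] unfolding fillings_def by fastforce
  ultimately have "bij_betw ?a ?F ?F" using endo_inj_surj[OF fin] by (auto simp: bij_betw_def)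
  then have "bij_betw (perm_restrict ?a ?F) ?F ?F"
    using bij_betw_cong[of ?F "perm_restrict ?a ?F" ?a ?F] by (simp add: perm_restrict_def)
  then show ?thesis by (rule bij_imp_permutes) (simp add: perm_restrict_def)
qed

lemma even_on_comp:
  assumes f: "local_on N f" "local_on N f'" and fin: "finite (fillings X N y)"
  shows "even_on N (f \<circ> f') (fillings X N y) \<longleftrightarrow>
     (even_on N f (fillings X N y) \<longleftrightarrow> even_on N f' (fillings X N y))"
proof -
  let ?F = "fillings X N y" and ?a = "\<lambda>f. perm_restrict (pattern_action N f) (fillings X N y)"
  have "?a (f \<circ> f') p = (?a f \<circ> ?a f') p" for p
  proof (cases "p \<in> ?F")
    case True
    then obtain x where x: "x \<in> X" "restrict x (- N) = y" "p = restrict x N"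
      unfolding fillings_def by blast
    note fx = pattern_action_filling[OF f(2) x(1,2)]
    have "restrict (f' x) N \<in> ?F" using fx unfolding fillings_def by blast
    moreover have "pattern_action N (f \<circ> f') p = restrict (f (f' x)) N"
      using pattern_action_restrict[OF local_on_comp[OF f] x(1)] x(3) by simp
    ultimately show ?thesis
      using True pattern_action_restrict[OF f(2) x(1)] pattern_action_restrict[OF f(1) fx(1)] x(3)
      by (simp add: perm_restrict_def)
  qed (simp add: perm_restrict_def)
  then have "?a (f \<circ> f') = ?a f \<circ> ?a f'" by blast
  moreover have "permutation (?a f)" "permutation (?a f')"
    using pattern_action_permutes[OF _ fin] f permutes_imp_permutation[OF fin] by auto
  ultimately show ?thesis unfolding even_on_def by (simp only: evenperm_comp)
qed

lemma even_gateI: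
  assumes f: "local_on N f" and N: "finite N"
    and fin: "\<And>y. finite (fillings X N y)"
    and even: "\<And>x. x \<in> X \<Longrightarrow> even_on N f (fillings X N (restrict x (- N)))"
  shows "even_gate X (restrict f X)"
proof -
  have a: "f \<in> autos X" and s: "supported_on X N f" using f by (auto simp: local_on_def)
  have "gate X (restrict f X)" using gate_iff gatesI[OF a N s] by blast
  moreover have "strong_neighborhood X (restrict f X) N (pattern_action N f)"
    unfolding strong_neighborhood_def patterns_def
    using N s a pattern_action_restrict[OF f] by (auto simp: supported_on_def)
  moreover have "evenperm (perm_restrict (pattern_action N f) (fillings X N y))"
    if "y \<in> patterns X (- N)" for y
    using that even unfolding patterns_def even_on_def by auto
  ultimately show ?thesis
    unfolding even_gate_def using pattern_action_permutes[OF f fin] by blast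
qed

text \<open>Gluing makes the set of fillings of an interval depend only on a bounded context on each
  side, so the number of such sets is bounded independently of the length of the interval. The
  parities of a gate on the fillings of a long interval are therefore among boundedly many
  patterns, and two of many translates of the gate must share them; their product is even.\<close>

lemma even_translate_pair:
  assumes A: "finite A" "X \<subseteq> full_shift A" and X: "gluing X w"
    and g: "g \<in> gates" and S: "infinite S"
  obtains s t where "s \<in> S" "t \<in> S" "s < t" "even_gate X (restrict (translate g s \<circ> translate g t) X)"
proof -
  have w: "w \<ge> 0" using X by (simp add: gluing_def)
  have glue: "(\<lambda>i. if i < a then x i else y i) \<in> X"
    if "x \<in> X" "y \<in> X" "agree {a..a+w} x y" for x y a
    using X that unfolding gluing_def by blast
  \<comment> \<open>\<open>C\<close> bounds the number of contexts of \<open>w + 1\<close> cells on each side, hence the number of sets of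
    fillings, and \<open>2 ^ C\<close> bounds the number of ways to assign parities to them.\<close>
  define C where "C = card A ^ nat (2 * (w + 1))"
  obtain F where F: "finite F" "card F = 2 ^ C + 1" "F \<subseteq> S"
    using infinite_arbitrarily_large[OF S] by blast
  have "\<exists>L\<ge>0. \<forall>s\<in>F. \<forall>L'\<ge>L. local_on {-L'..L'} (translate g s)"
  proof (rule common_window[OF F(1)])
    fix s show "\<exists>L. \<forall>L'\<ge>L. local_on {-L'..L'} (translate g s)"
      using gate_local[OF gates_translate[OF g]] by metis
  qed auto
  then obtain L where L: "L \<ge> 0" "\<And>s. s \<in> F \<Longrightarrow> local_on {-L..L} (translate g s)" by blast
  let ?N = "{-L..L}"
  let ?fill = "\<lambda>x. fillings X ?N (restrict x (- ?N))"
  have fin: "finite (fillings X ?N y)" for y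
  proof (rule finite_subset)
    show "fillings X ?N y \<subseteq> PiE ?N (\<lambda>_. A)"
      using A(2) unfolding fillings_def full_shift_def by auto
    show "finite (PiE ?N (\<lambda>_. A))" using A(1) by (simp add: finite_PiE)
  qed
  define D where "D = {-L-w-1..-L-1} \<union> {L+1..L+w+1}"
  have fill_le: "?fill x \<subseteq> ?fill x'" if x: "x \<in> X" "x' \<in> X" and ag: "agree D x x'" for x x'
  proof
    fix p assume "p \<in> ?fill x"
    then obtain z where z: "z \<in> X" "restrict z (- ?N) = restrict x (- ?N)" "p = restrict z ?N"
      unfolding fillings_def by blast
    then have zx: "agree (- ?N) z x" by (simp only: restrict_eq_iff_agree)
    have zD: "z i = x' i" if "i \<in> D" for i
      using agreeD[OF zx, of i] agreeD[OF ag that] that L(1) unfolding D_def by auto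
    \<comment> \<open>Replace the outside of the interval by \<open>x'\<close>, first on the left and then on the right.\<close>
    define z1 where "z1 = (\<lambda>i. if i < -L-w-1 then x' i else z i)"
    have z1: "z1 \<in> X"
      unfolding z1_def by (rule glue[OF x(2) z(1)], rule agreeI, rule zD[symmetric]) (simp add: D_def)
    define z2 where "z2 = (\<lambda>i. if i < L+1 then z1 i else x' i)"
    have "agree {L+1..L+1+w} z1 x'"
      by (rule agreeI) (use zD L(1) w in \<open>simp add: z1_def D_def\<close>)
    then have z2: "z2 \<in> X" unfolding z2_def by (rule glue[OF z1 x(2)])
    have "agree ?N z z2" using L(1) w by (auto simp: agree_def z2_def z1_def)
    then have "p = restrict z2 ?N" using z(3) by (simp only: restrict_eq_iff_agree)
    moreover have "agree (- ?N) z2 x'"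
    proof (rule agreeI)
      fix i assume "i \<in> - ?N"
      then show "z2 i = x' i" using zD[of i] by (auto simp: z2_def z1_def D_def)
    qed
    then have "restrict z2 (- ?N) = restrict x' (- ?N)" by (simp only: restrict_eq_iff_agree)
    ultimately show "p \<in> ?fill x'" using z2 unfolding fillings_def by blast
  qed
  have fill_eq: "?fill x = ?fill x'" if "x \<in> X" "x' \<in> X" "agree D x x'" for x x'
    using fill_le[OF that] fill_le[OF that(2,1) agree_sym[OF that(3)]] by blast
  have finD: "finite D" by (simp add: D_def)
  have "patterns X D \<subseteq> PiE D (\<lambda>_. A)" using A(2) unfolding patterns_def full_shift_def by auto
  then have pat: "finite (patterns X D)" "card (patterns X D) \<le> card (PiE D (\<lambda>_. A))"
    using A(1) finD by (auto intro: card_mono finite_subset finite_PiE)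
  have "card D = nat (2 * (w + 1))"
    unfolding D_def using L(1) w by (subst card_Un_disjoint) (auto simp: nat_add_distrib)
  then have "card (PiE D (\<lambda>_. A)) = C" using finD by (simp add: card_PiE C_def)
  then have cpat: "card (patterns X D) \<le> C" using pat(2) by simp
  have sub: "?fill ` X \<subseteq> (\<lambda>p. ?fill (SOME x. x \<in> X \<and> restrict x D = p)) ` patterns X D"
  proof
    fix K assume "K \<in> ?fill ` X"
    then obtain x where x: "x \<in> X" "K = ?fill x" by blast
    let ?u = "SOME u. u \<in> X \<and> restrict u D = restrict x D"
    have u: "?u \<in> X \<and> restrict ?u D = restrict x D" by (rule someI[of _ x]) (use x in auto)
    then have "agree D ?u x" by (simp only: restrict_eq_iff_agree)
    then have "K = ?fill ?u" using fill_eq[of ?u x] u x by simp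
    moreover have "restrict x D \<in> patterns X D" using x by (auto simp: patterns_def)
    ultimately show "K \<in> (\<lambda>p. ?fill (SOME x. x \<in> X \<and> restrict x D = p)) ` patterns X D" by blast
  qed
  have fam: "finite (?fill ` X)" "card (?fill ` X) \<le> C"
    using finite_subset[OF sub finite_imageI[OF pat(1)]]
      card_mono[OF finite_imageI[OF pat(1)] sub] card_image_le[OF pat(1)] cpat
    by (auto intro: order_trans)
  define e where "e s = {K \<in> ?fill ` X. even_on ?N (translate g s) K}" for s
  have "card (e ` F) \<le> card (Pow (?fill ` X))"
    using fam by (intro card_mono) (auto simp: e_def)
  also have "\<dots> = 2 ^ card (?fill ` X)" using fam(1) by (rule card_Pow)
  also have "\<dots> \<le> 2 ^ C" using fam(2) by simp
  finally have "card (e ` F) < card F" using F(2) by simp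
  then have "\<not> inj_on e F" by (rule pigeonhole)
  then obtain s t where st: "s \<in> F" "t \<in> F" "s < t" "e s = e t"
    unfolding inj_on_def by (metis linorder_neqE)
  have "even_gate X (restrict (translate g s \<circ> translate g t) X)"
  proof (rule even_gateI[OF local_on_comp[OF L(2)[OF st(1)] L(2)[OF st(2)]] _ fin])
    fix x assume "x \<in> X"
    then have "even_on ?N (translate g s) (?fill x) = even_on ?N (translate g t) (?fill x)"
      using st(4) unfolding e_def by blast
    then show "even_on ?N (translate g s \<circ> translate g t) (?fill x)"
      using even_on_comp[OF L(2)[OF st(1)] L(2)[OF st(2)] fin] by blast
  qed simp
  then show ?thesis using that st F(3) by blast
qed

text \<open>A lattice over the union of two translates of \<open>U\<close> is a lattice over \<open>U\<close> of a product of two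
  translated gates. With \<open>U\<close> of period \<open>2d\<close> and translates \<open>d\<close> apart this regroups a lattice of
  period \<open>d\<close> in pairs.\<close>

lemma lattice_pair:
  assumes g: "g \<in> gates" "commuting g S" and U: "(+) s ` U \<union> (+) t ` U \<subseteq> S"
    and dis: "(+) s ` U \<inter> (+) t ` U = {}"
  defines "f \<equiv> translate g s \<circ> translate g t"
  shows "commuting f U" "lattice_map f U = lattice_map g ((+) s ` U \<union> (+) t ` U)"
proof -
  have tr: "translate f u x = translate g (s + u) (translate g (t + u) x)" for u x
    by (simp add: f_def translate_comp)
  note swap = commuting_apply[OF g(2)]
  have mem: "s + u \<in> S" "t + u \<in> S" if "u \<in> U" for u using U that by auto
  show c: "commuting f U"
    unfolding commuting_def
  proof (intro ballI ext)
    fix u v x i assume u: "u \<in> U" and v: "v \<in> U"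
    let ?T = "translate g"
    have "?T (s+u) (?T (t+u) (?T (s+v) (?T (t+v) x))) = ?T (s+u) (?T (s+v) (?T (t+u) (?T (t+v) x)))"
      using swap[of "t+u" "s+v"] mem u v by simp
    also have "\<dots> = ?T (s+v) (?T (s+u) (?T (t+v) (?T (t+u) x)))"
      using swap[of "s+u" "s+v"] swap[of "t+u" "t+v"] mem u v by simp
    also have "\<dots> = ?T (s+v) (?T (t+v) (?T (s+u) (?T (t+u) x)))"
      using swap[of "s+u" "t+v"] mem u v by simp
    finally show "(translate f u \<circ> translate f v) x i = (translate f v \<circ> translate f u) x i"
      by (simp add: tr)
  qed
  have f: "f \<in> gates" unfolding f_def by (intro gates_comp gates_translate g(1))
  have P: "partial_product f F = partial_product g ((+) s ` F \<union> (+) t ` F)"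
    if "finite F" "F \<subseteq> U" for F
    using that
  proof (induction F)
    case (insert u F)
    let ?G = "(+) s ` F \<union> (+) t ` F"
    have G: "finite ?G" "?G \<subseteq> S" using insert U by auto
    have u: "s + u \<in> S" "t + u \<in> S" using insert.prems mem by auto
    have disj: "s + a \<noteq> t + b" if "a \<in> U" "b \<in> U" for a b using dis that by blast
    have "t + u \<notin> ?G" using insert.hyps insert.prems disj[of _ u] by fastforce
    moreover have "s + u \<notin> insert (t + u) ?G"
      using insert.hyps insert.prems disj[of u] by fastforce
    ultimately have "partial_product g (insert (s + u) (insert (t + u) ?G))
        = translate g (s + u) \<circ> (translate g (t + u) \<circ> partial_product g ?G)"
      using G u partial_product_insert[OF g(2), of "s + u" "insert (t + u) ?G"]
        partial_product_insert[OF g(2), of "t + u" ?G] by simp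
    moreover have "partial_product f (insert u F) = translate f u \<circ> partial_product f F"
      using insert by (intro partial_product_insert[OF c]) auto
    moreover have "(+) s ` insert u F \<union> (+) t ` insert u F = insert (s + u) (insert (t + u) ?G)"
      by auto
    moreover have "translate f u = translate g (s + u) \<circ> translate g (t + u)"
      by (simp add: f_def translate_comp)
    moreover have "partial_product f F = partial_product g ?G" using insert by blast
    ultimately show ?case by (simp only: comp_assoc)
  qed simp
  show "lattice_map f U = lattice_map g ((+) s ` U \<union> (+) t ` U)"
  proof (intro ext)
    fix x i
    let ?V = "(+) s ` U \<union> (+) t ` U"
    show "lattice_map f U x i = lattice_map g ?V x i"
    proof (cases "x \<in> X")
      case True
      define F where "F = {u \<in> U. i - u \<in> moved f} \<union>
        ({u \<in> U. (i - s) - u \<in> moved g} \<union> {u \<in> U. (i - t) - u \<in> moved g})"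
      have F: "finite F" "F \<subseteq> U" unfolding F_def using finite_relevant f g(1) by auto
      have "lattice_map f U x i = partial_product f F x i"
        using F by (intro lattice_eq_partial_product[OF f c True]) (auto simp: F_def)
      also have "\<dots> = partial_product g ((+) s ` F \<union> (+) t ` F) x i" using P[OF F] by simp
      also have "\<dots> = lattice_map g ?V x i"
        using F by (intro lattice_eq_partial_product[OF g(1) commuting_subset[OF g(2) U] True, symmetric])
          (auto simp: F_def algebra_simps)
      finally show ?thesis .
    qed (simp add: lattice_map_def)
  qed
qed

lemma shift_progression_by: "(+) s ` progression n k = progression n (s + k)"
  unfolding progression_def by (auto simp: image_iff algebra_simps)

text \<open>Pick two translates with even product at distance \<open>r * n\<close>, split the lattice into \<open>r\<close> residue
  classes, and pair the gates in each class at that distance.\<close>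

lemma gate_lattice_in_even_group:
  assumes A: "finite A" "X \<subseteq> full_shift A" and X: "gluing X w"
    and g: "g \<in> gates" "commuting g (progression n k)" "n \<ge> 1"
  shows "restrict (lattice_map g (progression n k)) X \<in> even_gate_lattice_group X"
proof -
  have "inj (\<lambda>z. int n * z + k)" using g(3) by (auto simp: inj_def)
  then have "infinite (range (\<lambda>z. int n * z + k))" by (simp add: finite_image_iff infinite_UNIV_int)
  then have "infinite (progression n k)" by (simp add: progression_def full_SetCompr_eq)
  from even_translate_pair[OF A X g(1) this]
  obtain s t where st: "s \<in> progression n k" "t \<in> progression n k" "s < t"
    and even: "even_gate X (restrict (translate g s \<circ> translate g t) X)"
    by metis
  obtain y z where yz: "s = int n * y + k" "t = int n * z + k" using st unfolding progression_def by blast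
  have nz: "int n * y < int n * z" using st(3) yz by simp
  then have "y < z" using g(3) by simp
  define r where "r = nat (z - y)"
  have r: "r \<ge> 1" "t = s + int (r * n)" using \<open>y < z\<close> yz by (auto simp: r_def algebra_simps)
  have ks: "progression n k = progression n s"
  proof -
    have "int n * z + k = int n * (z - y) + s" for z using yz by (simp add: algebra_simps)
    moreover have "int n * z + s = int n * (z + y) + k" for z using yz by (simp add: algebra_simps)
    ultimately show ?thesis unfolding progression_def by blast
  qed
  let ?K = "{f \<in> autos X. restrict f X \<in> even_gate_lattice_group X}"
  have "lattice_map g (progression n s) \<in> ?K"
  proof (rule lattice_progression_split[OF g(1) g(2)[unfolded ks] g(3) r(1)])
    show "id \<in> ?K"
      unfolding even_gate_lattice_group_def using autos_id generate_restrict_id by blast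
    show "f \<circ> f' \<in> ?K" if "f \<in> ?K" "f' \<in> ?K" for f f'
      using that autos_comp generate_restrict_comp unfolding even_gate_lattice_group_def by blast
    fix j assume j: "j < r"
    let ?U = "progression (2 * (r * n)) (int (j * n))" and ?V = "progression (r * n) (s + int (j * n))"
    have VS: "?V \<subseteq> progression n k"
    proof -
      have "progression n s = (\<Union>j<r. progression (r * n) (s + int (j * n)))"
        by (rule progression_split[OF r(1)])
      then show ?thesis using j ks by blast
    qed
    have rn: "r * n \<ge> 1" using r(1) g(3) by simp
    have "?V = (\<Union>i<2. progression (2 * (r * n)) (s + int (j * n) + int (i * (r * n))))"
      by (rule progression_split) simp
    also have "\<dots> = progression (2 * (r * n)) (s + int (j * n) + int (0 * (r * n)))
        \<union> progression (2 * (r * n)) (s + int (j * n) + int (1 * (r * n)))"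
      by (auto simp: numeral_2_eq_2 less_Suc_eq)
    also have "\<dots> = (+) s ` ?U \<union> (+) t ` ?U"
      unfolding shift_progression_by by (simp add: r(2) algebra_simps)
    finally have V: "?V = (+) s ` ?U \<union> (+) t ` ?U" .
    have dis: "(+) s ` ?U \<inter> (+) t ` ?U = {}"
      using progression_disjoint[OF rn, of 0 2 1 "s + int (j * n)"]
      unfolding shift_progression_by by (simp add: r(2) algebra_simps)
    let ?f = "translate g s \<circ> translate g t"
    note pair = lattice_pair[OF g(1) g(2) _ dis, folded V, OF VS]
    have "restrict (lattice_map ?f ?U) X \<in> even_gate_lattices X"
      unfolding even_gate_lattices_eq
      using pair(1) even rn gates_comp[OF gates_translate[OF g(1)] gates_translate[OF g(1)], of s t]
      by (intro CollectI exI[of _ ?f] exI[of _ "2 * (r * n)"] exI[of _ "int (j * n)"]) auto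
    then have "restrict (lattice_map g ?V) X \<in> even_gate_lattice_group X"
      unfolding pair(2) even_gate_lattice_group_def by (rule generate.incl)
    then show "lattice_map g ?V \<in> ?K"
      using lattice_autos[OF g(1) commuting_subset[OF g(2) VS]] by blast
  qed
  then show ?thesis using ks by simp
qed

end

section \<open>Gate lattices are products of inert automorphisms\<close>

lemma edge_shift_mem:
  "p \<in> edge_shift G \<longleftrightarrow> (\<forall>n. p n \<in> arcs G) \<and> (\<forall>n. head G (p n) = tail G (p (n + 1)))"
  by (auto simp: edge_shift_def)

lemma edge_shift_shift: "p \<in> edge_shift G \<Longrightarrow> shift k p \<in> edge_shift G"
  unfolding edge_shift_mem shift_def by (simp add: algebra_simps)

definition block_code :: "nat \<Rightarrow> (int \<Rightarrow> nat) \<Rightarrow> int \<Rightarrow> nat" where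
  "block_code N y z = to_nat (map (\<lambda>j. y (int N * z + int j)) [0..<N])"

text \<open>The graph whose edges are the paths of length \<open>N\<close>. Only vertices and paths that occur in
  a bi-infinite path are kept, which makes the degree conditions immediate.\<close>

definition power_graph :: "nat \<Rightarrow> (nat, nat) pre_digraph \<Rightarrow> (nat, nat) pre_digraph" where
  "power_graph N G = \<lparr>verts = (\<lambda>y. tail G (y 0)) ` edge_shift G,
     arcs = (\<lambda>y. block_code N y 0) ` edge_shift G,
     tail = (\<lambda>e. tail G (hd (from_nat e))), head = (\<lambda>e. head G (last (from_nat e)))\<rparr>"

lemma block_code_eq_iff:
  "block_code N y z = block_code N y' z \<longleftrightarrow> agree {int N * z..<int N * (z + 1)} y y'"
proof -
  have "agree {int N * z..<int N * (z + 1)} y y' \<longleftrightarrow>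
      (\<forall>j<N. y (int N * z + int j) = y' (int N * z + int j))"
  proof (intro iffI allI impI agreeI)
    fix i assume a: "\<forall>j<N. y (int N * z + int j) = y' (int N * z + int j)"
      and i: "i \<in> {int N * z..<int N * (z + 1)}"
    have "nat (i - int N * z) < N" using i by (auto simp: algebra_simps)
    then show "y i = y' i" using a i by fastforce
  qed (auto simp: agree_def algebra_simps)
  then show ?thesis by (auto simp: block_code_def)
qed

lemma block_code_shift: "block_code N (shift (int N * k) y) z = block_code N y (z + k)"
  by (simp add: block_code_def shift_apply algebra_simps)

context
  fixes N :: nat assumes N: "N \<ge> 1"
begin

lemma tail_block_code: "tail (power_graph N G) (block_code N y z) = tail G (y (int N * z))"
  using N by (simp add: power_graph_def block_code_def hd_map)

lemma head_block_code:
  "head (power_graph N G) (block_code N y z) = head G (y (int N * (z + 1) - 1))"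
  using N by (simp add: power_graph_def block_code_def last_map of_nat_diff algebra_simps)

lemma block_code_arc:
  assumes "y \<in> edge_shift G" shows "block_code N y z \<in> arcs (power_graph N G)"
proof -
  have "block_code N y z = block_code N (shift (int N * z) y) 0" by (simp add: block_code_shift)
  then show ?thesis using edge_shift_shift[OF assms] by (auto simp: power_graph_def)
qed

lemma edge_shift_head: "y \<in> edge_shift G \<Longrightarrow> head G (y (i - 1)) = tail G (y i)"
  unfolding edge_shift_mem by (metis diff_add_cancel)

lemma block_code_bij: "bij_betw (block_code N) (edge_shift G) (edge_shift (power_graph N G))"
  unfolding bij_betw_def
proof (intro conjI inj_onI equalityI subsetI)
  fix y y' :: "int \<Rightarrow> nat" assume eq: "block_code N y = block_code N y'"
  show "y = y'"
  proof
    fix i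
    define z j where "z = i div int N" and "j = i mod int N"
    have i: "i = int N * z + j" and j: "0 \<le> j" "j < int N" using N by (auto simp: z_def j_def)
    have "block_code N y z = block_code N y' z" using eq by simp
    then have "agree {int N * z..<int N * (z + 1)} y y'" by (simp add: block_code_eq_iff)
    then show "y i = y' i" by (rule agreeD) (use i j in \<open>simp add: algebra_simps\<close>)
  qed
next
  fix p assume "p \<in> block_code N ` edge_shift G"
  then obtain y where y: "y \<in> edge_shift G" "p = block_code N y" by auto
  then show "p \<in> edge_shift (power_graph N G)"
    using block_code_arc[OF y(1)] edge_shift_head[OF y(1)]
    unfolding y(2) edge_shift_mem[of "block_code N y"] by (simp add: head_block_code tail_block_code)
next
  fix p assume p: "p \<in> edge_shift (power_graph N G)"
  have "p z \<in> (\<lambda>y. block_code N y 0) ` edge_shift G" for z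
    using p by (simp add: edge_shift_mem[of p] power_graph_def)
  then have "\<forall>z. \<exists>y. y \<in> edge_shift G \<and> p z = block_code N y 0" by blast
  then obtain Y where Y: "\<And>z. Y z \<in> edge_shift G" "\<And>z. p z = block_code N (Y z) 0"
    by metis
  define y where "y i = Y (i div int N) (i mod int N)" for i
  have cell: "y (int N * z + j) = Y z j" if "0 \<le> j" "j < int N" for z j
    using that by (simp add: y_def)
  have code: "block_code N y = p"
  proof
    fix z show "block_code N y z = p z"
      unfolding Y(2) block_code_def by (auto simp: cell intro!: arg_cong[where f = to_nat])
  qed
  have "y \<in> edge_shift G"
    unfolding edge_shift_mem
  proof (intro conjI allI)
    fix i
    show "y i \<in> arcs G" using Y(1) by (auto simp: y_def edge_shift_mem)
    define z j where "z = i div int N" and "j = i mod int N"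
    have i: "i = int N * z + j" and j: "0 \<le> j" "j < int N" using N by (auto simp: z_def j_def)
    show "head G (y i) = tail G (y (i + 1))"
    proof (cases "j + 1 < int N")
      case True
      have "i + 1 = int N * z + (j + 1)" using i by simp
      moreover have "y (int N * z + (j + 1)) = Y z (j + 1)" using j True by (intro cell) auto
      ultimately have "y (i + 1) = Y z (j + 1)" by metis
      moreover have "y i = Y z j" using i cell j by simp
      ultimately show ?thesis using Y(1)[of z] by (simp add: edge_shift_mem)
    next
      case False
      then have "i + 1 = int N * (z + 1) + 0" using i j by (simp add: algebra_simps)
      then have "y (i + 1) = Y (z + 1) 0" using cell[of 0 "z + 1"] N by simp
      moreover have "j = int N * (0 + 1) - 1" using j False by simp
      then have "y i = Y z (int N * (0 + 1) - 1)" using i cell[OF j, of z] by (simp only:)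
      moreover have "head (power_graph N G) (p z) = tail (power_graph N G) (p (z + 1))"
        using p by (simp add: edge_shift_mem)
      ultimately show ?thesis by (simp add: Y(2) head_block_code tail_block_code)
    qed
  qed
  then show "p \<in> block_code N ` edge_shift G" using code by blast
qed

lemma power_graph_essential:
  assumes G: "essential_graph G" shows "essential_graph (power_graph N G)"
proof -
  let ?H = "power_graph N G"
  interpret G: fin_digraph G using G by (simp add: essential_graph_def)
  have fa: "finite (arcs ?H)"
  proof (rule finite_subset)
    show "arcs ?H \<subseteq> to_nat ` {xs. set xs \<subseteq> arcs G \<and> length xs = N}"
      by (auto simp: power_graph_def block_code_def edge_shift_mem intro!: imageI)
  qed (simp add: finite_lists_length_eq)
  have fv: "finite (verts ?H)"
    by (rule finite_subset[of _ "tail G ` arcs G"]) (auto simp: power_graph_def edge_shift_mem)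
  have arc: "\<exists>y\<in>edge_shift G. e = block_code N y 0" if "e \<in> arcs ?H" for e
    using that by (auto simp: power_graph_def)
  have vert: "tail G (y i) \<in> verts ?H" if "y \<in> edge_shift G" for y i
  proof -
    have "tail G (y i) = tail G (shift i y 0)" by (simp add: shift_apply)
    then show ?thesis using edge_shift_shift[OF that, of i] by (auto simp: power_graph_def)
  qed
  have fin: "fin_digraph ?H"
  proof
    fix e assume "e \<in> arcs ?H"
    then obtain y where y: "y \<in> edge_shift G" "e = block_code N y 0" using arc by blast
    then show "tail ?H e \<in> verts ?H" "head ?H e \<in> verts ?H"
      using vert[OF y(1)] edge_shift_head[OF y(1)] by (simp_all add: tail_block_code head_block_code)
  qed (use fa fv in auto)
  have "in_degree ?H v > 0 \<and> out_degree ?H v > 0" if v: "v \<in> verts ?H" for v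
  proof -
    obtain y where y: "y \<in> edge_shift G" "v = tail G (y 0)" using v by (auto simp: power_graph_def)
    have "block_code N y 0 \<in> out_arcs ?H v"
      using y block_code_arc[OF y(1)] by (simp add: tail_block_code out_arcs_def)
    moreover have "block_code N y (-1) \<in> in_arcs ?H v"
      using y block_code_arc[OF y(1)] edge_shift_head[OF y(1), of 0]
      by (simp add: head_block_code in_arcs_def)
    moreover have "finite (out_arcs ?H v)" "finite (in_arcs ?H v)"
      using fa by (auto simp: out_arcs_def in_arcs_def)
    ultimately show ?thesis unfolding in_degree_def out_degree_def by (metis card_gt_0_iff empty_iff)
  qed
  then show ?thesis using fin by (simp add: essential_graph_def)
qed

end

lemma block_code_window_continuous: "window_continuous Y (block_code N)"
  unfolding window_continuous_def
proof
  fix z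
  obtain r where r: "{int N * z..<int N * (z + 1)} \<subseteq> {-r..r}"
    using finite_subset_window[OF finite_atLeastLessThan_int] by blast
  then show "\<exists>r. \<forall>x\<in>Y. \<forall>y\<in>Y. agree {-r..r} x y \<longrightarrow> block_code N x z = block_code N y z"
    unfolding block_code_eq_iff using agree_mono by blast
qed

text \<open>A permutation of parallel edges applied at every coordinate maps rays to rays with the
  same end, so it preserves every beam vector.\<close>

lemma one_block_inert_edge:
  assumes bij: "bij_betw f (edge_shift G) (edge_shift G)"
    and one: "\<And>x y i. x \<in> edge_shift G \<Longrightarrow> y \<in> edge_shift G \<Longrightarrow> f x i = f y i \<longleftrightarrow> x i = y i"
    and head: "\<And>x i. x \<in> edge_shift G \<Longrightarrow> head G (f x i) = head G (x i)"
  shows "inert_edge G f"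
  unfolding inert_edge_def
proof (intro allI impI)
  let ?Y = "edge_shift G"
  fix U assume "\<exists>m. beam ?Y m U"
  then obtain m F where F: "finite F" "F \<subseteq> ?Y" "U = (\<Union>x\<in>F. ray ?Y x m)" by (auto simp: beam_def)
  have mem: "f x \<in> ?Y" if "x \<in> ?Y" for x using bij that by (auto simp: bij_betw_def)
  have fray: "f ` ray ?Y x m = ray ?Y (f x) m" if x: "x \<in> ?Y" for x
  proof (intro equalityI subsetI)
    fix u assume "u \<in> f ` ray ?Y x m"
    then show "u \<in> ray ?Y (f x) m" using x mem one by (auto simp: ray_def)
  next
    fix u assume u: "u \<in> ray ?Y (f x) m"
    then obtain y where y: "y \<in> ?Y" "u = f y" using bij by (auto simp: bij_betw_def ray_def)
    have "y \<in> ray ?Y x m" using u y x one by (auto simp: ray_def)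
    then show "u \<in> f ` ray ?Y x m" using y by blast
  qed
  have UY: "U \<subseteq> ?Y" using F by (auto simp: ray_def)
  have inj: "inj_on f ?Y" using bij by (simp add: bij_betw_def)
  have "f ` U = (\<Union>x\<in>F. f ` ray ?Y x m)" unfolding F(3) by (rule image_UN)
  also have "\<dots> = (\<Union>x\<in>F. ray ?Y (f x) m)" using F(2) fray by (intro SUP_cong) auto
  finally have fU: "f ` U = (\<Union>x\<in>f ` F. ray ?Y x m)" by simp
  have beams: "beam ?Y m (f ` U)" "beam ?Y m U"
    unfolding beam_def using F fU mem by (intro exI[of _ "f ` F"] exI[of _ F]; auto)+
  let ?R = "\<lambda>U v. {ray ?Y x m | x. x \<in> ?Y \<and> ray ?Y x m \<subseteq> U \<and> head G (x m) = v}"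
  have "beam_vector G (f ` U) m v = beam_vector G U m v" for v
  proof -
    have "bij_betw ((`) f) (?R U v) (?R (f ` U) v)"
      unfolding bij_betw_def
    proof (intro conjI equalityI subsetI)
      show "inj_on ((`) f) (?R U v)"
        by (rule inj_on_subset[OF inj_on_image_Pow[OF inj]]) (auto simp: ray_def)
    next
      fix S assume "S \<in> (`) f ` ?R U v"
      then obtain x where x: "x \<in> ?Y" "ray ?Y x m \<subseteq> U" "head G (x m) = v" "S = f ` ray ?Y x m"
        by auto
      moreover have "ray ?Y (f x) m \<subseteq> f ` U" using x(1,2) fray by (metis image_mono)
      ultimately show "S \<in> ?R (f ` U) v" using fray mem head by (auto intro!: exI[of _ "f x"])
    next
      fix S assume "S \<in> ?R (f ` U) v"
      then obtain u where u: "u \<in> ?Y" "ray ?Y u m \<subseteq> f ` U" "head G (u m) = v" "S = ray ?Y u m"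
        by auto
      obtain x where x: "x \<in> ?Y" "u = f x" using bij u(1) by (auto simp: bij_betw_def)
      have "ray ?Y x m \<subseteq> U"
      proof
        fix y assume y: "y \<in> ray ?Y x m"
        then have "f y \<in> f ` U" using u(2) x fray by blast
        then obtain w where "w \<in> U" "f y = f w" by blast
        then show "y \<in> U" using inj_onD[OF inj, of y w] UY y by (auto simp: ray_def)
      qed
      then have "ray ?Y x m \<in> ?R U v" using x u(3) head by auto
      moreover have "S = f ` ray ?Y x m" using u(4) x fray by simp
      ultimately show "S \<in> (`) f ` ?R U v" by blast
    qed
    then show ?thesis unfolding beam_vector_def by (simp add: bij_betw_same_card)
  qed
  then show "beam_equiv G (f ` U) U" using beams by (auto simp: beam_equiv_def)
qed

context compact_shift_space
begin

text \<open>Seen through a conjugacy \<open>h\<close>, a gate is still a gate acting within a block \<open>{-B..<B}\<close>. For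
  \<open>B\<close> large it leaves the two extreme cells of the block alone; when the cells are edges, this
  keeps the end vertices of the block.\<close>

lemma gate_block:
  assumes g: "g \<in> gates"
    and h: "window_continuous X h" "\<And>x z. x \<in> X \<Longrightarrow> h (shift z x) = shift z (h x)"
    and k: "window_continuous (h ` X) k" "\<And>x. x \<in> X \<Longrightarrow> k (h x) = x"
  obtains B0 where "\<And>B x i. B \<ge> B0 \<Longrightarrow> x \<in> X \<Longrightarrow> i \<notin> {-B<..<B-1} \<Longrightarrow> h (g x) i = h x i"
    "\<And>B x y. B \<ge> B0 \<Longrightarrow> x \<in> X \<Longrightarrow> y \<in> X \<Longrightarrow> agree {-B..<B} (h x) (h y) \<Longrightarrow>
       agree {-B..<B} (h (g x)) (h (g y))"
proof -
  have a: "g \<in> autos X" by (rule gates_autos[OF g])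
  obtain d where d: "d \<ge> 0" "moved g \<subseteq> {-d..d}" using finite_subset_window g gates_def by blast
  obtain r where r: "r \<ge> 0"
    "\<And>x y i. x \<in> X \<Longrightarrow> y \<in> X \<Longrightarrow> agree {1 * (i div 1) - r..1 * (i div 1) + r} x y \<Longrightarrow> h x i = h y i"
    using equivariant_window[of X h 1 1] shift_mem h by auto
  have far: "h (g x) i = h x i" if x: "x \<in> X" and i: "\<bar>i\<bar> > d + r" for x i
  proof (rule r(2))
    show "agree {1 * (i div 1) - r..1 * (i div 1) + r} (g x) x"
    proof (rule agreeI)
      fix j assume "j \<in> {1 * (i div 1) - r..1 * (i div 1) + r}"
      then have "j \<notin> {-d..d}" using i by auto
      then have "j \<notin> moved g" using d(2) by blast
      then show "g x j = x j" using x by (auto simp: moved_def)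
    qed
  qed (use x a in auto)
  have kX: "k \<in> h ` X \<rightarrow> X" using k(2) by auto
  have "window_continuous (h ` X) ((h \<circ> g) \<circ> k)"
    by (intro window_continuous_comp[OF _ k(1) kX] window_continuous_comp[OF h(1) autos_continuous[OF a]])
      (use a in auto)
  then obtain s where s: "s \<ge> 0" "\<And>x y. x \<in> h ` X \<Longrightarrow> y \<in> h ` X \<Longrightarrow> agree {-s..s} x y \<Longrightarrow>
      agree {-(d+r)..d+r} ((h \<circ> g \<circ> k) x) ((h \<circ> g \<circ> k) y)"
    using window_continuous_finite[OF _ finite_atLeastAtMost_int] by metis
  show ?thesis
  proof (rule that[of "max (d + r) s + 2"])
    fix B x i assume "B \<ge> max (d + r) s + 2" "x \<in> X" "i \<notin> {-B<..<B-1}"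
    then show "h (g x) i = h x i" by (intro far) auto
  next
    fix B x y assume B: "B \<ge> max (d + r) s + 2" and x: "x \<in> X" "y \<in> X"
      and ag: "agree {-B..<B} (h x) (h y)"
    have "agree {-s..s} (h x) (h y)" by (rule agree_mono[OF ag]) (use B in auto)
    then have near: "agree {-(d+r)..d+r} (h (g x)) (h (g y))"
      using s(2)[of "h x" "h y"] x k(2) by simp
    show "agree {-B..<B} (h (g x)) (h (g y))"
    proof (rule agreeI)
      fix i assume i: "i \<in> {-B..<B}"
      show "h (g x) i = h (g y) i"
      proof (cases "\<bar>i\<bar> > d + r")
        case True
        then show ?thesis using far x agreeD[OF ag i] by simp
      next
        case False
        then show ?thesis by (intro agreeD[OF near]) auto
      qed
    qed
  qed
qed

text \<open>When the period is at least the block length, the translates act on disjoint blocks, so on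
  each block the whole lattice acts as the one translate belonging to it.\<close>

lemma sparse_lattice_blocks:
  assumes g: "g \<in> gates" "commuting g S"
    and h: "window_continuous X h" "\<And>x z. x \<in> X \<Longrightarrow> h (shift z x) = shift z (h x)"
    and fix_out: "\<And>x i. x \<in> X \<Longrightarrow> i \<notin> {-B<..<B-1} \<Longrightarrow> h (g x) i = h x i"
    and block: "\<And>x y. x \<in> X \<Longrightarrow> y \<in> X \<Longrightarrow> agree {-B..<B} (h x) (h y) \<Longrightarrow>
       agree {-B..<B} (h (g x)) (h (g y))"
    and sparse: "\<And>s t. s \<in> S \<Longrightarrow> t \<in> S \<Longrightarrow> s \<noteq> t \<Longrightarrow> \<bar>s - t\<bar> \<ge> 2 * B"
    and x: "x \<in> X"
  shows "s \<in> S \<Longrightarrow> agree {s-B..<s+B} (h (lattice_map g S x)) (h (translate g s x))"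
    and "(\<And>s. s \<in> S \<Longrightarrow> i - s \<notin> {-B<..<B-1}) \<Longrightarrow> h (lattice_map g S x) i = h x i"
proof -
  have a: "g \<in> autos X" by (rule gates_autos[OF g(1)])
  have hT: "h (translate g t x) i = h (g (shift t x)) (i - t)" if "x \<in> X" for t x i
    using h(2)[of "g (shift t x)" "-t"] that a by (simp add: translate_def shift_apply)
  have T_out: "h (translate g t x) i = h x i" if "x \<in> X" "i - t \<notin> {-B<..<B-1}" for t x i
    using fix_out[of "shift t x" "i - t"] that hT[OF that(1)] h(2) by (simp add: shift_apply)
  have T_block: "agree {t-B..<t+B} (h (translate g t x)) (h (translate g t y))"
    if "x \<in> X" "y \<in> X" "agree {t-B..<t+B} (h x) (h y)" for t x y
  proof -
    have "agree {-B..<B} (h (shift t x)) (h (shift t y))"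
      using that h(2) by (auto simp: agree_def shift_apply)
    then have ag: "agree {-B..<B} (h (g (shift t x))) (h (g (shift t y)))" using block that by simp
    show ?thesis
      by (rule agreeI) (simp add: hT that, rule agreeD[OF ag], auto)
  qed
  have P_mem: "partial_product g F x \<in> X" for F using partial_product_autos[OF a] x by simp
  have P: "(\<forall>s\<in>S. agree {s-B..<s+B} (h (partial_product g F x)) (h (if s \<in> F then translate g s x else x))) \<and>
      (\<forall>i. (\<forall>s\<in>S. i - s \<notin> {-B<..<B-1}) \<longrightarrow> h (partial_product g F x) i = h x i)"
    if "finite F" "F \<subseteq> S" for F
    using that
  proof (induction F)
    case (insert t F)
    let ?z = "partial_product g F x"
    have t: "t \<in> S" and FS: "F \<subseteq> S" using insert by auto
    note IH = insert.IH[OF FS]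
    have ins: "partial_product g (insert t F) x = translate g t ?z"
      using insert by (subst partial_product_insert[OF g(2)]) auto
    have "agree {s-B..<s+B} (h (translate g t ?z)) (h (if s \<in> insert t F then translate g s x else x))"
      if s: "s \<in> S" for s
    proof (cases "s = t")
      case True
      then have "agree {t-B..<t+B} (h ?z) (h x)" using IH t insert.hyps by auto
      then have "agree {t-B..<t+B} (h (translate g t ?z)) (h (translate g t x))"
        by (rule T_block[OF P_mem x])
      then show ?thesis using True by simp
    next
      case False
      have "agree {s-B..<s+B} (h (translate g t ?z)) (h ?z)"
        by (rule agreeI, rule T_out[OF P_mem]) (use sparse[OF s t False] in auto)
      moreover have "agree {s-B..<s+B} (h ?z) (h (if s \<in> insert t F then translate g s x else x))"
        using IH s False by auto
      ultimately show ?thesis by (rule agree_trans)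
    qed
    then show ?case unfolding ins using IH T_out[OF P_mem] t by auto
  qed simp
  have approx: "\<exists>F. finite F \<and> F0 \<subseteq> F \<and> F \<subseteq> S \<and> agree D (h (lattice_map g S x)) (h (partial_product g F x))"
    if D: "finite D" and F0: "finite F0" "F0 \<subseteq> S" for D F0
  proof -
    obtain r where r: "\<And>x y. x \<in> X \<Longrightarrow> y \<in> X \<Longrightarrow> agree {-r..r} x y \<Longrightarrow> agree D (h x) (h y)"
      using window_continuous_finite[OF h(1) D] by metis
    obtain F1 where F1: "finite F1" "F1 \<subseteq> S" "\<And>F x. finite F \<Longrightarrow> F1 \<subseteq> F \<Longrightarrow> F \<subseteq> S \<Longrightarrow> x \<in> X \<Longrightarrow>
        agree {-r..r} (lattice_map g S x) (partial_product g F x)"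
      using lattice_window[OF g finite_atLeastAtMost_int] by metis
    show ?thesis
      using F0 F1(1,2) by (intro exI[of _ "F0 \<union> F1"] conjI r lattice_mem[OF g x] P_mem F1(3) x) auto
  qed
  show "agree {s-B..<s+B} (h (lattice_map g S x)) (h (translate g s x))" if s: "s \<in> S"
  proof -
    obtain F where F: "finite F" "{s} \<subseteq> F" "F \<subseteq> S"
      "agree {s-B..<s+B} (h (lattice_map g S x)) (h (partial_product g F x))"
      using approx[of "{s-B..<s+B}" "{s}"] s by auto
    have "agree {s-B..<s+B} (h (partial_product g F x)) (h (translate g s x))"
      using P[OF F(1,3)] F(2) s by auto
    with F(4) show ?thesis by (rule agree_trans)
  qed
  show "h (lattice_map g S x) i = h x i" if i: "\<And>s. s \<in> S \<Longrightarrow> i - s \<notin> {-B<..<B-1}"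
  proof -
    obtain F where F: "finite F" "F \<subseteq> S" "agree {i} (h (lattice_map g S x)) (h (partial_product g F x))"
      using approx[of "{i}" "{}"] by auto
    then show ?thesis using P[OF F(1,2)] i by (auto simp: agree_def)
  qed
qed

text \<open>Blocks of length \<open>N\<close> conjugate \<open>(X, \<sigma>\<^sup>N)\<close> to the edge shift of the power graph, and the lattice
  becomes a coordinatewise permutation of edges that keeps their ends. Both the gate and its inverse
  are assumed to act within the block, because injectivity on single edges comes from the inverse.\<close>

lemma sparse_gate_lattice_inert:
  fixes G :: "(nat, nat) pre_digraph"
  assumes G: "essential_graph G" and conj: "conjugacy X (shift 1) (edge_shift G) (shift 1) h"
    and g: "g \<in> gates" and B: "B \<ge> 1" and N: "N \<ge> 1" "int N \<ge> 2 * B"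
    and comm: "commuting g (progression N q)"
    and fix_out: "\<And>f x i. f \<in> {g, inv_map g} \<Longrightarrow> x \<in> X \<Longrightarrow> i \<notin> {-B<..<B-1} \<Longrightarrow> h (f x) i = h x i"
    and block: "\<And>f x y. f \<in> {g, inv_map g} \<Longrightarrow> x \<in> X \<Longrightarrow> y \<in> X \<Longrightarrow> agree {-B..<B} (h x) (h y) \<Longrightarrow>
       agree {-B..<B} (h (f x)) (h (f y))"
  shows "inert X N (restrict (lattice_map g (progression N q)) X)"
proof -
  let ?S = "progression N q" and ?Y = "edge_shift G"
  have hh: "homeomorphic_map (config_topology X) (config_topology ?Y) h"
    and h1: "\<And>x. x \<in> X \<Longrightarrow> h (shift 1 x) = shift 1 (h x)"
    using conj by (auto simp: conjugacy_def)
  obtain k where k: "window_continuous X h" "window_continuous ?Y k" "h \<in> X \<rightarrow> ?Y" "k \<in> ?Y \<rightarrow> X"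
    "\<And>x. x \<in> X \<Longrightarrow> k (h x) = x" "\<And>y. y \<in> ?Y \<Longrightarrow> h (k y) = y"
    using homeomorphic_map_inverse[OF hh] by metis
  have hs: "h (shift z x) = shift z (h x)" if "x \<in> X" for x z
    using equivariant_int[of h 1 1, OF h1 that, of z] by simp
  have sparse: "\<bar>s - t\<bar> \<ge> 2 * B" if st: "s \<in> ?S" "t \<in> ?S" "s \<noteq> t" for s t
  proof -
    obtain y z where yz: "s = int N * y + q" "t = int N * z + q" using st unfolding progression_def by blast
    then have "y \<noteq> z" using st(3) by auto
    then have "int N * 1 \<le> int N * \<bar>y - z\<bar>" by (intro mult_left_mono) auto
    also have "\<dots> = \<bar>s - t\<bar>" by (simp add: yz abs_mult flip: right_diff_distrib)
    finally show ?thesis using N(2) by simp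
  qed
  have g': "inv_map g \<in> gates" "commuting (inv_map g) ?S"
    using gates_inv commuting_inv gates_autos g comm by auto
  define L where "L = lattice_map g ?S"
  define L' where "L' = lattice_map (inv_map g) ?S"
  have LX: "L x \<in> X" if "x \<in> X" for x using that lattice_mem[OF g comm] by (simp add: L_def)
  have L'L: "L' (L x) = x" for x unfolding L_def L'_def by (rule lattice_inverse[OF g comm])
  \<comment> \<open>With this offset the block of a point \<open>s\<close> of the progression starts at \<open>s - B\<close>. As \<open>N\<close> is
    at least \<open>2 * B\<close>, it contains all cells that the translate to \<open>s\<close> reads or changes.\<close>
  define a where "a = q - B"
  define H where "H x = block_code N (shift a (h x))" for x
  have H_eq: "H x z = H y z \<longleftrightarrow> agree {a + int N * z..<a + int N * (z + 1)} (h x) (h y)" for x y z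
  proof -
    have "agree {int N * z..<int N * (z + 1)} (shift a u) (shift a w)
        \<longleftrightarrow> agree {a + int N * z..<a + int N * (z + 1)} u w" for u w :: "int \<Rightarrow> nat"
    proof (intro iffI agreeI)
      fix i assume ag: "agree {int N * z..<int N * (z + 1)} (shift a u) (shift a w)"
        and i: "i \<in> {a + int N * z..<a + int N * (z + 1)}"
      have "shift a u (i - a) = shift a w (i - a)" by (rule agreeD[OF ag]) (use i in auto)
      then show "u i = w i" by (simp add: shift_apply)
    next
      fix i assume ag: "agree {a + int N * z..<a + int N * (z + 1)} u w"
        and i: "i \<in> {int N * z..<int N * (z + 1)}"
      show "shift a u i = shift a w i"
        unfolding shift_apply by (rule agreeD[OF ag]) (use i in auto)
    qed
    then show ?thesis by (simp add: H_def block_code_eq_iff)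
  qed
  have mid: "int N * z + q \<in> ?S" for z by (auto simp: progression_def)
  have key: "(\<forall>x\<in>X. \<forall>z. \<forall>i\<in>{a + int N * z..<a + int N * (z + 1)}.
        i \<notin> {int N * z + q - B<..<int N * z + q + B - 1} \<longrightarrow> h (lattice_map f ?S x) i = h x i) \<and>
      (\<forall>x\<in>X. \<forall>y\<in>X. \<forall>z. H x z = H y z \<longrightarrow> H (lattice_map f ?S x) z = H (lattice_map f ?S y) z)"
    if f: "f \<in> {g, inv_map g}" for f
  proof -
    have fg: "f \<in> gates" "commuting f ?S" using f g g' comm by auto
    have on_block: "agree {s-B..<s+B} (h (lattice_map f ?S x)) (h (translate f s x))"
      if x: "x \<in> X" and s: "s \<in> ?S" for x s
      by (rule sparse_lattice_blocks(1)[OF fg k(1) _ _ _ _ x s])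
        (assumption | rule hs fix_out[OF f] block[OF f] sparse)+
    have off_blocks: "h (lattice_map f ?S x) i = h x i"
      if x: "x \<in> X" and i: "\<And>s. s \<in> ?S \<Longrightarrow> i - s \<notin> {-B<..<B-1}" for x i
      by (rule sparse_lattice_blocks(2)[OF fg k(1) _ _ _ _ x])
        (assumption | rule hs fix_out[OF f] block[OF f] sparse i)+
    have out: "h (lattice_map f ?S x) i = h x i"
      if x: "x \<in> X" and i: "i \<in> {a + int N * z..<a + int N * (z + 1)}"
        and ni: "i \<notin> {int N * z + q - B<..<int N * z + q + B - 1}" for x z i
    proof (rule off_blocks[OF x])
      fix s assume s: "s \<in> ?S"
      show "i - s \<notin> {-B<..<B-1}"
      proof (cases "s = int N * z + q")
        case False
        then obtain y where y: "s = int N * y + q" "y \<noteq> z" using s unfolding progression_def by blast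
        consider "y \<le> z - 1" | "y \<ge> z + 1" using y(2) by linarith
        then show ?thesis
        proof cases
          case 1
          then have "int N * y \<le> int N * (z - 1)" by (intro mult_left_mono) auto
          then show ?thesis using i y(1) N(2) by (auto simp: a_def algebra_simps)
        next
          case 2
          then have "int N * (z + 1) \<le> int N * y" by (intro mult_left_mono) auto
          then show ?thesis using i y(1) N(2) by (auto simp: a_def algebra_simps)
        qed
      qed (use ni in auto)
    qed
    have "H (lattice_map f ?S x) z = H (lattice_map f ?S y) z"
      if x: "x \<in> X" "y \<in> X" and eq: "H x z = H y z" for x y z
      unfolding H_eq
    proof (rule agreeI)
      let ?s = "int N * z + q"
      fix i assume i: "i \<in> {a + int N * z..<a + int N * (z + 1)}"
      have ag: "agree {a + int N * z..<a + int N * (z + 1)} (h x) (h y)" using eq by (simp add: H_eq)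
      show "h (lattice_map f ?S x) i = h (lattice_map f ?S y) i"
      proof (cases "i \<in> {?s - B<..<?s + B - 1}")
        case False
        then show ?thesis using out[OF x(1) i] out[OF x(2) i] agreeD[OF ag i] by simp
      next
        case True
        have "agree {-B..<B} (h (shift ?s x)) (h (shift ?s y))"
        proof (rule agreeI)
          fix j assume "j \<in> {-B..<B}"
          then have "j + ?s \<in> {a + int N * z..<a + int N * (z + 1)}"
            using N(2) by (auto simp: a_def algebra_simps)
          then show "h (shift ?s x) j = h (shift ?s y) j"
            using agreeD[OF ag] x by (simp add: hs shift_apply)
        qed
        then have "agree {-B..<B} (h (f (shift ?s x))) (h (f (shift ?s y)))"
          using block[OF f] x by simp
        then have "h (f (shift ?s x)) (i - ?s) = h (f (shift ?s y)) (i - ?s)"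
          by (rule agreeD) (use True in auto)
        moreover have "h (translate f ?s x) i = h (f (shift ?s x)) (i - ?s)" if "x \<in> X" for x
          using hs[of "f (shift ?s x)" "- ?s"] that gates_autos[OF fg(1)]
          by (simp add: translate_def shift_apply algebra_simps)
        moreover have "h (lattice_map f ?S x) i = h (translate f ?s x) i" if "x \<in> X" for x
          by (rule agreeD[OF on_block[OF that mid]]) (use True in auto)
        ultimately show ?thesis using x by simp
      qed
    qed
    then show ?thesis using out by blast
  qed
  have one: "H (L x) z = H (L y) z \<longleftrightarrow> H x z = H y z" if "x \<in> X" "y \<in> X" for x y z
  proof
    assume "H x z = H y z"
    then show "H (L x) z = H (L y) z"
      using key[of g, THEN conjunct2] that unfolding L_def by blast
  next
    assume "H (L x) z = H (L y) z"
    then have "H (L' (L x)) z = H (L' (L y)) z"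
      using key[of "inv_map g", THEN conjunct2] LX[OF that(1)] LX[OF that(2)] unfolding L'_def by blast
    then show "H x z = H y z" by (simp add: L'L)
  qed
  have head: "head (power_graph N G) (H (L x) z) = head (power_graph N G) (H x z)" if "x \<in> X" for x z
  proof -
    have i: "a + int N * (z + 1) - 1 \<in> {a + int N * z..<a + int N * (z + 1)}"
      "a + int N * (z + 1) - 1 \<notin> {int N * z + q - B<..<int N * z + q + B - 1}"
      using N by (auto simp: a_def algebra_simps)
    have "h (L x) (a + int N * (z + 1) - 1) = h x (a + int N * (z + 1) - 1)"
      using key[of g, THEN conjunct1] that i unfolding L_def by blast
    then show ?thesis by (simp add: H_def head_block_code[OF N(1)] shift_apply algebra_simps)
  qed
  let ?P = "edge_shift (power_graph N G)"
  have bh: "bij_betw h X ?Y" by (rule bij_betw_byWitness[where f' = k]) (use k in auto)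
  have bs: "bij_betw (shift a) ?Y ?Y"
    by (rule bij_betw_byWitness[where f' = "shift (-a)"]) (auto intro: edge_shift_shift)
  have bH: "bij_betw H X ?P"
    using bij_betw_trans[OF bij_betw_trans[OF bh bs] block_code_bij[OF N(1)]] unfolding H_def comp_def .
  have "window_continuous ?Y (shift a)"
    unfolding window_continuous_def
  proof
    fix i
    have "agree {-\<bar>i + a\<bar>..\<bar>i + a\<bar>} x y \<Longrightarrow> shift a x i = shift a y i" for x y :: "int \<Rightarrow> nat"
      unfolding shift_apply by (erule agreeD) auto
    then show "\<exists>r. \<forall>x\<in>?Y. \<forall>y\<in>?Y. agree {-r..r} x y \<longrightarrow> shift a x i = shift a y i" by blast
  qed
  then have "window_continuous ?Y (block_code N \<circ> shift a)"
    by (rule window_continuous_comp[OF block_code_window_continuous[of ?Y]]) (auto intro: edge_shift_shift)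
  from window_continuous_comp[OF this k(1,3)]
  have "window_continuous X H" unfolding H_def comp_def .
  then have "homeomorphic_map (config_topology X) (config_topology ?P) H"
    by (rule window_continuous_bij_homeomorphic[OF _ bH])
  moreover have "H (shift (int N) x) = shift 1 (H x)" if "x \<in> X" for x
  proof
    fix z
    have "H (shift (int N) x) z = block_code N (shift (int N * 1) (shift a (h x))) z"
      using hs[OF that] by (simp add: H_def add.commute)
    also have "\<dots> = shift 1 (H x) z" unfolding block_code_shift by (simp add: H_def shift_apply)
    finally show "H (shift (int N) x) z = shift 1 (H x) z" .
  qed
  ultimately have conjH: "conjugacy X (shift (int N)) ?P (shift 1) H" by (simp add: conjugacy_def)
  let ?f = "H \<circ> restrict L X \<circ> inv_into X H"
  have invH: "inv_into X H p \<in> X" "H (inv_into X H p) = p" if "p \<in> ?P" for p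
    using bH that by (auto simp: bij_betw_def inv_into_into f_inv_into_f)
  have La: "L \<in> autos X" unfolding L_def by (rule lattice_autos[OF g comm])
  have "inert_edge (power_graph N G) ?f"
  proof (rule one_block_inert_edge)
    have "bij_betw (restrict L X) X X"
      using permutes_imp_bij[OF autos_permutes[OF La]] bij_betw_cong[of X "restrict L X" L X] by simp
    then show "bij_betw ?f ?P ?P"
      using bij_betw_trans[OF bij_betw_trans[OF bij_betw_inv_into[OF bH]] bH] by (simp add: comp_assoc)
  next
    fix p p' i assume p: "p \<in> ?P" "p' \<in> ?P"
    show "?f p i = ?f p' i \<longleftrightarrow> p i = p' i"
      using one[OF invH(1)[OF p(1)] invH(1)[OF p(2)], of i] invH p by simp
  next
    fix p i assume p: "p \<in> ?P"
    show "head (power_graph N G) (?f p i) = head (power_graph N G) (p i)"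
      using head[OF invH(1)[OF p], of i] invH[OF p] by simp
  qed
  moreover have "restrict L X \<in> Aut X N"
    using restrict_autos_homeos[OF La] lattice_shift[OF g comm shift_progression]
    by (simp add: Aut_def L_def)
  ultimately show ?thesis
    using power_graph_essential[OF N(1) G] conjH unfolding inert_def L_def by blast
qed

lemma gate_lattice_in_SIAut:
  fixes G :: "(nat, nat) pre_digraph"
  assumes G: "essential_graph G" and conj: "conjugacy X (shift 1) (edge_shift G) (shift 1) h"
    and g: "g \<in> gates" "commuting g (progression n k)" "n \<ge> 1"
  shows "restrict (lattice_map g (progression n k)) X \<in> SIAut X"
proof -
  let ?Y = "edge_shift G"
  have hh: "homeomorphic_map (config_topology X) (config_topology ?Y) h"
    and h1: "\<And>x. x \<in> X \<Longrightarrow> h (shift 1 x) = shift 1 (h x)"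
    using conj by (auto simp: conjugacy_def)
  obtain k' where k: "window_continuous X h" "window_continuous ?Y k'" "h \<in> X \<rightarrow> ?Y" "k' \<in> ?Y \<rightarrow> X"
    "\<And>x. x \<in> X \<Longrightarrow> k' (h x) = x" "\<And>y. y \<in> ?Y \<Longrightarrow> h (k' y) = y"
    using homeomorphic_map_inverse[OF hh] by metis
  have hs: "h (shift z x) = shift z (h x)" if "x \<in> X" for x z
    using equivariant_int[of h 1 1, OF h1 that, of z] by simp
  have kc: "window_continuous (h ` X) k'"
    by (rule window_continuous_subset[OF k(2)]) (use k(3) in auto)
  obtain B1 where B1: "\<And>B x i. B \<ge> B1 \<Longrightarrow> x \<in> X \<Longrightarrow> i \<notin> {-B<..<B-1} \<Longrightarrow> h (g x) i = h x i"
    "\<And>B x y. B \<ge> B1 \<Longrightarrow> x \<in> X \<Longrightarrow> y \<in> X \<Longrightarrow> agree {-B..<B} (h x) (h y) \<Longrightarrow>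
       agree {-B..<B} (h (g x)) (h (g y))"
    using gate_block[OF g(1) k(1) hs kc k(5)] by metis
  obtain B2 where B2: "\<And>B x i. B \<ge> B2 \<Longrightarrow> x \<in> X \<Longrightarrow> i \<notin> {-B<..<B-1} \<Longrightarrow> h (inv_map g x) i = h x i"
    "\<And>B x y. B \<ge> B2 \<Longrightarrow> x \<in> X \<Longrightarrow> y \<in> X \<Longrightarrow> agree {-B..<B} (h x) (h y) \<Longrightarrow>
       agree {-B..<B} (h (inv_map g x)) (h (inv_map g y))"
    using gate_block[OF gates_inv[OF g(1)] k(1) hs kc k(5)] by metis
  define b where "b = nat (max 1 (max B1 B2))"
  have b: "b \<ge> 1" "int b \<ge> B1" "int b \<ge> B2" by (auto simp: b_def)
  let ?r = "2 * b"
  let ?K = "{f \<in> autos X. restrict f X \<in> SIAut X}"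
  have "lattice_map g (progression n k) \<in> ?K"
  proof (rule lattice_progression_split[OF g, of ?r])
    show "id \<in> ?K" using autos_id generate_restrict_id unfolding SIAut_eq by blast
    show "f \<circ> f' \<in> ?K" if "f \<in> ?K" "f' \<in> ?K" for f f'
      using that autos_comp generate_restrict_comp unfolding SIAut_eq by blast
    fix j assume j: "j < ?r"
    let ?S = "progression (?r * n) (k + int (j * n))"
    have sub: "?S \<subseteq> progression n k"
    proof -
      have "progression n k = (\<Union>j<?r. progression (?r * n) (k + int (j * n)))"
        by (rule progression_split) (use b in simp)
      then show ?thesis using j by blast
    qed
    have c: "commuting g ?S" by (rule commuting_subset[OF g(2) sub])
    have "inert X (?r * n) (restrict (lattice_map g ?S) X)"
    proof (rule sparse_gate_lattice_inert[OF G conj g(1) _ _ _ c, where B = "int b"])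
      fix f x i assume "f \<in> {g, inv_map g}" "x \<in> X" "i \<notin> {-int b<..<int b-1}"
      then show "h (f x) i = h x i" using B1(1)[OF b(2)] B2(1)[OF b(3)] by blast
    next
      fix f x y assume "f \<in> {g, inv_map g}" "x \<in> X" "y \<in> X" "agree {-int b..<int b} (h x) (h y)"
      then show "agree {-int b..<int b} (h (f x)) (h (f y))"
        using B1(2)[OF b(2)] B2(2)[OF b(3)] by blast
    next
      show "2 * int b \<le> int (?r * n)" using g(3) by (simp add: mult_le_cancel_left1)
    qed (use b g(3) in auto)
    then have "restrict (lattice_map g ?S) X \<in> SIAut X"
      unfolding SIAut_def using b g(3) by (intro generate.incl) (auto intro!: exI[of _ "?r * n"])
    then show "lattice_map g ?S \<in> ?K" using lattice_autos[OF g(1) c] by simp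
  qed (use b in auto)
  then show ?thesis by simp
qed

end

section \<open>Cutting an inert automorphism\<close>

lemma edge_shift_glue:
  assumes "x \<in> edge_shift G" "y \<in> edge_shift G" "head G (x a) = head G (y a)"
  shows "(\<lambda>i. if i \<le> a then x i else y i) \<in> edge_shift G"
  unfolding edge_shift_mem
proof (intro conjI allI)
  fix i
  consider "i < a" | "i = a" | "i > a" by linarith
  then show "head G (if i \<le> a then x i else y i) = tail G (if i + 1 \<le> a then x (i + 1) else y (i + 1))"
    using assms by cases (auto simp: edge_shift_mem)
qed (use assms in \<open>auto simp: edge_shift_mem\<close>)

lemma ray_eq: "z \<in> ray Y x m \<Longrightarrow> x \<in> Y \<Longrightarrow> ray Y z m = ray Y x m"
  by (auto simp: ray_def)

lemma beam_ray_subset: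
  assumes "beam Y m U" "z \<in> U" shows "ray Y z m \<subseteq> U"
proof -
  obtain F where F: "finite F" "F \<subseteq> Y" "U = (\<Union>x\<in>F. ray Y x m)" using assms(1) by (auto simp: beam_def)
  then obtain x where "x \<in> F" "z \<in> ray Y x m" using assms(2) by blast
  then show ?thesis using ray_eq[of z Y x m] F by blast
qed

lemma finite_beam_rays:
  assumes "beam Y m U" shows "finite {ray Y x m | x. x \<in> Y \<and> ray Y x m \<subseteq> U \<and> P x}"
proof -
  obtain F where F: "finite F" "F \<subseteq> Y" "U = (\<Union>x\<in>F. ray Y x m)" using assms by (auto simp: beam_def)
  have "{ray Y x m | x. x \<in> Y \<and> ray Y x m \<subseteq> U \<and> P x} \<subseteq> (\<lambda>x. ray Y x m) ` F"
  proof clarify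
    fix x assume x: "x \<in> Y" "ray Y x m \<subseteq> U"
    then have "x \<in> U" by (auto simp: ray_def)
    then obtain y where y: "y \<in> F" "x \<in> ray Y y m" using F(3) by blast
    then have "ray Y x m = ray Y y m" using ray_eq F(2) by blast
    then show "ray Y x m \<in> (\<lambda>x. ray Y x m) ` F" using y(1) by blast
  qed
  then show ?thesis using F(1) by (meson finite_imageI finite_subset)
qed

text \<open>Equal beam vectors give a bijection from the \<open>m\<close>-rays of \<open>f ` U\<close> to those of \<open>U\<close> that keeps
  the end of each ray. Replacing the left half of \<open>f y\<close> accordingly and keeping its right half
  turns \<open>f\<close> into a bijection of \<open>U\<close>.\<close>

lemma ray_exchange:
  assumes G: "wf_digraph G" and f: "bij_betw f (edge_shift G) (edge_shift G)"
    and U: "U \<subseteq> edge_shift G" and eq: "beam_equiv G (f ` U) U"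
  obtains m sel where
    "bij_betw (\<lambda>y i. if i \<le> m then sel (head G (f y m)) (ray (edge_shift G) (f y) m) i else f y i) U U"
proof -
  let ?Y = "edge_shift G"
  obtain m where b: "beam ?Y m (f ` U)" "beam ?Y m U"
    and vec: "\<And>v. v \<in> verts G \<Longrightarrow> beam_vector G (f ` U) m v = beam_vector G U m v"
    using eq by (auto simp: beam_equiv_def)
  define R where "R V v = {ray ?Y x m | x. x \<in> ?Y \<and> ray ?Y x m \<subseteq> V \<and> head G (x m) = v}" for V v
  have "\<exists>\<beta>. bij_betw \<beta> (R (f ` U) v) (R U v)" if "v \<in> verts G" for v
  proof (rule finite_same_card_bij)
    show "finite (R (f ` U) v)" "finite (R U v)" unfolding R_def by (rule finite_beam_rays[OF b(1)], rule finite_beam_rays[OF b(2)])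
    show "card (R (f ` U) v) = card (R U v)" using vec[OF that] by (simp add: beam_vector_def R_def)
  qed
  then obtain \<beta> where \<beta>: "\<And>v. v \<in> verts G \<Longrightarrow> bij_betw (\<beta> v) (R (f ` U) v) (R U v)" by metis
  define sel where "sel v S = (SOME z. z \<in> ?Y \<and> head G (z m) = v \<and> ray ?Y z m = \<beta> v S)" for v S
  define c where "c y = (\<lambda>i. if i \<le> m then sel (head G (f y m)) (ray ?Y (f y) m) i else f y i)" for y
  have vert: "head G (y i) \<in> verts G" if "y \<in> ?Y" for y i
    using wf_digraph.head_in_verts[OF G] that edge_shift_mem[of y G] by metis
  have fY: "f y \<in> ?Y" if "y \<in> ?Y" for y using f that by (auto simp: bij_betw_def)
  have sel: "sel v S \<in> ?Y" "head G (sel v S m) = v" "ray ?Y (sel v S) m = \<beta> v S" "\<beta> v S \<subseteq> U"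
    if v: "v \<in> verts G" and S: "S \<in> R (f ` U) v" for v S
  proof -
    have "\<beta> v S \<in> R U v" using \<beta>[OF v] S by (auto simp: bij_betw_def)
    then have ex: "\<exists>z. z \<in> ?Y \<and> head G (z m) = v \<and> ray ?Y z m = \<beta> v S" and "\<beta> v S \<subseteq> U"
      unfolding R_def by auto
    then show "sel v S \<in> ?Y" "head G (sel v S m) = v" "ray ?Y (sel v S) m = \<beta> v S" "\<beta> v S \<subseteq> U"
      using someI_ex[OF ex] unfolding sel_def by auto
  qed
  have S: "ray ?Y (f y) m \<in> R (f ` U) (head G (f y m))" if "y \<in> U" for y
    using that U fY beam_ray_subset[OF b(1), of "f y"] unfolding R_def by blast
  have c_ray: "c y \<in> \<beta> (head G (f y m)) (ray ?Y (f y) m)" and c_head: "head G (c y m) = head G (f y m)"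
    and c_Y: "c y \<in> ?Y" if y: "y \<in> U" for y
  proof -
    have yY: "f y \<in> ?Y" using y U fY by blast
    note s = sel[OF vert[OF yY] S[OF y]]
    show "c y \<in> ?Y" unfolding c_def by (rule edge_shift_glue[OF s(1) yY]) (simp add: s(2))
    then have "c y \<in> ray ?Y (sel (head G (f y m)) (ray ?Y (f y) m)) m"
      by (auto simp: ray_def c_def)
    then show "c y \<in> \<beta> (head G (f y m)) (ray ?Y (f y) m)" using s(3) by simp
    show "head G (c y m) = head G (f y m)" using s(2) by (simp add: c_def)
  qed
  have "bij_betw c U U"
    unfolding bij_betw_def
  proof (intro conjI inj_onI equalityI subsetI)
    fix y y' assume y: "y \<in> U" and y': "y' \<in> U" and e: "c y = c y'"
    let ?S = "ray ?Y (f y) m" and ?S' = "ray ?Y (f y') m"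
    have yY: "f y \<in> ?Y" "f y' \<in> ?Y" using y y' U fY by auto
    have v: "head G (f y m) = head G (f y' m)" using c_head[OF y] c_head[OF y'] e by simp
    let ?v = "head G (f y m)"
    have S': "?S' \<in> R (f ` U) ?v" using S[OF y'] v by simp
    have "\<beta> ?v ?S = ray ?Y (c y) m"
      using ray_eq[of "c y" ?Y "sel ?v ?S" m] c_ray[OF y] sel[OF vert[OF yY(1)] S[OF y]] by simp
    also have "\<dots> = \<beta> ?v ?S'"
      using ray_eq[of "c y'" ?Y "sel ?v ?S'" m] c_ray[OF y'] sel[OF vert[OF yY(1)] S'] e v by simp
    finally have "?S = ?S'"
      using \<beta>[OF vert[OF yY(1)]] S[OF y] S' unfolding bij_betw_def by (meson inj_onD)
    moreover have "f y \<in> ?S" using yY by (auto simp: ray_def)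
    ultimately have le: "f y i = f y' i" if "i \<le> m" for i using that by (auto simp: ray_def)
    have gt: "f y i = f y' i" if "\<not> i \<le> m" for i
      using fun_cong[OF e, of i] that by (simp add: c_def)
    have "f y = f y'" using le gt by blast
    then show "y = y'" using f y y' U by (auto simp: bij_betw_def dest: inj_onD)
  next
    fix t assume "t \<in> c ` U"
    then obtain y where y: "y \<in> U" "t = c y" by blast
    have "f y \<in> ?Y" using y U fY by blast
    from sel(4)[OF vert[OF this] S[OF y(1)]] show "t \<in> U" using c_ray[OF y(1)] y(2) by blast
  next
    fix t assume t: "t \<in> U"
    then have tY: "t \<in> ?Y" using U by blast
    let ?v = "head G (t m)"
    have "ray ?Y t m \<in> R U ?v" using beam_ray_subset[OF b(2) t] tY unfolding R_def by blast
    then have "ray ?Y t m \<in> \<beta> ?v ` R (f ` U) ?v"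
      using \<beta>[OF vert[OF tY, of m]] by (simp add: bij_betw_def)
    then obtain S where "\<beta> ?v S = ray ?Y t m" "S \<in> R (f ` U) ?v" by (metis imageE)
    then obtain s where s: "s \<in> ?Y" "ray ?Y s m \<subseteq> f ` U" "head G (s m) = ?v"
      "\<beta> ?v (ray ?Y s m) = ray ?Y t m" "ray ?Y s m \<in> R (f ` U) ?v"
      unfolding R_def by blast
    define u where "u = (\<lambda>i. if i \<le> m then s i else t i)"
    have "u \<in> ?Y" unfolding u_def by (rule edge_shift_glue[OF s(1) tY s(3)])
    then have us: "u \<in> ray ?Y s m" by (auto simp: ray_def u_def)
    then obtain y where y: "y \<in> U" "u = f y" using s(2) by blast
    have "ray ?Y (f y) m = ray ?Y s m" using ray_eq[OF us s(1)] y(2) by simp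
    moreover have "head G (f y m) = ?v" using s(3) y(2)[symmetric] by (simp add: u_def)
    moreover have "sel ?v (ray ?Y s m) \<in> ray ?Y t m"
      using sel(1,3)[OF vert[OF tY, of m] s(5)] s(4) by (auto simp: ray_def)
    ultimately have "c y i = t i" for i
      using y(2)[symmetric] by (simp add: c_def ray_def u_def)
    then have "c y = t" by (rule ext)
    then show "t \<in> c ` U" using y(1) by blast
  qed
  then show ?thesis using that unfolding c_def by blast
qed

text \<open>A right half-path only knows the past through its initial vertex. So it suffices to exchange
  rays over one representative past for each vertex, and to transplant the result to all pasts;
  this makes the construction uniform and local.\<close>

lemma edge_shift_cut:
  fixes G :: "('v, 'e) pre_digraph"
  assumes G: "fin_digraph G" and f: "bij_betw f (edge_shift G) (edge_shift G)"
    and rad: "radius (edge_shift G) \<rho> f" "\<rho> \<ge> 0" and inert: "inert_edge G f"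
  obtains c M where "bij_betw c (edge_shift G) (edge_shift G)" "window_continuous (edge_shift G) c"
    "\<And>y i. y \<in> edge_shift G \<Longrightarrow> i \<le> 0 \<Longrightarrow> c y i = y i"
    "\<And>y i. y \<in> edge_shift G \<Longrightarrow> i > M \<Longrightarrow> c y i = f y i"
proof -
  let ?Y = "edge_shift G"
  interpret G: fin_digraph G by (rule G)
  define V where "V = (\<lambda>y. head G (y 0)) ` ?Y"
  have "V \<subseteq> head G ` arcs G"
  proof
    fix v assume "v \<in> V"
    then obtain y where "y \<in> ?Y" "v = head G (y 0)" by (auto simp: V_def)
    moreover from this have "y 0 \<in> arcs G" unfolding edge_shift_mem by blast
    ultimately show "v \<in> head G ` arcs G" by blast
  qed
  then have finV: "finite V" using G.finite_arcs by (meson finite_imageI finite_subset)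
  have "\<forall>v\<in>V. \<exists>x. x \<in> ?Y \<and> head G (x 0) = v" by (auto simp: V_def)
  from bchoice[OF this] obtain x where x: "\<And>v. v \<in> V \<Longrightarrow> x v \<in> ?Y" "\<And>v. v \<in> V \<Longrightarrow> head G (x v 0) = v"
    by blast
  define U where "U v = ray ?Y (x v) 0" for v
  have UY: "U v \<subseteq> ?Y" for v by (auto simp: U_def ray_def)
  have "\<forall>v\<in>V. \<exists>ms. bij_betw (\<lambda>y i. if i \<le> fst ms
      then snd ms (head G (f y (fst ms))) (ray ?Y (f y) (fst ms)) i else f y i) (U v) (U v)"
  proof
    fix v assume v: "v \<in> V"
    have "beam ?Y 0 (U v)" unfolding beam_def U_def by (rule exI[of _ "{x v}"]) (use x v in auto)
    then have "beam_equiv G (f ` U v) (U v)" using inert unfolding inert_edge_def by blast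
    then obtain m sel where "bij_betw (\<lambda>y i. if i \<le> m
      then sel (head G (f y m)) (ray ?Y (f y) m) i else f y i) (U v) (U v)"
      by (rule ray_exchange[OF G.wf_digraph f UY])
    then show "\<exists>ms. bij_betw (\<lambda>y i. if i \<le> fst ms
      then snd ms (head G (f y (fst ms))) (ray ?Y (f y) (fst ms)) i else f y i) (U v) (U v)"
      by (intro exI[of _ "(m, sel)"]) (simp only: fst_conv snd_conv)
  qed
  from bchoice[OF this] obtain ms where ms: "\<And>v. v \<in> V \<Longrightarrow> bij_betw (\<lambda>y i. if i \<le> fst (ms v)
      then snd (ms v) (head G (f y (fst (ms v)))) (ray ?Y (f y) (fst (ms v))) i else f y i) (U v) (U v)"
    by blast
  define m where "m v = fst (ms v)" for v
  define C where "C v y = (\<lambda>i. if i \<le> m v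
      then snd (ms v) (head G (f y (m v))) (ray ?Y (f y) (m v)) i else f y i)" for v y
  have C: "bij_betw (C v) (U v) (U v)" if "v \<in> V" for v
    using ms[OF that] unfolding C_def m_def by simp
  obtain M0 where M0: "M0 \<ge> 0" "m ` V \<subseteq> {-M0..M0}" using finite_subset_window[of "m ` V"] finV by auto
  \<comment> \<open>Beyond \<open>M + \<rho>\<close> the exchanged rays and, by the radius of \<open>f\<close>, the transplanted past have no effect.\<close>
  define M where "M = max M0 \<rho>"
  have mM: "m v \<le> M" if "v \<in> V" for v
  proof -
    have "m v \<in> {-M0..M0}" using M0(2) that by blast
    then show ?thesis by (simp add: M_def le_max_iff_disj)
  qed
  define join where "join v y = (\<lambda>i. if i \<le> 0 then x v i else y i)" for v y
  define c where "c y = (\<lambda>i. if i \<le> 0 then y i else C (head G (y 0)) (join (head G (y 0)) y) i)" for y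
  have V: "head G (y 0) \<in> V" if "y \<in> ?Y" for y using that by (auto simp: V_def)
  have joinU: "join v y \<in> U v" if "y \<in> ?Y" "v = head G (y 0)" for v y
  proof -
    have "join v y \<in> ?Y"
      unfolding join_def using x V[OF that(1)] that by (intro edge_shift_glue) auto
    then show ?thesis by (auto simp: U_def ray_def join_def)
  qed
  have U0: "u i = x v i" if "u \<in> U v" "i \<le> 0" for u v i using that by (auto simp: U_def ray_def)
  have CU: "C v u \<in> U v" if "v \<in> V" "u \<in> U v" for u v using C[OF that(1)] that(2) by (auto simp: bij_betw_def)
  have cY: "c y \<in> ?Y" if y: "y \<in> ?Y" for y
  proof -
    let ?v = "head G (y 0)"
    have u: "C ?v (join ?v y) \<in> U ?v" using CU V[OF y] joinU[OF y] by blast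
    show ?thesis unfolding c_def
    proof (rule edge_shift_glue[OF y])
      show "C ?v (join ?v y) \<in> ?Y" using u UY by blast
      show "head G (y 0) = head G (C ?v (join ?v y) 0)" using U0[OF u] x(2)[OF V[OF y]] by simp
    qed
  qed
  have c_le: "c y i = y i" if "i \<le> 0" for y i using that by (simp add: c_def)
  have "bij_betw c ?Y ?Y"
    unfolding bij_betw_def
  proof (intro conjI inj_onI equalityI subsetI)
    fix y y' assume y: "y \<in> ?Y" and y': "y' \<in> ?Y" and e: "c y = c y'"
    have le: "y i = y' i" if "i \<le> 0" for i using fun_cong[OF e, of i] that by (simp add: c_le)
    let ?v = "head G (y 0)"
    have v: "?v = head G (y' 0)" using le[of 0] by simp
    have j: "join ?v y \<in> U ?v" "join ?v y' \<in> U ?v" using joinU[OF y] joinU[OF y'] v by auto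
    have "C ?v (join ?v y) i = C ?v (join ?v y') i" for i
    proof (cases "i \<le> 0")
      case True
      then show ?thesis using U0[OF CU[OF V[OF y] j(1)]] U0[OF CU[OF V[OF y] j(2)]] by simp
    next
      case False
      then show ?thesis using fun_cong[OF e, of i] v by (simp add: c_def)
    qed
    then have "C ?v (join ?v y) = C ?v (join ?v y')" by blast
    then have je: "join ?v y = join ?v y'"
      using C[OF V[OF y]] j unfolding bij_betw_def by (meson inj_onD)
    have "y i = y' i" if "\<not> i \<le> 0" for i using fun_cong[OF je, of i] that by (simp add: join_def)
    then show "y = y'" using le by blast
  next
    fix t assume "t \<in> c ` ?Y" then show "t \<in> ?Y" using cY by blast
  next
    fix t assume t: "t \<in> ?Y"
    let ?v = "head G (t 0)"
    have "join ?v t \<in> C ?v ` U ?v" using C[OF V[OF t]] joinU[OF t] by (simp add: bij_betw_def)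
    then obtain u where u: "u \<in> U ?v" "join ?v t = C ?v u" by blast
    define y where "y = (\<lambda>i. if i \<le> 0 then t i else u i)"
    have "head G (t 0) = head G (u 0)" using U0[OF u(1)] x(2)[OF V[OF t]] by simp
    then have y: "y \<in> ?Y" unfolding y_def using u(1) UY t by (intro edge_shift_glue) auto
    have ju: "join ?v y = u" using U0[OF u(1)] by (auto simp: join_def y_def)
    have "head G (y 0) = ?v" by (simp add: y_def)
    then have cy: "c y i = (if i \<le> 0 then y i else C ?v u i)" for i by (simp add: c_def ju)
    have yt: "y i = t i" if "i \<le> 0" for i using that by (simp add: y_def)
    have "c y i = t i" for i
      using cy[of i] yt[of i] fun_cong[OF u(2), of i] by (simp add: join_def split: if_splits)
    then have "c y = t" by (rule ext)
    then show "t \<in> c ` ?Y" using y by blast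
  qed
  moreover have "window_continuous ?Y c"
    unfolding window_continuous_def
  proof
    fix i
    define K where "K = max M \<bar>i\<bar> + \<rho>"
    have K: "K \<ge> 0" "\<bar>i\<bar> \<le> K" using rad(2) by (auto simp: K_def)
    have "c y i = c y' i" if y: "y \<in> ?Y" "y' \<in> ?Y" and ag: "agree {-K..K} y y'" for y y'
    proof (cases "i \<le> 0")
      case True
      then show ?thesis using agreeD[OF ag, of i] K by (simp add: c_le)
    next
      case False
      let ?v = "head G (y 0)"
      have v: "head G (y' 0) = ?v" using agreeD[OF ag, of 0] K by simp
      have j: "join ?v y \<in> ?Y" "join ?v y' \<in> ?Y"
        using joinU[OF y(1) refl] joinU[OF y(2) v[symmetric]] UY by auto
      have ja: "join ?v y k = join ?v y' k" if "k \<le> K" for k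
        using agreeD[OF ag, of k] that by (auto simp: join_def)
      have fa: "f (join ?v y) k = f (join ?v y') k" if "k \<le> max M \<bar>i\<bar>" for k
        by (rule radiusD[OF rad(1) j], rule agreeI, rule ja) (use that in \<open>auto simp: K_def\<close>)
      have "m ?v \<le> M" using mM V[OF y(1)] by blast
      then have "ray ?Y (f (join ?v y)) (m ?v) = ray ?Y (f (join ?v y')) (m ?v)"
        using fa by (auto simp: ray_def)
      then have "C ?v (join ?v y) i = C ?v (join ?v y') i"
        using fa[of i] fa[of "m ?v"] \<open>m ?v \<le> M\<close> by (simp add: C_def)
      then show ?thesis using False v by (simp add: c_def)
    qed
    then show "\<exists>r. \<forall>x\<in>?Y. \<forall>y\<in>?Y. agree {-r..r} x y \<longrightarrow> c x i = c y i"
      by (intro exI[of _ K] ballI impI)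
  qed
  moreover have "c y i = f y i" if y: "y \<in> ?Y" and i: "i > M + \<rho>" for y i
  proof -
    let ?v = "head G (y 0)"
    have v: "?v \<in> V" using V[OF y] .
    have "f (join ?v y) i = f y i"
    proof (rule radiusD[OF rad(1) _ y])
      show "join ?v y \<in> ?Y" using joinU[OF y] UY by blast
      show "agree {i - \<rho>..i + \<rho>} (join ?v y) y"
        using i M0(1) by (auto simp: agree_def join_def M_def)
    qed
    moreover have "M \<ge> 0" using M0(1) by (simp add: M_def)
    then have "i > 0" "i > m ?v" using i mM[OF v] rad(2) by linarith+
    ultimately show ?thesis by (simp add: c_def C_def)
  qed
  ultimately show ?thesis using c_le that by blast
qed

context compact_shift_space
begin

text \<open>The cut is made in the edge shift and carried back by the conjugacy, under which cell \<open>z\<close> there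
  corresponds to the cells of \<open>X\<close> near \<open>n * z\<close>.\<close>

lemma inert_cut:
  assumes f: "inert X n f" and n: "n \<ge> 1"
  obtains \<phi> c M where "\<phi> \<in> autos X" "f = restrict \<phi> X" "\<And>x. x \<in> X \<Longrightarrow> \<phi> (shift (int n) x) = shift (int n) (\<phi> x)"
    "c \<in> autos X" "M \<ge> 0" "\<And>x i. x \<in> X \<Longrightarrow> i < -M \<Longrightarrow> c x i = x i"
    "\<And>x i. x \<in> X \<Longrightarrow> i > M \<Longrightarrow> c x i = \<phi> x i"
proof -
  obtain G :: "(nat, nat) pre_digraph" and h where fA: "f \<in> Aut X n" and G: "essential_graph G"
    and conj: "conjugacy X (shift (int n)) (edge_shift G) (shift 1) h"
    and inert: "inert_edge G (h \<circ> f \<circ> inv_into X h)"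
    using f by (auto simp: inert_def)
  let ?Y = "edge_shift G" and ?n = "int n"
  obtain \<phi> where \<phi>: "\<phi> \<in> autos X" "f = restrict \<phi> X" using fA homeos_autos by (auto simp: Aut_def)
  have \<phi>n: "\<phi> (shift ?n x) = shift ?n (\<phi> x)" if "x \<in> X" for x
    using fA that \<phi>(2) by (auto simp: Aut_def)
  have hh: "homeomorphic_map (config_topology X) (config_topology ?Y) h"
    and hn: "\<And>x. x \<in> X \<Longrightarrow> h (shift ?n x) = shift 1 (h x)"
    using conj by (auto simp: conjugacy_def)
  obtain k where k: "window_continuous X h" "window_continuous ?Y k" "h \<in> X \<rightarrow> ?Y" "k \<in> ?Y \<rightarrow> X"
    "\<And>x. x \<in> X \<Longrightarrow> k (h x) = x" "\<And>y. y \<in> ?Y \<Longrightarrow> h (k y) = y"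
    using homeomorphic_map_inverse[OF hh] by metis
  have kX: "k y \<in> X" if "y \<in> ?Y" for y using k(4) that by auto
  have hY: "h x \<in> ?Y" if "x \<in> X" for x using k(3) that by auto
  have hz: "h (shift (?n * z) x) = shift (1 * z) (h x)" if "x \<in> X" for x z
    using equivariant_int[of h ?n 1, OF hn that] .
  have kz: "k (shift (1 * z) y) = shift (?n * z) (k y)" if y: "y \<in> ?Y" for y z
  proof -
    have "k (h (shift (?n * z) (k y))) = shift (?n * z) (k y)" using kX[OF y] by (intro k(5)) simp
    then show ?thesis using hz[OF kX[OF y], of z] k(6)[OF y] by simp
  qed
  define F where "F = h \<circ> f \<circ> inv_into X h"
  have bh: "bij_betw h X ?Y" by (rule bij_betw_byWitness[where f' = k]) (use k in auto)
  have F: "F y = h (\<phi> (k y))" if y: "y \<in> ?Y" for y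
  proof -
    have "inv_into X h y = k y"
      using bij_betw_inv_into_left[OF bh kX[OF y]] k(6)[OF y] by simp
    then show ?thesis using kX[OF y] \<phi>(2) by (simp add: F_def)
  qed
  have "bij_betw (restrict \<phi> X) X X"
    using permutes_imp_bij[OF autos_permutes[OF \<phi>(1)]] bij_betw_cong[of X "restrict \<phi> X" \<phi> X] by simp
  then have bF: "bij_betw F ?Y ?Y"
    using bij_betw_trans[OF bij_betw_trans[OF bij_betw_inv_into[OF bh]] bh] \<phi>(2)
    by (simp add: F_def comp_assoc)
  have "window_continuous ?Y ((h \<circ> \<phi>) \<circ> k)"
    using \<phi>(1) by (intro window_continuous_comp[OF _ k(2,4)] window_continuous_comp[OF k(1) autos_continuous]) auto
  then have cF: "window_continuous ?Y F" by (rule window_continuous_cong) (simp add: F)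
  have Fz: "F (shift (1 * z) y) = shift (1 * z) (F y)" if y: "y \<in> ?Y" for y z
  proof -
    have "\<phi> (shift (?n * z) (k y)) = shift (?n * z) (\<phi> (k y))"
      by (rule equivariant_int[of \<phi> ?n ?n, OF \<phi>n kX[OF y]])
    then show ?thesis
      using F[OF y] F[OF edge_shift_shift[OF y]] kz[OF y, of z] hz[of "\<phi> (k y)" z] kX[OF y] \<phi>(1) by simp
  qed
  obtain \<rho> where \<rho>: "\<rho> \<ge> 0" "\<And>x y i. x \<in> ?Y \<Longrightarrow> y \<in> ?Y \<Longrightarrow>
      agree {1 * (i div 1) - \<rho>..1 * (i div 1) + \<rho>} x y \<Longrightarrow> F x i = F y i"
    using equivariant_window[of ?Y F 1 1, OF edge_shift_shift cF Fz order_refl] by blast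
  have rF: "radius ?Y \<rho> F"
    unfolding radius_def
  proof (intro ballI allI impI)
    fix x y i assume "x \<in> ?Y" "y \<in> ?Y" "agree {i - \<rho>..i + \<rho>} x y"
    then show "F x i = F y i" by (intro \<rho>(2)) simp_all
  qed
  have fin: "fin_digraph G" using G by (simp add: essential_graph_def)
  obtain cY M where cY: "bij_betw cY ?Y ?Y" "window_continuous ?Y cY"
    "\<And>y i. y \<in> ?Y \<Longrightarrow> i \<le> 0 \<Longrightarrow> cY y i = y i" "\<And>y i. y \<in> ?Y \<Longrightarrow> i > M \<Longrightarrow> cY y i = F y i"
    using edge_shift_cut[OF fin bF rF \<rho>(1) inert[folded F_def]] by blast
  have cYY: "cY y \<in> ?Y" if "y \<in> ?Y" for y using cY(1) that by (auto simp: bij_betw_def)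
  define c where "c x = (if x \<in> X then k (cY (h x)) else x)" for x
  have "c permutes X"
  proof (rule bij_imp_permutes)
    have "bij_betw k ?Y X" by (rule bij_betw_byWitness[where f' = h]) (use k in auto)
    with bij_betw_trans[OF bh cY(1)] have "bij_betw (k \<circ> (cY \<circ> h)) X X" by (rule bij_betw_trans)
    then show "bij_betw c X X" using bij_betw_cong[of X c "k \<circ> (cY \<circ> h)" X] by (simp add: c_def)
  qed (simp add: c_def)
  moreover have "window_continuous X ((k \<circ> cY) \<circ> h)"
    using cYY by (intro window_continuous_comp[OF _ k(1,3)] window_continuous_comp[OF k(2) cY(2)]) auto
  then have "window_continuous X c" by (rule window_continuous_cong) (simp add: c_def)
  ultimately have ca: "c \<in> autos X" by (simp add: autos_def)
  have n1: "?n \<ge> 1" using n by simp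
  obtain r where r: "r \<ge> 0" "\<And>x y i. x \<in> ?Y \<Longrightarrow> y \<in> ?Y \<Longrightarrow>
      agree {1 * (i div ?n) - r..1 * (i div ?n) + r} x y \<Longrightarrow> k x i = k y i"
    using equivariant_window[of ?Y k 1 ?n, OF edge_shift_shift k(2) kz n1] by blast
  define M' where "M' = ?n * (r + \<bar>M\<bar> + 2)"
  show ?thesis
  proof (rule that[OF \<phi> \<phi>n ca])
    show "M' \<ge> 0" using r(1) by (simp add: M'_def)
    have div_le: "i div ?n \<le> -(r + \<bar>M\<bar> + 2)" if "i < - M'" for i
    proof -
      have "i div ?n \<le> (?n * (-(r + \<bar>M\<bar> + 2))) div ?n"
        using that n by (intro zdiv_mono1) (auto simp: M'_def algebra_simps)
      then show ?thesis using n by simp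
    qed
    have div_ge: "i div ?n \<ge> r + \<bar>M\<bar> + 2" if "i > M'" for i
    proof -
      have "(?n * (r + \<bar>M\<bar> + 2)) div ?n \<le> i div ?n"
        using that n by (intro zdiv_mono1) (auto simp: M'_def algebra_simps)
      then show ?thesis using n by simp
    qed
    show "c x i = x i" if x: "x \<in> X" and i: "i < -M'" for x i
    proof -
      have "k (cY (h x)) i = k (h x) i"
      proof (rule r(2)[OF cYY[OF hY[OF x]] hY[OF x]], rule agreeI)
        fix j assume "j \<in> {1 * (i div ?n) - r..1 * (i div ?n) + r}"
        then show "cY (h x) j = h x j" using div_le[OF i] by (intro cY(3)[OF hY[OF x]]) auto
      qed
      then show ?thesis using x k(5) by (simp add: c_def)
    qed
    show "c x i = \<phi> x i" if x: "x \<in> X" and i: "i > M'" for x i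
    proof -
      have \<phi>x: "\<phi> x \<in> X" using x \<phi>(1) by simp
      have "k (cY (h x)) i = k (h (\<phi> x)) i"
      proof (rule r(2)[OF cYY[OF hY[OF x]] hY[OF \<phi>x]], rule agreeI)
        fix j assume "j \<in> {1 * (i div ?n) - r..1 * (i div ?n) + r}"
        then have "cY (h x) j = F (h x) j" using div_ge[OF i] by (intro cY(4)[OF hY[OF x]]) auto
        then show "cY (h x) j = h (\<phi> x) j" using F[OF hY[OF x]] k(5)[OF x] by simp
      qed
      then show ?thesis using x \<phi>x k(5) by (simp add: c_def)
    qed
  qed
qed

end

section \<open>A cut automorphism is a product of two gate lattices\<close>

context compact_shift_space
begin

lemma periodic_radius:
  assumes f: "f \<in> autos X" and n: "n \<ge> 1" and com: "\<And>x. x \<in> X \<Longrightarrow> f (shift (int n) x) = shift (int n) (f x)"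
  obtains r where "r \<ge> 0" "radius X r f"
proof -
  let ?n = "int n"
  have n1: "?n \<ge> 1" using n by simp
  have c: "f (shift (?n * z) x) = shift (?n * z) (f x)" if "x \<in> X" for x z
    by (rule equivariant_int[of f ?n ?n, OF com that])
  obtain r where r: "r \<ge> 0" "\<And>x y i. x \<in> X \<Longrightarrow> y \<in> X \<Longrightarrow>
      agree {?n * (i div ?n) - r..?n * (i div ?n) + r} x y \<Longrightarrow> f x i = f y i"
    using equivariant_window[of X f ?n ?n, OF shift_mem autos_continuous[OF f] c n1] by blast
  have "radius X (r + ?n) f"
    unfolding radius_def
  proof (intro ballI allI impI)
    fix x y i assume x: "x \<in> X" "y \<in> X" and ag: "agree {i - (r + ?n)..i + (r + ?n)} x y"
    have "i = ?n * (i div ?n) + i mod ?n" "0 \<le> i mod ?n" "i mod ?n < ?n" using n1 by auto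
    then have sub: "i - ?n \<le> ?n * (i div ?n)" "?n * (i div ?n) \<le> i" by linarith+
    have "agree {?n * (i div ?n) - r..?n * (i div ?n) + r} x y"
      by (rule agree_mono[OF ag]) (use sub n1 in auto)
    then show "f x i = f y i" by (rule r(2)[OF x])
  qed
  then show ?thesis using that[of "r + ?n"] r(1) by simp
qed

text \<open>Outside a bounded interval \<open>c\<close> is the identity or \<open>f\<close>; inside there are finitely many cells.\<close>

lemma cut_radius:
  assumes c: "c \<in> autos X" and l: "\<And>x i. x \<in> X \<Longrightarrow> i < -M \<Longrightarrow> c x i = x i"
    and rt: "\<And>x i. x \<in> X \<Longrightarrow> i > M \<Longrightarrow> c x i = f x i" and f: "radius X r f" "r \<ge> 0" and M: "M \<ge> 0"
  obtains s where "s \<ge> 0" "radius X s c"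
proof -
  obtain w where w: "w \<ge> 0" "\<And>x y. x \<in> X \<Longrightarrow> y \<in> X \<Longrightarrow> agree {-w..w} x y \<Longrightarrow> agree {-M..M} (c x) (c y)"
    using window_continuous_finite[OF autos_continuous[OF c] finite_atLeastAtMost_int] by metis
  have "radius X (w + M + r) c"
    unfolding radius_def
  proof (intro ballI allI impI)
    fix x y i assume x: "x \<in> X" "y \<in> X" and ag: "agree {i - (w + M + r)..i + (w + M + r)} x y"
    consider "i < -M" | "i > M" | "i \<in> {-M..M}" by fastforce
    then show "c x i = c y i"
    proof cases
      case 1
      then show ?thesis using l x agreeD[OF ag, of i] w(1) M f(2) by simp
    next
      case 2
      have "agree {i - r..i + r} x y" by (rule agree_mono[OF ag]) (use w(1) M in auto)
      then have "f x i = f y i" by (rule radiusD[OF f(1) x])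
      then show ?thesis using rt x 2 by simp
    next
      case 3
      have "agree {-w..w} x y" by (rule agree_mono[OF ag]) (use 3 f(2) in auto)
      then show ?thesis using w(2)[OF x] 3 by (auto dest: agreeD)
    qed
  qed
  then show ?thesis using that[of "w + M + r"] w(1) M f(2) by simp
qed

lemma partial_product_commutes:
  assumes "\<And>s. s \<in> F \<Longrightarrow> h \<circ> translate g s = translate g s \<circ> h" "finite F"
  shows "h \<circ> partial_product g F = partial_product g F \<circ> h"
proof -
  have "h (foldr (translate g) xs x) = foldr (translate g) xs (h x)" if "set xs \<subseteq> F" for xs x
    using that
  proof (induction xs)
    case (Cons s xs)
    then show ?case using fun_cong[OF assms(1)[of s]] by simp
  qed simp
  then show ?thesis using assms(2) by (simp add: partial_product_def fun_eq_iff)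
qed

lemma commuting_separated:
  assumes g: "g \<in> autos X" "supported_on X {a..b} g" "radius X r g" "r \<ge> 0"
    and sep: "\<And>s t. s \<in> S \<Longrightarrow> t \<in> S \<Longrightarrow> s \<noteq> t \<Longrightarrow> \<bar>s - t\<bar> > b - a + r"
  shows "commuting g S"
  unfolding commuting_def
proof (intro ballI)
  fix s t assume st: "s \<in> S" "t \<in> S"
  show "translate g s \<circ> translate g t = translate g t \<circ> translate g s"
  proof (cases "s = t")
    case False
    then have "\<bar>s - t\<bar> > b - a + r" using sep st by blast
    then show ?thesis
      using g by (intro separated_commute[OF _ supported_on_translate radius_translate
            _ supported_on_translate radius_translate] autos_permutes autos_translate) auto
  qed simp
qed

text \<open>In the proof, \<open>a j\<close> is \<open>c\<close> moved to \<open>j * p\<close>: the identity to the left of that point and \<open>f\<close> to the right.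
  So \<open>\<gamma>\<close> turns \<open>f\<close> on and off again between \<open>0\<close> and \<open>p\<close>. Formally \<open>f\<close> is the ordered product of
  all \<open>a j \<circ> inv (a (j + 1))\<close>, in which only neighbours fail to commute. Moving the factors with
  even \<open>j\<close> to the left conjugates those with odd \<open>j\<close> by one neighbour, which gives \<open>\<delta>\<close>.\<close>

lemma cut_decomposition:
  assumes f: "f \<in> autos X" and n: "n \<ge> 1" and com: "\<And>x. x \<in> X \<Longrightarrow> f (shift (int n) x) = shift (int n) (f x)"
    and c: "c \<in> autos X" and M: "M \<ge> 0" and l: "\<And>x i. x \<in> X \<Longrightarrow> i < -M \<Longrightarrow> c x i = x i"
    and rt: "\<And>x i. x \<in> X \<Longrightarrow> i > M \<Longrightarrow> c x i = f x i"
  obtains \<gamma> \<delta> N where "\<gamma> \<in> gates" "\<delta> \<in> gates" "N \<ge> 1" "commuting \<gamma> (progression N 0)"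
    "commuting \<delta> (progression N 0)" "f = lattice_map \<gamma> (progression N 0) \<circ> lattice_map \<delta> (progression N 0)"
proof -
  let ?n = "int n"
  have fi: "inv_map f \<in> autos X" and ci: "inv_map c \<in> autos X" using autos_inv f c by auto
  note comi = inv_commutes_shift[OF f com]
  obtain r1 where r1: "r1 \<ge> 0" "radius X r1 f" using periodic_radius[OF f n com] by blast
  obtain r2 where r2: "r2 \<ge> 0" "radius X r2 (inv_map f)" using periodic_radius[OF fi n comi] by blast
  obtain r3 where r3: "r3 \<ge> 0" "radius X r3 c" using cut_radius[OF c l rt r1(2,1) M] by blast
  obtain r4 where r4: "r4 \<ge> 0" "radius X r4 (inv_map c)"
  proof (rule cut_radius[OF ci _ _ r2(2,1), of "M + r2"])
    fix x i assume x: "x \<in> X"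
    let ?z = "inv_map c x"
    have z: "?z \<in> X" "c ?z = x" using x c ci by auto
    show "?z i = x i" if "i < - (M + r2)" using l[OF z(1), of i] that r2(1) z(2) by simp
    show "?z i = inv_map f x i" if "i > M + r2"
    proof -
      have "agree {i - r2..i + r2} x (f ?z)"
        using rt[OF z(1)] z(2) that by (auto simp: agree_def)
      then have "inv_map f x i = inv_map f (f ?z) i" using x z f by (intro radiusD[OF r2(2)]) auto
      then show ?thesis using f by simp
    qed
  qed (use M r2 in auto)
  define \<rho> where "\<rho> = max (max r1 r2) (max r3 r4)"
  have \<rho>: "\<rho> \<ge> 0" "radius X \<rho> f" "radius X \<rho> (inv_map f)" "radius X \<rho> c" "radius X \<rho> (inv_map c)"
    using r1 r2 r3 r4 by (auto simp: \<rho>_def intro: radius_mono)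
  \<comment> \<open>\<open>\<gamma>\<close> and \<open>\<delta>\<close> will have radius at most \<open>4 * \<rho>\<close> and supports of length at most
    \<open>p + 2 * M + 2 * \<rho>\<close>, and their translates are \<open>2 * p\<close> apart. They commute if
    \<open>2 * p > (p + 2 * M + 2 * \<rho>) + 4 * \<rho>\<close>.\<close>
  define q where "q = nat (2 * M + 6 * \<rho> + 1)"
  define p where "p = ?n * int q"
  have "1 * int q \<le> ?n * int q" using n by (intro mult_right_mono) auto
  then have "int q \<le> p" by (simp add: p_def)
  moreover have "int q = 2 * M + 6 * \<rho> + 1" using M \<rho>(1) by (simp add: q_def)
  ultimately have p: "p > 2 * M + 6 * \<rho>" by linarith
  have p0: "p \<ge> 1" using p M \<rho>(1) by linarith
  have fp: "f (shift (p * j) x) = shift (p * j) (f x)" if "x \<in> X" for x j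
    using equivariant_int[of f ?n ?n "x" "int q * j", OF com that] by (simp add: p_def mult.assoc)
  define a where "a j = translate c (j * p)" for j
  have a: "a j \<in> autos X" for j unfolding a_def by (rule autos_translate[OF c])
  have ai: "inv_map (a j) \<in> autos X" for j by (rule autos_inv[OF a])
  have ai_eq: "inv_map (a j) = translate (inv_map c) (j * p)" for j
    unfolding a_def by (rule translate_inv[OF c, symmetric])
  have "radius X \<rho> (a j)" for j
    unfolding a_def by (rule radius_translate[OF \<rho>(4)])
  moreover have "radius X \<rho> (inv_map (a j))" for j
    unfolding ai_eq by (rule radius_translate[OF \<rho>(5)])
  ultimately have a_rad: "radius X \<rho> (a j)" "radius X \<rho> (inv_map (a j))" for j .
  have a_left: "a j x i = x i" if "x \<in> X" "i < j * p - M" for j x i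
    using l[of "shift (j * p) x" "i - j * p"] that by (simp add: a_def translate_apply shift_apply)
  have a_right: "a j x i = f x i" if "x \<in> X" "i > j * p + M" for j x i
    using rt[of "shift (j * p) x" "i - j * p"] fp[OF that(1), of j] that
    by (simp add: a_def translate_apply shift_apply mult.commute)
  have ai_left: "inv_map (a j) x i = x i" if "x \<in> X" "i < j * p - M" for j x i
    using a_left[of "inv_map (a j) x" i j] that a ai by simp
  have ai_right: "f (inv_map (a j) x) i = x i" if "x \<in> X" "i > j * p + M" for j x i
    using a_right[of "inv_map (a j) x" j i] that a ai by simp
  define \<gamma> where "\<gamma> = a 0 \<circ> inv_map (a 1)"
  define \<delta> where "\<delta> = a 3 \<circ> inv_map (a 2) \<circ> a 1 \<circ> inv_map (a 3)"
  have \<gamma>a: "\<gamma> \<in> autos X" and \<delta>a: "\<delta> \<in> autos X"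
    unfolding \<gamma>_def \<delta>_def by (intro autos_comp a ai)+
  have tr_a: "translate (a j) (k * p) = a (j + k)" for j k
    by (simp add: a_def algebra_simps)
  have tr_ai: "translate (inv_map (a j)) (k * p) = inv_map (a (j + k))" for j k
    unfolding translate_inv[OF a] tr_a ..
  have tr_\<gamma>: "translate \<gamma> (2 * p * k) = a (2 * k) \<circ> inv_map (a (2 * k + 1))" for k
    using tr_a[of 0 "2 * k"] tr_ai[of 1 "2 * k"]
    by (simp add: \<gamma>_def translate_comp mult.commute mult.left_commute add.commute)
  have tr_\<delta>: "translate \<delta> (2 * p * k)
      = a (2 * k + 3) \<circ> inv_map (a (2 * k + 2)) \<circ> a (2 * k + 1) \<circ> inv_map (a (2 * k + 3))" for k
    using tr_a[of 3 "2 * k"] tr_ai[of 2 "2 * k"] tr_a[of 1 "2 * k"] tr_ai[of 3 "2 * k"]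
    by (simp add: \<delta>_def translate_comp mult.commute mult.left_commute add.commute)
  have \<gamma>_sup: "supported_on X {-M..p + M} \<gamma>"
    unfolding supported_on_def
  proof (intro ballI allI impI)
    fix x i assume x: "x \<in> X" and i: "i \<notin> {-M..p + M}"
    let ?z = "inv_map (a 1) x"
    have z: "?z \<in> X" using x ai by simp
    consider "i < -M" | "i > p + M" using i by fastforce
    then show "\<gamma> x i = x i"
    proof cases
      case 1
      then show ?thesis using a_left[OF z, of i 0] ai_left[OF x, of i 1] p0 by (simp add: \<gamma>_def)
    next
      case 2
      then show ?thesis using a_right[OF z, of 0 i] ai_right[OF x, of 1 i] p0 by (simp add: \<gamma>_def)
    qed
  qed
  have \<delta>_sup: "supported_on X {p - M..2 * p + M + 2 * \<rho>} \<delta>"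
    unfolding supported_on_def
  proof (intro ballI allI impI)
    fix x i assume x: "x \<in> X" and i: "i \<notin> {p - M..2 * p + M + 2 * \<rho>}"
    define u where "u = inv_map (a 3) x"
    define w where "w = inv_map (a 2) (a 1 u)"
    have u: "u \<in> X" and v: "a 1 u \<in> X" and w: "w \<in> X" using x a ai by (auto simp: u_def w_def)
    have \<delta>x: "\<delta> x = a 3 w" by (simp add: \<delta>_def u_def w_def)
    consider "i < p - M" | "i > 2 * p + M + 2 * \<rho>" using i by fastforce
    then show "\<delta> x i = x i"
    proof cases
      case 1
      then show ?thesis
        using a_left[OF w, of i 3] ai_left[OF v, of i 2] a_left[OF u, of i 1] ai_left[OF x, of i 3] p0
        by (simp add: \<delta>x u_def w_def)
    next
      case 2
      \<comment> \<open>To the right of \<open>2 * p + M\<close> both \<open>a 1\<close> and \<open>a 2\<close> are \<open>f\<close>, so they cancel in \<open>w\<close>. Undoing \<open>f\<close> and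
        then applying \<open>a 3\<close> costs \<open>\<rho>\<close> each.\<close>
      have fw: "f w j = f u j" if "j > 2 * p + M" for j
        using ai_right[OF v, of 2 j] a_right[OF u, of 1 j] that p0 by (simp add: w_def)
      have wu: "w j = u j" if "j > 2 * p + M + \<rho>" for j
      proof -
        have "agree {j - \<rho>..j + \<rho>} (f w) (f u)" using fw that by (auto simp: agree_def)
        then have "inv_map f (f w) j = inv_map f (f u) j"
          using f u w by (intro radiusD[OF \<rho>(3)]) auto
        then show ?thesis using f by simp
      qed
      have "agree {i - \<rho>..i + \<rho>} w u" using wu 2 by (auto simp: agree_def)
      then have "a 3 w i = a 3 u i" by (rule radiusD[OF a_rad(1) w u])
      then show ?thesis using a by (simp add: \<delta>x u_def)
    qed
  qed
  have \<gamma>_rad: "radius X (4 * \<rho>) \<gamma>" and \<delta>_rad: "radius X (4 * \<rho>) \<delta>"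
  proof -
    have "radius X (\<rho> + \<rho>) \<gamma>" unfolding \<gamma>_def by (intro radius_comp a_rad autos_permutes ai)
    then show "radius X (4 * \<rho>) \<gamma>" using \<rho>(1) by (elim radius_mono) simp
    have "radius X (\<rho> + \<rho> + \<rho> + \<rho>) \<delta>" unfolding \<delta>_def by (intro radius_comp a_rad autos_permutes ai a)
    then show "radius X (4 * \<rho>) \<delta>" by (elim radius_mono) simp
  qed
  have \<gamma>g: "\<gamma> \<in> gates" and \<delta>g: "\<delta> \<in> gates"
    by (rule gatesI[OF \<gamma>a _ \<gamma>_sup], simp, rule gatesI[OF \<delta>a _ \<delta>_sup], simp)
  define N where "N = nat (2 * p)"
  have N: "N \<ge> 1" "int N = 2 * p" using p0 by (auto simp: N_def)
  let ?S = "progression N 0"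
  have S: "s \<in> ?S \<longleftrightarrow> (\<exists>k. s = 2 * p * k)" for s by (auto simp: progression_def N(2))
  have sep: "\<bar>s - t\<bar> \<ge> 2 * p" if st: "s \<in> ?S" "t \<in> ?S" "s \<noteq> t" for s t
  proof -
    obtain y z where yz: "s = 2 * p * y" "t = 2 * p * z" using st S by metis
    then have "y \<noteq> z" using st(3) by auto
    then have "2 * p * 1 \<le> 2 * p * \<bar>y - z\<bar>" using p0 by (intro mult_left_mono) auto
    also have "\<dots> = \<bar>s - t\<bar>" using p0 by (simp add: yz abs_mult flip: right_diff_distrib)
    finally show ?thesis by simp
  qed
  have \<gamma>c: "commuting \<gamma> ?S"
  proof (rule commuting_separated[OF \<gamma>a \<gamma>_sup \<gamma>_rad])
    fix s t assume "s \<in> ?S" "t \<in> ?S" "s \<noteq> t"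
    then show "p + M - - M + 4 * \<rho> < \<bar>s - t\<bar>" using sep[of s t] p \<rho>(1) by linarith
  qed (use \<rho>(1) in simp)
  have \<delta>c: "commuting \<delta> ?S"
  proof (rule commuting_separated[OF \<delta>a \<delta>_sup \<delta>_rad])
    fix s t assume "s \<in> ?S" "t \<in> ?S" "s \<noteq> t"
    then show "2 * p + M + 2 * \<rho> - (p - M) + 4 * \<rho> < \<bar>s - t\<bar>" using sep[of s t] p \<rho>(1) by linarith
  qed (use \<rho>(1) in simp)
  have cross: "translate \<gamma> (2 * p * (B + 1)) \<circ> translate \<delta> (2 * p * k)
      = translate \<delta> (2 * p * k) \<circ> translate \<gamma> (2 * p * (B + 1))" if "k < B" for k B
  proof (rule separated_commute[OF _ supported_on_translate[OF \<gamma>_sup] radius_translate[OF \<gamma>_rad]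
          _ supported_on_translate[OF \<delta>_sup] radius_translate[OF \<delta>_rad]])
    have "2 * p * (k + 1) \<le> 2 * p * B" using that p0 by (intro mult_left_mono) auto
    then have kB: "2 * p * k + 4 * p \<le> 2 * p * (B + 1)" by (simp add: algebra_simps)
    fix i j assume "i \<in> {i. i - 2 * p * (B + 1) \<in> {- M..p + M}}"
      "j \<in> {i. i - 2 * p * k \<in> {p - M..2 * p + M + 2 * \<rho>}}"
    then show "4 * \<rho> < \<bar>i - j\<bar>" using kB p \<rho>(1) M by simp
  qed (use \<rho>(1) \<gamma>a \<delta>a autos_permutes autos_translate in auto)
  define E where "E A b = (\<lambda>k. 2 * p * k) ` {A..A + int b}" for A and b :: nat
  define D where "D A b = (\<lambda>k. 2 * p * k) ` {A..<A + int b}" for A and b :: nat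
  have ED: "finite (E A b)" "finite (D A b)" "E A b \<subseteq> ?S" "D A b \<subseteq> ?S" for A b
    using S by (auto simp: E_def D_def)
  have inj: "2 * p * k = 2 * p * k' \<longleftrightarrow> k = k'" for k k' using p0 by simp
  \<comment> \<open>Truncated to a finite range the two lattices compose to a map that switches \<open>f\<close> on at the left
    end and off at the right end of the range.\<close>
  have telescope: "partial_product \<gamma> (E A b) \<circ> partial_product \<delta> (D A b)
      = a (2 * A) \<circ> inv_map (a (2 * (A + int b) + 1))" for A b
  proof (induction b)
    case 0
    have "partial_product \<gamma> (insert (2 * p * A) {}) = translate \<gamma> (2 * p * A) \<circ> partial_product \<gamma> {}"
      using S by (intro partial_product_insert[OF \<gamma>c]) auto
    then show ?case by (simp add: E_def D_def tr_\<gamma>)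
  next
    case (Suc b)
    define B where "B = A + int b"
    let ?g = "translate \<gamma> (2 * p * (B + 1))" and ?d = "translate \<delta> (2 * p * B)"
    have "E A (Suc b) = insert (2 * p * (B + 1)) (E A b)"
    proof -
      have "{A..A + int (Suc b)} = insert (B + 1) {A..A + int b}" by (auto simp: B_def)
      then show ?thesis by (simp add: E_def)
    qed
    moreover have "2 * p * (B + 1) \<notin> E A b" using inj by (auto simp: E_def B_def)
    ultimately have E: "partial_product \<gamma> (E A (Suc b)) = partial_product \<gamma> (E A b) \<circ> ?g"
      using ED(1,3) S by (metis insert_subset partial_product_insert_right[OF \<gamma>c])
    have "D A (Suc b) = insert (2 * p * B) (D A b)"
    proof -
      have "{A..<A + int (Suc b)} = insert B {A..<A + int b}" by (auto simp: B_def)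
      then show ?thesis by (simp add: D_def)
    qed
    moreover have "2 * p * B \<notin> D A b" using inj by (auto simp: D_def B_def)
    ultimately have D: "partial_product \<delta> (D A (Suc b)) = partial_product \<delta> (D A b) \<circ> ?d"
      using ED(2,4) S by (metis insert_subset partial_product_insert_right[OF \<delta>c])
    have swap: "?g \<circ> partial_product \<delta> (D A b) = partial_product \<delta> (D A b) \<circ> ?g"
    proof (rule partial_product_commutes[OF _ ED(2)])
      fix s assume "s \<in> D A b"
      then obtain k where "s = 2 * p * k" "k \<in> {A..<A + int b}" unfolding D_def by (rule imageE)
      then have "s = 2 * p * k" "k < B" by (simp_all add: B_def)
      then show "?g \<circ> translate \<delta> s = translate \<delta> s \<circ> ?g" using cross by simp
    qed
    have "?g (?d x) = a (2 * B + 1) (inv_map (a (2 * (B + 1) + 1)) x)" for x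
      unfolding tr_\<gamma> tr_\<delta> using a by (simp add: algebra_simps)
    then have gd: "?g \<circ> ?d = a (2 * B + 1) \<circ> inv_map (a (2 * (B + 1) + 1))" by auto
    have IH: "partial_product \<gamma> (E A b) \<circ> partial_product \<delta> (D A b)
        = a (2 * A) \<circ> inv_map (a (2 * B + 1))"
      using Suc.IH by (simp only: B_def)
    have "partial_product \<gamma> (E A (Suc b)) \<circ> partial_product \<delta> (D A (Suc b))
        = partial_product \<gamma> (E A b) \<circ> (?g \<circ> partial_product \<delta> (D A b)) \<circ> ?d"
      unfolding E D by (simp only: comp_assoc)
    also have "\<dots> = (partial_product \<gamma> (E A b) \<circ> partial_product \<delta> (D A b)) \<circ> (?g \<circ> ?d)"
      unfolding swap by (simp only: comp_assoc)
    also have "\<dots> = a (2 * A) \<circ> (inv_map (a (2 * B + 1)) \<circ> a (2 * B + 1)) \<circ> inv_map (a (2 * (B + 1) + 1))"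
      unfolding IH gd by (simp only: comp_assoc)
    also have "inv_map (a (2 * B + 1)) \<circ> a (2 * B + 1) = id"
      using a[of "2 * B + 1"] by (auto simp: fun_eq_iff)
    finally show ?case by (simp add: B_def algebra_simps)
  qed
  have "f x i = (lattice_map \<gamma> ?S \<circ> lattice_map \<delta> ?S) x i" if x: "x \<in> X" for x i
  proof -
    obtain F0 H0 where FH: "finite F0" "F0 \<subseteq> ?S" "finite H0" "H0 \<subseteq> ?S"
      "\<And>F H x. finite F \<Longrightarrow> F0 \<subseteq> F \<Longrightarrow> F \<subseteq> ?S \<Longrightarrow> finite H \<Longrightarrow> H0 \<subseteq> H \<Longrightarrow> H \<subseteq> ?S \<Longrightarrow> x \<in> X \<Longrightarrow>
         lattice_map \<gamma> ?S (lattice_map \<delta> ?S x) i = partial_product \<gamma> F (partial_product \<delta> H x) i"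
      using lattice_comp_truncate[OF \<gamma>g \<gamma>c \<delta>g \<delta>c] by metis
    obtain r where r: "r \<ge> 0" "F0 \<union> H0 \<subseteq> {-r..r}" using finite_subset_window[of "F0 \<union> H0"] FH by auto
    define K where "K = r + \<bar>i\<bar> + M + \<rho> + 1"
    have K: "K \<ge> 1" using r(1) M \<rho>(1) by (simp add: K_def)
    have pK: "K \<le> p * K" using p0 K by (simp add: mult_le_cancel_right1)
    have small: "k \<in> {-K..<K}" if "2 * p * k \<in> {-r..r}" for k
    proof -
      have "\<bar>2 * p * k\<bar> = (2 * p) * \<bar>k\<bar>" using p0 by (simp add: abs_mult)
      moreover have "1 * \<bar>k\<bar> \<le> (2 * p) * \<bar>k\<bar>" using p0 by (intro mult_right_mono) auto
      ultimately have "\<bar>k\<bar> \<le> r" using that by auto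
      then show ?thesis using M \<rho>(1) by (auto simp: K_def)
    qed
    let ?b = "nat (2 * K)"
    have b: "- K + int ?b = K" using K by simp
    have cover: "F0 \<subseteq> E (-K) ?b" "H0 \<subseteq> D (-K) ?b"
    proof -
      have "s \<in> D (-K) ?b \<and> s \<in> E (-K) ?b" if s: "s \<in> F0 \<union> H0" for s
      proof -
        obtain k where k: "s = 2 * p * k" using S FH(2,4) s by blast
        then have "k \<in> {-K..<K}" using small s r(2) by blast
        then show ?thesis unfolding D_def E_def b k by auto
      qed
      then show "F0 \<subseteq> E (-K) ?b" "H0 \<subseteq> D (-K) ?b" by auto
    qed
    let ?z = "inv_map (a (2 * K + 1)) x"
    have z: "?z \<in> X" using ai x by simp
    have "(lattice_map \<gamma> ?S \<circ> lattice_map \<delta> ?S) x i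
        = (partial_product \<gamma> (E (-K) ?b) \<circ> partial_product \<delta> (D (-K) ?b)) x i"
      using FH(5)[OF ED(1) cover(1) ED(3) ED(2) cover(2) ED(4) x] by simp
    also have "\<dots> = a (2 * - K) ?z i" unfolding telescope b by simp
    also have "\<dots> = f ?z i"
    proof (rule a_right[OF z])
      show "2 * - K * p + M < i" using pK r(1) \<rho>(1) M by (simp add: K_def algebra_simps)
    qed
    also have "\<dots> = f x i"
    proof (rule radiusD[OF \<rho>(2) z x], rule agreeI, rule ai_left[OF x])
      fix j assume j: "j \<in> {i - \<rho>..i + \<rho>}"
      have "(2 * K + 1) * p = 2 * (p * K) + p" by (simp add: algebra_simps)
      then have "K \<le> (2 * K + 1) * p" using pK K p0 by linarith
      moreover have "K = r + \<bar>i\<bar> + M + \<rho> + 1" "j \<le> i + \<rho>" using j by (auto simp: K_def)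
      ultimately show "j < (2 * K + 1) * p - M" using r(1) abs_ge_self[of i] by linarith
    qed
    finally show ?thesis by simp
  qed
  then have "f = lattice_map \<gamma> ?S \<circ> lattice_map \<delta> ?S"
    using f autos_comp[OF lattice_autos[OF \<gamma>g \<gamma>c] lattice_autos[OF \<delta>g \<delta>c]]
    by (intro permutes_eqI[OF autos_permutes autos_permutes])
  then show ?thesis using that[OF \<gamma>g \<delta>g N(1) \<gamma>c \<delta>c] by blast
qed

end

section \<open>The three groups coincide\<close>

context compact_shift_space
begin

lemma gate_lattices_carrier: "gate_lattices X \<subseteq> carrier (BijGroup X)"
  unfolding gate_lattices_eq BijGroup_def using restrict_autos_Bij lattice_autos by auto

lemma even_gate_lattices_subset: "even_gate_lattices X \<subseteq> gate_lattices X"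
  unfolding even_gate_lattices_eq gate_lattices_eq by blast

lemma inert_in_gate_lattice_group:
  assumes "inert X n f" "n \<ge> 1" shows "f \<in> gate_lattice_group X"
proof -
  obtain \<phi> c M where \<phi>: "\<phi> \<in> autos X" "f = restrict \<phi> X"
    "\<And>x. x \<in> X \<Longrightarrow> \<phi> (shift (int n) x) = shift (int n) (\<phi> x)"
    and c: "c \<in> autos X" "M \<ge> 0" "\<And>x i. x \<in> X \<Longrightarrow> i < -M \<Longrightarrow> c x i = x i"
    "\<And>x i. x \<in> X \<Longrightarrow> i > M \<Longrightarrow> c x i = \<phi> x i"
    by (rule inert_cut[OF assms]) blast
  obtain \<gamma> \<delta> N where g: "\<gamma> \<in> gates" "\<delta> \<in> gates" "N \<ge> 1" "commuting \<gamma> (progression N 0)"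
    "commuting \<delta> (progression N 0)"
    and \<phi>_eq: "\<phi> = lattice_map \<gamma> (progression N 0) \<circ> lattice_map \<delta> (progression N 0)"
    by (rule cut_decomposition[OF \<phi>(1) assms(2) \<phi>(3) c]) blast
  have "restrict (lattice_map \<gamma> (progression N 0)) X \<in> gate_lattice_group X"
    "restrict (lattice_map \<delta> (progression N 0)) X \<in> gate_lattice_group X"
    unfolding gate_lattice_group_def using g by (auto simp: gate_lattices_eq intro!: generate.incl)
  then show ?thesis
    unfolding \<phi>(2) \<phi>_eq gate_lattice_group_def
    by (intro generate_restrict_comp lattice_autos g)
qed

end

theorem theorem5:
  fixes A :: "'a set" and X :: "(int \<Rightarrow> 'a) set"
  assumes "mixing_SFT A X"
  shows "SIAut X = gate_lattice_group X \<and> gate_lattice_group X = even_gate_lattice_group X"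
proof -
  have SFT: "SFT A X" and sub: "subshift A X" using assms by (auto simp: mixing_SFT_def SFT_def)
  obtain G :: "(nat, nat) pre_digraph" and h where G: "essential_graph G"
    and conj: "conjugacy X (shift 1) (edge_shift G) (shift 1) h"
    using assms by (auto simp: mixing_SFT_def)
  interpret compact_shift_space X
    by unfold_locales (rule subshift_compact[OF sub], rule subshift_shift[OF sub])
  interpret B: group "BijGroup X" by (rule group_BijGroup)
  have A: "finite A" "X \<subseteq> full_shift A"
    using sub closedin_subset[of "config_topology (full_shift A)" X] by (auto simp: subshift_def)
  obtain w where w: "gluing X w" by (rule SFT_glue[OF SFT])
  have gl: "subgroup (gate_lattice_group X) (BijGroup X)"
    unfolding gate_lattice_group_def by (rule B.generate_is_subgroup[OF gate_lattices_carrier])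
  have el: "subgroup (even_gate_lattice_group X) (BijGroup X)"
    unfolding even_gate_lattice_group_def using even_gate_lattices_subset gate_lattices_carrier
    by (intro B.generate_is_subgroup) blast
  have inerts: "{f. \<exists>n\<ge>1. inert X n f} \<subseteq> gate_lattice_group X"
    using inert_in_gate_lattice_group by blast
  then have "{f. \<exists>n\<ge>1. inert X n f} \<subseteq> carrier (BijGroup X)"
    using subgroup.subset[OF gl] by blast
  then have sl: "subgroup (SIAut X) (BijGroup X)"
    unfolding SIAut_eq by (rule B.generate_is_subgroup)
  have "gate_lattice_group X \<subseteq> SIAut X"
    unfolding gate_lattice_group_def
  proof (rule B.generate_subgroup_incl[OF _ sl])
    show "gate_lattices X \<subseteq> SIAut X"
      unfolding gate_lattices_eq using gate_lattice_in_SIAut[OF G conj] by blast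
  qed
  moreover have "SIAut X \<subseteq> gate_lattice_group X"
    unfolding SIAut_eq by (rule B.generate_subgroup_incl[OF inerts gl])
  moreover have "even_gate_lattice_group X \<subseteq> gate_lattice_group X"
    unfolding gate_lattice_group_def even_gate_lattice_group_def
    by (rule B.mono_generate[OF even_gate_lattices_subset])
  moreover have "gate_lattice_group X \<subseteq> even_gate_lattice_group X"
    unfolding gate_lattice_group_def
  proof (rule B.generate_subgroup_incl[OF _ el])
    show "gate_lattices X \<subseteq> even_gate_lattice_group X"
      unfolding gate_lattices_eq using gate_lattice_in_even_group[OF A w] by blast
  qed
  ultimately show ?thesis by blast
qed

end
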